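(* Let $p$ be a prime and let $(G,\theta)$ be an oriented pro-$p$ group of elementary type (so $G$ is a pro-$p$ group of elementary type with associated orientation $\theta\colon G\to 1+p\mathbb{Z}_p$). If $p=2$, assume further that $\mathrm{Im}(\theta)\subseteq 1+4\mathbb{Z}_2$. Then $G$ satisfies the strong $n$-Massey vanishing property for every $n>2$.
   Context: All homomorphisms of pro-$p$ groups are continuous. $\mathbb{F}_p$ is the trivial $G$-module, cohomology is continuous cochain cohomology, and $\mathrm{H}^1(G,\mathbb{F}_p)=\mathrm{Hom}(G,\mathbb{F}_p)$. Massey products. Let $\mathfrak{C}^m$ be the space of continuous maps $G^m\to\mathbb{F}_p$. For $c\in\mathfrak{C}^1$, $\partial^1(c)(g_1,g_2)=c(g_1)-c(g_1g_2)+c(g_2)$; for $c'\in\mathfrak{C}^2$, $\partial^2(c')(g_1,g_2,g_3)=c'(g_1,g_2)-c'(g_1,g_2g_3)+c'(g_1g_2,g_3)-c'(g_2,g_3)$. $\mathrm{H}^2(G,\mathbb{F}_p)=\mathrm{Ker}(\partial^2)/\mathrm{Im}(\partial^1)$. For $c,c'\in\mathfrak{C}^1$, $(c\cdot c')(g_1,g_2)=c(g_1)c'(g_2)$; the cup product $\alpha\cup\alpha'$ of $\alpha,\alpha'\in\mathrm{H}^1(G,\mathbb{F}_p)$ is the class of $\alpha\cdot\alpha'$. For $n\ge 2$ and $\alpha_1,\dots,\alpha_n\in\mathrm{H}^1(G,\mathbb{F}_p)$, a defining set is a collection $(c_{ij})_{1\le i\le j\le n}$ in $\mathfrak{C}^1$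 with $c_{ii}=\alpha_i$ for all $i$ and $\partial^1(c_{ij})=\sum_{h=i}^{j-1}c_{i,h}\cdot c_{h+1,j}$ for all $i<j$, $(i,j)\neq(1,n)$. Its value is the class of $\sum_{h=1}^{n-1}c_{1,h}\cdot c_{h+1,n}$ in $\mathrm{H}^2(G,\mathbb{F}_p)$. The $n$-fold Massey product $\langle\alpha_1,\dots,\alpha_n\rangle\subseteq\mathrm{H}^2(G,\mathbb{F}_p)$ is the (possibly empty) set of values of all defining sets; it vanishes if it contains $0$. For $n>2$, $G$ satisfies the strong $n$-Massey vanishing property if $\langle\alpha_1,\dots,\alpha_n\rangle$ contains $0$ for every sequence $\alpha_1,\dots,\alpha_n$ in $\mathrm{H}^1(G,\mathbb{F}_p)$ with $\alpha_i\cup\alpha_{i+1}=0$ for $i=1,\dots,n-1$. Oriented pro-$p$ groups. $1+p\mathbb{Z}_p$ is the multiplicative group of principal units of $\mathbb{Z}_p$. An orientation of a pro-$p$ group $G$ is a homomorphism of pro-$p$ groups $\theta\colon G\to1+p\mathbb{Z}_p$; $(G,\theta)$ is then an oriented pro-$p$ group. - Semidirect product: for an oriented pro-$p$ group $(G_0,\theta)$ and a free abelian pro-$p$ group $A$, $A\rtimes_\theta G_0$ is the semidirect product with action $gag^{-1}=a^{\theta(g)}$ ($g\in G_0$, $a\in A$), with orientation $\tilde\theta=\theta\circ\pi$, $\pi\colon A\rtimes_\theta G_0\to G_0$ the canonical projection. - Free product: for $(G_1,\theta_1),(G_2,\theta_2)$, the free pro-$p$ product $G_1\ast G_2$ with the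 orientation induced by $\theta_1,\theta_2$ via the universal property. Demushkin groups. A pro-$p$ group $G$ is Demushkin if $\dim\mathrm{H}^1(G,\mathbb{F}_p)<\infty$, $\mathrm{H}^2(G,\mathbb{F}_p)\simeq\mathbb{F}_p$, and the cup product $\mathrm{H}^1\times\mathrm{H}^1\to\mathrm{H}^2$ is a non-degenerate bilinear form. It has a canonical orientation $\theta_G$ (Serre), which is the unique orientation such that for all $m\ge1$ the natural map $\mathrm{H}^1(G,\mathbb{Z}_p(\theta_G)/p^m)\to\mathrm{H}^1(G,\mathbb{F}_p)$ is surjective, where $\mathbb{Z}_p(\theta_G)$ is $\mathbb{Z}_p$ with action $g\cdot m=\theta_G(g)m$. If $p$ is odd, or $p=2$ and $\mathrm{Im}(\theta_G)\subseteq1+4\mathbb{Z}_2$, then $G=\langle x_1,\dots,x_d\mid x_1^{p^f}[x_1,x_2]\cdots[x_{d-1},x_d]=1\rangle$ with $d$ even, $f\in\mathbb{N}\cup\{\infty\}$, $\mathrm{Im}(\theta_G)=1+p^f\mathbb{Z}_p$ (with $p^\infty=0$), $\theta_G(x_2)=1+p^f$ and $\theta_G(x_h)=1$ for $h\ne2$; here $[g,h]=ghg^{-1}h^{-1}$. Elementary type. The family of oriented pro-$p$ groups of elementary type is the smallest family of oriented pro-$p$ groups containing (a) every $(F,\theta)$ with $F$ a finitely generated free pro-$p$ group and $\theta$ an arbitrary orientation, and (b) every Demushkin group with its canonical orientation $(G,\theta_G)$; and closed under (c) $(G_0,\theta)\mapsto(\mathbb{Z}_p\rtimes_\theta G_0,\tilde\theta)$,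 and (d) free products $(G_1\ast G_2,\theta)$ of two members. *)

theory Defs
  imports "HOL-Analysis.Analysis" "HOL-Algebra.Elementary_Groups" "HOL-Algebra.Ring"
begin

section \<open>Pro-p groups\<close>

record 'a topgroup = "'a monoid" +
  gtop :: "'a topology"

definition topological_group :: "'a topgroup \<Rightarrow> bool" where
  "topological_group G \<longleftrightarrow>
     group G \<and> topspace (gtop G) = carrier G \<and>
     continuous_map (prod_topology (gtop G) (gtop G)) (gtop G) (\<lambda>(x, y). x \<otimes>\<^bsub>G\<^esub> y) \<and>
     continuous_map (gtop G) (gtop G) (\<lambda>x. inv\<^bsub>G\<^esub> x)"

definition profinite_group :: "'a topgroup \<Rightarrow> bool" where
  "profinite_group G \<longleftrightarrow>
     topological_group G \<and> compact_space (gtop G) \<and> Hausdorff_space (gtop G) \<and>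
     (\<forall>U. openin (gtop G) U \<and> \<one>\<^bsub>G\<^esub> \<in> U \<longrightarrow>
        (\<exists>V. subgroup V G \<and> openin (gtop G) V \<and> V \<subseteq> U))"

definition pro_p_group :: "nat \<Rightarrow> 'a topgroup \<Rightarrow> bool" where
  "pro_p_group p G \<longleftrightarrow>
     profinite_group G \<and>
     (\<forall>N. N \<lhd> G \<and> openin (gtop G) N \<longrightarrow> (\<exists>k. card (rcosets\<^bsub>G\<^esub> N) = p ^ k))"

definition cont_hom :: "'a topgroup \<Rightarrow> 'b topgroup \<Rightarrow> ('a \<Rightarrow> 'b) set" where
  "cont_hom G H = {f \<in> hom G H. continuous_map (gtop G) (gtop H) f}"


section \<open>The p-adic integers and orientations\<close>

text \<open>$\mathbb{Z}_p$ is the inverse limit of the rings $\mathbb{Z}/p^n$: an element is the sequence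
  of its residues, \<open>x n \<in> {0..<p^n}\<close> being the residue modulo \<open>p^n\<close>.\<close>

definition Zp :: "nat \<Rightarrow> (nat \<Rightarrow> int) ring" where
  "Zp p = \<lparr>carrier = {x. \<forall>n. x n \<in> {0..<int p ^ n} \<and> x (Suc n) mod int p ^ n = x n},
           mult = (\<lambda>x y n. (x n * y n) mod int p ^ n),
           one = (\<lambda>n. 1 mod int p ^ n),
           zero = (\<lambda>n. 0),
           add = (\<lambda>x y n. (x n + y n) mod int p ^ n)\<rparr>"

definition Zp_top :: "nat \<Rightarrow> (nat \<Rightarrow> int) topology" where
  "Zp_top p = subtopology (product_topology (\<lambda>n. discrete_topology {0..<int p ^ n}) UNIV)
                (carrier (Zp p))"

text \<open>The set $1 + p^k\mathbb{Z}_p$.\<close>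

definition one_plus :: "nat \<Rightarrow> nat \<Rightarrow> (nat \<Rightarrow> int) set" where
  "one_plus p k = {\<one>\<^bsub>Zp p\<^esub> \<oplus>\<^bsub>Zp p\<^esub> [(p ^ k)] \<cdot>\<^bsub>Zp p\<^esub> y | y. y \<in> carrier (Zp p)}"

definition principal_units :: "nat \<Rightarrow> (nat \<Rightarrow> int) topgroup" where
  "principal_units p = \<lparr>carrier = one_plus p 1, mult = mult (Zp p), one = one (Zp p),
                        gtop = subtopology (Zp_top p) (one_plus p 1)\<rparr>"

definition oriented_pro_p :: "nat \<Rightarrow> 'a topgroup \<Rightarrow> ('a \<Rightarrow> nat \<Rightarrow> int) \<Rightarrow> bool" where
  "oriented_pro_p p G \<theta> \<longleftrightarrow> pro_p_group p G \<and> \<theta> \<in> cont_hom G (principal_units p)"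

definition oriented_iso ::
  "'a topgroup \<Rightarrow> ('a \<Rightarrow> nat \<Rightarrow> int) \<Rightarrow> 'b topgroup \<Rightarrow> ('b \<Rightarrow> nat \<Rightarrow> int) \<Rightarrow> bool" where
  "oriented_iso G \<theta> H \<eta> \<longleftrightarrow>
     (\<exists>f. f \<in> iso G H \<and> homeomorphic_map (gtop G) (gtop H) f \<and>
          (\<forall>x\<in>carrier G. \<eta> (f x) = \<theta> x))"


section \<open>Continuous cochains\<close>

text \<open>Continuous functions from a space into the discrete group $\mathbb{Z}/q$, whose elements are the
  residues \<open>{0..<q}\<close>.  Cochains are extensional, so that equality of cochains is equality of HOL
  functions; $\mathfrak{C}^m$ is \<open>cochains p\<close> of the m-fold product of the group.\<close>

definition cochains :: "nat \<Rightarrow> 'x topology \<Rightarrow> ('x \<Rightarrow> int) set" where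
  "cochains q X = {c \<in> extensional (topspace X).
                     continuous_map X (discrete_topology {0..<int q}) c}"

definition cochain_group :: "nat \<Rightarrow> 'x topology \<Rightarrow> ('x \<Rightarrow> int) monoid" where
  "cochain_group q X = \<lparr>carrier = cochains q X,
                        mult = (\<lambda>c c'. \<lambda>x\<in>topspace X. (c x + c' x) mod int q),
                        one = (\<lambda>x\<in>topspace X. 0)\<rparr>"

abbreviation C1 :: "nat \<Rightarrow> 'a topgroup \<Rightarrow> ('a \<Rightarrow> int) set" where
  "C1 p G \<equiv> cochains p (gtop G)"

abbreviation C2 :: "nat \<Rightarrow> 'a topgroup \<Rightarrow> ('a \<times> 'a \<Rightarrow> int) set" where
  "C2 p G \<equiv> cochains p (prod_topology (gtop G) (gtop G))"

definition d1 :: "nat \<Rightarrow> 'a topgroup \<Rightarrow> ('a \<Rightarrow> int) \<Rightarrow> 'a \<times> 'a \<Rightarrow> int" where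
  "d1 p G c = (\<lambda>(g1, g2)\<in>carrier G \<times> carrier G. (c g1 - c (g1 \<otimes>\<^bsub>G\<^esub> g2) + c g2) mod int p)"

definition d2 :: "nat \<Rightarrow> 'a topgroup \<Rightarrow> ('a \<times> 'a \<Rightarrow> int) \<Rightarrow> 'a \<times> 'a \<times> 'a \<Rightarrow> int" where
  "d2 p G c = (\<lambda>(g1, g2, g3)\<in>carrier G \<times> carrier G \<times> carrier G.
     (c (g1, g2) - c (g1, g2 \<otimes>\<^bsub>G\<^esub> g3) + c (g1 \<otimes>\<^bsub>G\<^esub> g2, g3) - c (g2, g3)) mod int p)"

definition Z2 :: "nat \<Rightarrow> 'a topgroup \<Rightarrow> ('a \<times> 'a \<Rightarrow> int) monoid" where
  "Z2 p G = (cochain_group p (prod_topology (gtop G) (gtop G)))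
     \<lparr>carrier := {c \<in> C2 p G. d2 p G c = (\<lambda>x\<in>carrier G \<times> carrier G \<times> carrier G. 0)}\<rparr>"

definition B2 :: "nat \<Rightarrow> 'a topgroup \<Rightarrow> ('a \<times> 'a \<Rightarrow> int) set" where
  "B2 p G = d1 p G ` C1 p G"

definition H1 :: "nat \<Rightarrow> 'a topgroup \<Rightarrow> ('a \<Rightarrow> int) set" where
  "H1 p G = hom G (integer_mod_group p) \<inter> C1 p G"

definition H2 :: "nat \<Rightarrow> 'a topgroup \<Rightarrow> ('a \<times> 'a \<Rightarrow> int) set monoid" where
  "H2 p G = Z2 p G Mod B2 p G"

definition class2 :: "nat \<Rightarrow> 'a topgroup \<Rightarrow> ('a \<times> 'a \<Rightarrow> int) \<Rightarrow> ('a \<times> 'a \<Rightarrow> int) set" where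
  "class2 p G z = B2 p G #>\<^bsub>Z2 p G\<^esub> z"

definition cprod :: "nat \<Rightarrow> 'a topgroup \<Rightarrow> ('a \<Rightarrow> int) \<Rightarrow> ('a \<Rightarrow> int) \<Rightarrow> 'a \<times> 'a \<Rightarrow> int" where
  "cprod p G c c' = (\<lambda>(g1, g2)\<in>carrier G \<times> carrier G. (c g1 * c' g2) mod int p)"

definition cup :: "nat \<Rightarrow> 'a topgroup \<Rightarrow> ('a \<Rightarrow> int) \<Rightarrow> ('a \<Rightarrow> int) \<Rightarrow> ('a \<times> 'a \<Rightarrow> int) set" where
  "cup p G \<alpha> \<beta> = class2 p G (cprod p G \<alpha> \<beta>)"


section \<open>Massey products\<close>

text \<open>The 2-cochain $\sum_{h=i}^{j-1} c_{i,h}\cdot c_{h+1,j}$.\<close>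

definition massey_sum ::
  "nat \<Rightarrow> 'a topgroup \<Rightarrow> (nat \<Rightarrow> nat \<Rightarrow> 'a \<Rightarrow> int) \<Rightarrow> nat \<Rightarrow> nat \<Rightarrow> 'a \<times> 'a \<Rightarrow> int" where
  "massey_sum p G c i j =
     (\<lambda>x\<in>carrier G \<times> carrier G. (\<Sum>h = i..<j. cprod p G (c i h) (c (Suc h) j) x) mod int p)"

definition defining_set ::
  "nat \<Rightarrow> 'a topgroup \<Rightarrow> nat \<Rightarrow> (nat \<Rightarrow> 'a \<Rightarrow> int) \<Rightarrow> (nat \<Rightarrow> nat \<Rightarrow> 'a \<Rightarrow> int) \<Rightarrow> bool" where
  "defining_set p G n \<alpha> c \<longleftrightarrow>
     (\<forall>i j. 1 \<le> i \<and> i \<le> j \<and> j \<le> n \<longrightarrow> c i j \<in> C1 p G) \<and>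
     (\<forall>i\<in>{1..n}. c i i = \<alpha> i) \<and>
     (\<forall>i j. 1 \<le> i \<and> i < j \<and> j \<le> n \<and> (i, j) \<noteq> (1, n) \<longrightarrow> d1 p G (c i j) = massey_sum p G c i j)"

definition massey_product ::
  "nat \<Rightarrow> 'a topgroup \<Rightarrow> nat \<Rightarrow> (nat \<Rightarrow> 'a \<Rightarrow> int) \<Rightarrow> ('a \<times> 'a \<Rightarrow> int) set set" where
  "massey_product p G n \<alpha> = {class2 p G (massey_sum p G c 1 n) | c. defining_set p G n \<alpha> c}"

definition strong_massey_vanishing :: "nat \<Rightarrow> nat \<Rightarrow> 'a topgroup \<Rightarrow> bool" where
  "strong_massey_vanishing p n G \<longleftrightarrow>
     (\<forall>\<alpha>. (\<forall>i\<in>{1..n}. \<alpha> i \<in> H1 p G) \<and>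
          (\<forall>i\<in>{1..n-1}. cup p G (\<alpha> i) (\<alpha> (Suc i)) = \<one>\<^bsub>H2 p G\<^esub>) \<longrightarrow>
          \<one>\<^bsub>H2 p G\<^esub> \<in> massey_product p G n \<alpha>)"


section \<open>Demushkin groups\<close>

definition H1_finite_dim :: "nat \<Rightarrow> 'a topgroup \<Rightarrow> bool" where
  "H1_finite_dim p G \<longleftrightarrow>
     (\<exists>B. finite B \<and> B \<subseteq> H1 p G \<and>
          (\<forall>\<alpha>\<in>H1 p G. \<exists>k. \<alpha> = (\<lambda>g\<in>carrier G. (\<Sum>\<beta>\<in>B. k \<beta> * \<beta> g) mod int p)))"

definition demushkin :: "nat \<Rightarrow> 'a topgroup \<Rightarrow> bool" where
  "demushkin p G \<longleftrightarrow>
     pro_p_group p G \<and> H1_finite_dim p G \<and> H2 p G \<cong> integer_mod_group p \<and>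
     (\<forall>\<alpha>\<in>H1 p G. (\<forall>\<beta>\<in>H1 p G. cup p G \<alpha> \<beta> = \<one>\<^bsub>H2 p G\<^esub>) \<longrightarrow> \<alpha> = (\<lambda>g\<in>carrier G. 0)) \<and>
     (\<forall>\<beta>\<in>H1 p G. (\<forall>\<alpha>\<in>H1 p G. cup p G \<alpha> \<beta> = \<one>\<^bsub>H2 p G\<^esub>) \<longrightarrow> \<beta> = (\<lambda>g\<in>carrier G. 0))"

text \<open>First cohomology of $\mathbb{Z}_p(\theta)/p^m$: the underlying group is $\mathbb{Z}/p^m$ and \<open>g\<close> acts as
  multiplication by \<open>\<theta> g m\<close>, the residue of \<open>\<theta> g\<close> modulo \<open>p^m\<close>.\<close>

definition Z1_tw :: "nat \<Rightarrow> 'a topgroup \<Rightarrow> ('a \<Rightarrow> nat \<Rightarrow> int) \<Rightarrow> nat \<Rightarrow> ('a \<Rightarrow> int) monoid" where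
  "Z1_tw p G \<theta> m = (cochain_group (p ^ m) (gtop G))
     \<lparr>carrier := {c \<in> cochains (p ^ m) (gtop G).
        \<forall>g\<in>carrier G. \<forall>h\<in>carrier G. c (g \<otimes>\<^bsub>G\<^esub> h) = (c g + \<theta> g m * c h) mod int p ^ m}\<rparr>"

definition B1_tw :: "nat \<Rightarrow> 'a topgroup \<Rightarrow> ('a \<Rightarrow> nat \<Rightarrow> int) \<Rightarrow> nat \<Rightarrow> ('a \<Rightarrow> int) set" where
  "B1_tw p G \<theta> m = {\<lambda>g\<in>carrier G. (\<theta> g m * a - a) mod int p ^ m | a. a \<in> {0..<int p ^ m}}"

definition H1_tw :: "nat \<Rightarrow> 'a topgroup \<Rightarrow> ('a \<Rightarrow> nat \<Rightarrow> int) \<Rightarrow> nat \<Rightarrow> ('a \<Rightarrow> int) set monoid" where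
  "H1_tw p G \<theta> m = Z1_tw p G \<theta> m Mod B1_tw p G \<theta> m"

text \<open>The natural map sends the class \<open>C\<close> to the common reduction modulo \<open>p\<close> of its members: as
  \<open>\<theta> g\<close> is congruent to 1 modulo \<open>p\<close>, coboundaries reduce to 0.\<close>

definition reduction_surj :: "nat \<Rightarrow> 'a topgroup \<Rightarrow> ('a \<Rightarrow> nat \<Rightarrow> int) \<Rightarrow> nat \<Rightarrow> bool" where
  "reduction_surj p G \<theta> m \<longleftrightarrow>
     (\<forall>\<alpha>\<in>H1 p G. \<exists>C\<in>carrier (H1_tw p G \<theta> m). (\<lambda>c. \<lambda>g\<in>carrier G. c g mod int p) ` C = {\<alpha>})"

definition canonical_orientation :: "nat \<Rightarrow> 'a topgroup \<Rightarrow> ('a \<Rightarrow> nat \<Rightarrow> int) \<Rightarrow> bool" where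
  "canonical_orientation p G \<theta> \<longleftrightarrow>
     \<theta> \<in> cont_hom G (principal_units p) \<and> (\<forall>m\<ge>1. reduction_surj p G \<theta> m)"


section \<open>Free pro-p groups, free products and semidirect products\<close>

text \<open>In the universal properties the target \<open>H\<close> runs over the pro-p groups whose elements are
  sequences of integers.  Up to isomorphism these include all countably based, hence all finitely
  generated, pro-p groups (inverse limits of sequences of finite p-groups), and also
  \<open>principal_units p\<close>.  When the source is (topologically) finitely generated, as it always is below,
  every continuous homomorphism from it has finitely generated image, so the restriction on \<open>H\<close>
  loses nothing.\<close>

definition free_pro_p_on :: "nat \<Rightarrow> 'a topgroup \<Rightarrow> 'a set \<Rightarrow> bool" where
  "free_pro_p_on p F X \<longleftrightarrow>
     pro_p_group p F \<and> X \<subseteq> carrier F \<and>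
     (\<forall>H :: (nat \<Rightarrow> int) topgroup. pro_p_group p H \<longrightarrow>
        (\<forall>\<phi>\<in>X \<rightarrow> carrier H.
           \<exists>!f. f \<in> cont_hom F H \<inter> extensional (carrier F) \<and> (\<forall>x\<in>X. f x = \<phi> x)))"

definition free_pro_p_product ::
  "nat \<Rightarrow> 'a topgroup \<Rightarrow> 'b topgroup \<Rightarrow> 'c topgroup \<Rightarrow> ('a \<Rightarrow> 'c) \<Rightarrow> ('b \<Rightarrow> 'c) \<Rightarrow> bool" where
  "free_pro_p_product p G1 G2 G \<iota>1 \<iota>2 \<longleftrightarrow>
     pro_p_group p G \<and> \<iota>1 \<in> cont_hom G1 G \<and> \<iota>2 \<in> cont_hom G2 G \<and>
     (\<forall>H :: (nat \<Rightarrow> int) topgroup. pro_p_group p H \<longrightarrow>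
        (\<forall>f1\<in>cont_hom G1 H. \<forall>f2\<in>cont_hom G2 H.
           \<exists>!f. f \<in> cont_hom G H \<inter> extensional (carrier G) \<and>
                (\<forall>x\<in>carrier G1. f (\<iota>1 x) = f1 x) \<and> (\<forall>x\<in>carrier G2. f (\<iota>2 x) = f2 x)))"

text \<open>$\mathbb{Z}_p \rtimes_\theta G_0$, with $\mathbb{Z}_p$ written additively.\<close>

definition Zp_semidirect ::
  "nat \<Rightarrow> 'a topgroup \<Rightarrow> ('a \<Rightarrow> nat \<Rightarrow> int) \<Rightarrow> ((nat \<Rightarrow> int) \<times> 'a) topgroup" where
  "Zp_semidirect p G0 \<theta> =
     \<lparr>carrier = carrier (Zp p) \<times> carrier G0,
      mult = (\<lambda>(a, g) (b, h). (a \<oplus>\<^bsub>Zp p\<^esub> (\<theta> g \<otimes>\<^bsub>Zp p\<^esub> b), g \<otimes>\<^bsub>G0\<^esub> h)),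
      one = (\<zero>\<^bsub>Zp p\<^esub>, \<one>\<^bsub>G0\<^esub>),
      gtop = prod_topology (Zp_top p) (gtop G0)\<rparr>"


section \<open>Oriented pro-p groups of elementary type\<close>

text \<open>The family is closed under isomorphism of oriented pro-p groups, and is described here on a
  fixed type of elements.  No member is lost by this: \<open>G0\<close> embeds into its semidirect product and
  the free factors embed into their free product, so all groups occurring in the construction of
  \<open>G\<close> have copies on the element type of \<open>G\<close>.\<close>

inductive elementary_type :: "nat \<Rightarrow> 'a topgroup \<Rightarrow> ('a \<Rightarrow> nat \<Rightarrow> int) \<Rightarrow> bool" for p where
  free: "elementary_type p F \<theta>"
    if "finite X" "free_pro_p_on p F X" "oriented_pro_p p F \<theta>"
| demushkin: "elementary_type p G \<theta>"
    if "demushkin p G" "canonical_orientation p G \<theta>"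
| semidirect: "elementary_type p G \<theta>"
    if "elementary_type p G0 \<theta>0" "oriented_pro_p p G \<theta>"
       "oriented_iso (Zp_semidirect p G0 \<theta>0) (\<theta>0 \<circ> snd) G \<theta>"
| free_product: "elementary_type p G \<theta>"
    if "elementary_type p G1 \<theta>1" "elementary_type p G2 \<theta>2" "oriented_pro_p p G \<theta>"
       "free_pro_p_product p G1 G2 G \<iota>1 \<iota>2"
       "\<forall>x\<in>carrier G1. \<theta> (\<iota>1 x) = \<theta>1 x" "\<forall>x\<in>carrier G2. \<theta> (\<iota>2 x) = \<theta>2 x"

end

theory Submission
  imports Defs "HOL-Number_Theory.Cong" "HOL-Algebra.Product_Groups" "HOL-Computational_Algebra.Polynomial"
begin

text \<open>A Massey product of characters $\alpha_1,\dots,\alpha_n$ contains 0 exactly if there is a continuous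
  homomorphism from \<open>G\<close> to the unipotent upper triangular matrices over $\mathbb{F}_p$ with superdiagonal
  $-\alpha_1,\dots,-\alpha_n$.  So the task is to construct such homomorphisms whenever the neighbouring cup
  products vanish (\<open>massey_liftable\<close>).  If some $\alpha_i$ is 0 the matrix may be taken block diagonal, which
  always allows the restriction to segments of nonzero characters.  The construction follows the
  inductive description of groups of elementary type.

  For free groups and free products it is a lifting problem along a surjection of finite \<open>p\<close>-groups and
  is solved by the universal properties (\<open>free_pro_p_lifting\<close>, \<open>free_product_lifting\<close>).

  For a Demushkin group the matrix is built column by column, each column from bottom to top.  The
  obstruction to the next entry is a class in the second cohomology group, and it can be shifted by $\alpha_i\cup\beta$ for any character \<open>\<beta>\<close>; as $\alpha_i \neq 0$, duality makes
  $\alpha_i\cup{-}$ surjective and the obstruction can be removed (\<open>massey_column\<close>).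

  For $\mathbb{Z}_p \rtimes_\theta G_0$, vanishing of the cup products forces a segment of nonzero characters
  either to be inflated from $G_0$ or to consist of multiples of a single character \<open>\<epsilon>\<close>
  (\<open>split_cup_zero\<close>, \<open>split_massey_liftable\<close>).  In the second case the orientation is needed.  If \<open>\<epsilon>\<close>
  lifts to a cocycle \<open>B\<close> with values in $\mathbb{Z}_p(\theta)/p^m$, the group acts on $\mathbb{F}_p[x]/(x^{n+1})$
  by $F(x) \mapsto (1+x)^{B(g)} F((1+x)^{\theta(g)} - 1)$.  In the basis of powers of \<open>x\<close> this is triangular
  with superdiagonal entries \<open>\<epsilon>\<close>, provided that $\binom{\theta(g)}{2}$ is 0 modulo \<open>p\<close>; this holds for odd \<open>p\<close>,
  and for \<open>p = 2\<close> because $\theta(g) \equiv 1$ modulo 4 (\<open>massey_lift_proportional\<close>).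

  That characters lift to such cocycles (\<open>kummerian\<close>) is carried along in the induction: it is part of the
  definition of the canonical orientation of a Demushkin group, it follows from the universal properties for
  free groups and free products, and for $\mathbb{Z}_p \rtimes_\theta G_0$ the first coordinate is itself a
  cocycle.\<close>

section \<open>Continuous cochains\<close>

text \<open>Around each point the finitely many functions \<open>f i\<close> are constant on a common neighbourhood, so
  \<open>F\<close> is too.  Together with the next lemma this gives the continuity of the cochains and of the
  maps to finite groups constructed below, which are built from finitely many continuous cochains.\<close>

lemma continuous_map_discreteI:
  fixes f :: "'i \<Rightarrow> 'x \<Rightarrow> 'd"
  assumes "finite I"
    and f: "\<And>i. i \<in> I \<Longrightarrow> continuous_map X (discrete_topology (D i)) (f i)"
    and E: "\<And>x. x \<in> topspace X \<Longrightarrow> F x \<in> E"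
    and det: "\<And>x y. \<lbrakk>x \<in> topspace X; y \<in> topspace X; \<And>i. i \<in> I \<Longrightarrow> f i x = f i y\<rbrakk> \<Longrightarrow> F x = F y"
  shows "continuous_map X (discrete_topology E) F"
proof -
  have "openin X {x \<in> topspace X. F x \<in> V}" for V
  proof (subst openin_subopen, intro ballI)
    fix x assume x: "x \<in> {x \<in> topspace X. F x \<in> V}"
    define N where "N = (\<Inter>i\<in>I. {y \<in> topspace X. f i y \<in> {f i x}}) \<inter> topspace X"
    have "f i x \<in> D i" if "i \<in> I" for i
      using f[OF that] x by (auto simp: continuous_map_def)
    then have "openin X {y \<in> topspace X. f i y \<in> {f i x}}" if "i \<in> I" for i
      using openin_continuous_map_preimage[OF f[OF that], of "{f i x}"] that by simp
    then have "openin X N"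
      unfolding N_def using \<open>finite I\<close> by (intro openin_INT) auto
    moreover have "x \<in> N" using x by (auto simp: N_def)
    moreover have "N \<subseteq> {x \<in> topspace X. F x \<in> V}"
    proof
      fix y assume "y \<in> N"
      then have "F y = F x" using x by (intro det) (auto simp: N_def)
      then show "y \<in> {x \<in> topspace X. F x \<in> V}" using x \<open>y \<in> N\<close> by (auto simp: N_def)
    qed
    ultimately show "\<exists>T. openin X T \<and> x \<in> T \<and> T \<subseteq> {x \<in> topspace X. F x \<in> V}" by blast
  qed
  then show ?thesis using E by (auto simp: continuous_map_def)
qed

lemma continuous_map_discrete_pairI:
  fixes f g :: "'x \<Rightarrow> 'd"
  assumes f: "continuous_map X (discrete_topology D) f" and g: "continuous_map X (discrete_topology D') g"
    and E: "\<And>x. x \<in> topspace X \<Longrightarrow> F x \<in> E"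
    and det: "\<And>x y. \<lbrakk>x \<in> topspace X; y \<in> topspace X; f x = f y; g x = g y\<rbrakk> \<Longrightarrow> F x = F y"
  shows "continuous_map X (discrete_topology E) F"
proof (rule continuous_map_discreteI[of UNIV X "\<lambda>b. if b then D else D'" "\<lambda>b. if b then f else g"])
  fix x y assume "x \<in> topspace X" "y \<in> topspace X" "\<And>b. b \<in> UNIV \<Longrightarrow> (if b then f else g) x = (if b then f else g) y"
  from this(1,2) this(3)[of True] this(3)[of False] show "F x = F y" by (intro det) simp_all
qed (simp_all add: f g E)

lemma topspace_gtop: "topological_group G \<Longrightarrow> topspace (gtop G) = carrier G"
  by (simp add: topological_group_def)

lemma topological_group_group: "topological_group G \<Longrightarrow> group G"
  by (simp add: topological_group_def)

lemma topological_group_mult_closed: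
  "\<lbrakk>topological_group G; x \<in> carrier G; y \<in> carrier G\<rbrakk> \<Longrightarrow> x \<otimes>\<^bsub>G\<^esub> y \<in> carrier G"
  by (simp add: group.is_monoid monoid.m_closed topological_group_group)

lemma C1_iff:
  assumes "topological_group G"
  shows "c \<in> C1 p G \<longleftrightarrow> c \<in> extensional (carrier G) \<and> continuous_map (gtop G) (discrete_topology {0..<int p}) c"
  using assms by (simp add: cochains_def topspace_gtop)

lemma C1_range:
  assumes "topological_group G" "c \<in> C1 p G" "g \<in> carrier G"
  shows "0 \<le> c g" "c g < int p" "c g mod int p = c g"
  using assms by (auto simp: C1_iff continuous_map_def topspace_gtop Pi_iff)

lemma C1I:
  fixes f g :: "'a \<Rightarrow> 'd"
  assumes G: "topological_group G" and p: "p > 0"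
    and f: "continuous_map (gtop G) (discrete_topology D) f" and g: "continuous_map (gtop G) (discrete_topology D') g"
    and det: "\<And>x y. \<lbrakk>x \<in> carrier G; y \<in> carrier G; f x = f y; g x = g y\<rbrakk> \<Longrightarrow> F x = F y"
  shows "(\<lambda>x\<in>carrier G. F x mod int p) \<in> C1 p G"
proof -
  have "continuous_map (gtop G) (discrete_topology {0..<int p}) (\<lambda>x\<in>carrier G. F x mod int p)"
  proof (rule continuous_map_discrete_pairI[OF f g])
    fix x y assume "x \<in> topspace (gtop G)" "y \<in> topspace (gtop G)" "f x = f y" "g x = g y"
    then show "(\<lambda>x\<in>carrier G. F x mod int p) x = (\<lambda>x\<in>carrier G. F x mod int p) y"
      using det[of x y] by (simp add: topspace_gtop[OF G])
  qed (use p in \<open>simp add: topspace_gtop[OF G]\<close>)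
  then show ?thesis by (simp add: C1_iff[OF G])
qed

lemma C1_eqI:
  assumes "topological_group G" "c \<in> C1 p G" "c' \<in> C1 p G" 
    "\<And>g. g \<in> carrier G \<Longrightarrow> [c g = c' g] (mod int p)"
  shows "c = c'"
proof (rule extensionalityI[of _ "carrier G"])
  show "c g = c' g" if "g \<in> carrier G" for g
    using assms(4)[OF that] C1_range[OF assms(1,2) that] C1_range[OF assms(1,3) that]
    by (simp add: cong_def)
qed (use assms C1_iff in auto)

lemma H1_iff:
  assumes "topological_group G" "p > 0"
  shows "\<alpha> \<in> H1 p G \<longleftrightarrow> \<alpha> \<in> C1 p G \<and>
     (\<forall>g\<in>carrier G. \<forall>h\<in>carrier G. [\<alpha> (g \<otimes>\<^bsub>G\<^esub> h) = \<alpha> g + \<alpha> h] (mod int p))"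
proof -
  have "\<alpha> \<in> hom G (integer_mod_group p) \<longleftrightarrow> 
     (\<forall>g\<in>carrier G. \<forall>h\<in>carrier G. [\<alpha> (g \<otimes>\<^bsub>G\<^esub> h) = \<alpha> g + \<alpha> h] (mod int p))" if "\<alpha> \<in> C1 p G"
    using C1_range[OF assms(1) that] assms(2) topological_group_mult_closed[OF assms(1)]
    by (auto simp: hom_def carrier_integer_mod_group cong_def)
  then show ?thesis by (auto simp: H1_def)
qed

lemma H1_mult:
  assumes G: "topological_group G" and p: "p > 0" and \<alpha>: "\<alpha> \<in> H1 p G" and gh: "g \<in> carrier G" "h \<in> carrier G"
  shows "\<alpha> (g \<otimes>\<^bsub>G\<^esub> h) = (\<alpha> g + \<alpha> h) mod int p"
proof -
  have "\<alpha> \<in> C1 p G" "[\<alpha> (g \<otimes>\<^bsub>G\<^esub> h) = \<alpha> g + \<alpha> h] (mod int p)"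
    using \<alpha> gh by (simp_all add: H1_iff[OF G p])
  then show ?thesis
    using C1_range(3)[OF G _ topological_group_mult_closed[OF G gh]] by (simp add: cong_def)
qed

lemma C1_zero: "topological_group G \<Longrightarrow> p > 0 \<Longrightarrow> (\<lambda>g\<in>carrier G. 0) \<in> C1 p G"
  by (simp add: C1_iff) (rule continuous_map_eq[of _ _ "\<lambda>_. 0"], simp_all add: topspace_gtop)

lemma H1_zero: "topological_group G \<Longrightarrow> p > 0 \<Longrightarrow> (\<lambda>g\<in>carrier G. 0) \<in> H1 p G"
  by (simp add: H1_iff C1_zero topological_group_mult_closed)

lemma C1_add:
  assumes "topological_group G" "p > 0" "c \<in> C1 p G" "d \<in> C1 p G"
  shows "(\<lambda>g\<in>carrier G. (k * c g + l * d g) mod int p) \<in> C1 p G"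
  by (rule C1I[where f = c and g = d and D = "{0..<int p}" and D' = "{0..<int p}"])
     (use assms in \<open>simp_all add: C1_iff\<close>)

lemma H1_add:
  assumes "topological_group G" "p > 0" "c \<in> H1 p G" "d \<in> H1 p G"
  shows "(\<lambda>g\<in>carrier G. (k * c g + l * d g) mod int p) \<in> H1 p G"
proof -
  have "[k * c (g \<otimes>\<^bsub>G\<^esub> h) + l * d (g \<otimes>\<^bsub>G\<^esub> h) = (k * c g + l * d g) + (k * c h + l * d h)] (mod int p)"
    if "g \<in> carrier G" "h \<in> carrier G" for g h
  proof -
    have "[k * c (g \<otimes>\<^bsub>G\<^esub> h) + l * d (g \<otimes>\<^bsub>G\<^esub> h) = k * (c g + c h) + l * (d g + d h)] (mod int p)"
      using assms that by (intro cong_add cong_mult cong_refl) (auto simp: H1_iff)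
    then show ?thesis by (simp add: algebra_simps)
  qed
  then show ?thesis
    using assms C1_add[of G p c d k l]
    by (auto simp: H1_iff topological_group_mult_closed cong_def mod_simps)
qed

lemma H1_scale:
  assumes "topological_group G" "p > 0" "c \<in> H1 p G"
  shows "(\<lambda>g\<in>carrier G. (k * c g) mod int p) \<in> H1 p G"
  using H1_add[OF assms assms(3), of k 0] by simp

section \<open>Massey products and unipotent matrices\<close>

text \<open>Written out on elements, without reference to cohomology classes: \<open>c\<close> is a cochain whose
  coboundary is $\alpha\cdot\beta$.\<close>

definition cup_zero :: "nat \<Rightarrow> 'a topgroup \<Rightarrow> ('a \<Rightarrow> int) \<Rightarrow> ('a \<Rightarrow> int) \<Rightarrow> bool" where
  "cup_zero p G \<alpha> \<beta> \<longleftrightarrow> (\<exists>c\<in>C1 p G. \<forall>g\<in>carrier G. \<forall>h\<in>carrier G.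
     [c (g \<otimes>\<^bsub>G\<^esub> h) = c g + c h - \<alpha> g * \<beta> h] (mod int p))"

text \<open>The relation says that $g \mapsto I - (c_{ij}(g))$ is multiplicative, where $c_{ij}$ is placed in
  row \<open>i\<close> and column \<open>j + 1\<close> of an upper triangular matrix.  In contrast to a defining set, the corner
  entry is present and satisfies the relation as well, so this is a homomorphism to the full group of
  unipotent matrices.  The index interval is half-open in order that the empty block $\{a..<a\}$ is
  available when a matrix is cut into diagonal blocks.\<close>

definition unipotent_system :: "nat \<Rightarrow> 'a topgroup \<Rightarrow> nat \<Rightarrow> nat \<Rightarrow> (nat \<Rightarrow> nat \<Rightarrow> 'a \<Rightarrow> int) \<Rightarrow> bool" where
  "unipotent_system p G a b c \<longleftrightarrow> (\<forall>i j. a \<le> i \<and> i \<le> j \<and> j < b \<longrightarrow> c i j \<in> C1 p G \<and>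
     (\<forall>g\<in>carrier G. \<forall>h\<in>carrier G.
        [c i j (g \<otimes>\<^bsub>G\<^esub> h) = c i j g + c i j h - (\<Sum>k=i..<j. c i k g * c (Suc k) j h)] (mod int p)))"

definition massey_lift :: "nat \<Rightarrow> 'a topgroup \<Rightarrow> nat \<Rightarrow> nat \<Rightarrow> (nat \<Rightarrow> 'a \<Rightarrow> int) \<Rightarrow> bool" where
  "massey_lift p G a b \<alpha> \<longleftrightarrow> (\<exists>c. unipotent_system p G a b c \<and> (\<forall>i\<in>{a..<b}. c i i = \<alpha> i))"

text \<open>All intervals of indices are admitted, so that the property can be applied to segments of a sequence.\<close>

definition massey_liftable :: "nat \<Rightarrow> 'a topgroup \<Rightarrow> bool" where
  "massey_liftable p G \<longleftrightarrow> (\<forall>a b \<alpha>. (\<forall>i\<in>{a..<b}. \<alpha> i \<in> H1 p G) \<and>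
     (\<forall>i. a \<le> i \<and> Suc i < b \<longrightarrow> cup_zero p G (\<alpha> i) (\<alpha> (Suc i))) \<longrightarrow> massey_lift p G a b \<alpha>)"

lemma massey_liftableD:
  assumes "massey_liftable p G" "\<forall>i\<in>{a..<b}. \<alpha> i \<in> H1 p G"
    and "\<forall>i. a \<le> i \<and> Suc i < b \<longrightarrow> cup_zero p G (\<alpha> i) (\<alpha> (Suc i))"
  shows "massey_lift p G a b \<alpha>"
  using assms unfolding massey_liftable_def by blast

lemma d1_eq_iff:
  assumes G: "topological_group G" and p: "p > 0"
  shows "d1 p G c = (\<lambda>x\<in>carrier G \<times> carrier G. F x mod int p) \<longleftrightarrow>
    (\<forall>g\<in>carrier G. \<forall>h\<in>carrier G. [c (g \<otimes>\<^bsub>G\<^esub> h) = c g + c h - F (g, h)] (mod int p))" (is "?L \<longleftrightarrow> ?R")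
proof -
  have *: "(x - y + z) mod m = w mod m \<longleftrightarrow> [y = x + z - w] (mod m)" for x y z w m :: int
    unfolding cong_def mod_eq_dvd_iff
    by (subst (2) dvd_minus_iff[symmetric]) (simp add: algebra_simps)
  have "?L \<longleftrightarrow> (\<forall>g\<in>carrier G. \<forall>h\<in>carrier G. (c g - c (g \<otimes>\<^bsub>G\<^esub> h) + c h) mod int p = F (g,h) mod int p)"
  proof
    assume L: ?L
    show "\<forall>g\<in>carrier G. \<forall>h\<in>carrier G. (c g - c (g \<otimes>\<^bsub>G\<^esub> h) + c h) mod int p = F (g,h) mod int p"
    proof (intro ballI)
      fix g h assume "g \<in> carrier G" "h \<in> carrier G"
      then show "(c g - c (g \<otimes>\<^bsub>G\<^esub> h) + c h) mod int p = F (g,h) mod int p"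
        using fun_cong[OF L, of "(g, h)"] by (simp add: d1_def)
    qed
  next
    assume "\<forall>g\<in>carrier G. \<forall>h\<in>carrier G. (c g - c (g \<otimes>\<^bsub>G\<^esub> h) + c h) mod int p = F (g,h) mod int p"
    then show ?L unfolding d1_def by (intro restrict_ext) auto
  qed
  then show ?thesis by (simp only: *)
qed

lemma massey_sum_eq:
  "massey_sum p G c i j = (\<lambda>x\<in>carrier G \<times> carrier G. (\<Sum>k=i..<j. c i k (fst x) * c (Suc k) j (snd x)) mod int p)"
  unfolding massey_sum_def cprod_def by (intro restrict_ext) (auto simp: mod_sum_eq)

lemma cprod_eq: "cprod p G c d = (\<lambda>x\<in>carrier G \<times> carrier G. (c (fst x) * d (snd x)) mod int p)"
  unfolding cprod_def by (intro restrict_ext) auto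

lemma d1_add:
  assumes G: "topological_group G"
  shows "(\<lambda>x\<in>carrier G \<times> carrier G. (d1 p G b x + d1 p G c x) mod int p) =
     d1 p G (\<lambda>g\<in>carrier G. (b g + c g) mod int p)"
proof -
  have *: "((b1 - b12 + b2) mod m + (c1 - c12 + c2) mod m) mod m =
      ((b1 + c1) mod m - (b12 + c12) mod m + (b2 + c2) mod m) mod m" for b1 b12 b2 c1 c12 c2 m :: int
  proof -
    have "[(b1 - b12 + b2) mod m + (c1 - c12 + c2) mod m = (b1 - b12 + b2) + (c1 - c12 + c2)] (mod m)"
      by (intro cong_add) auto
    moreover have "[(b1 + c1) mod m - (b12 + c12) mod m + (b2 + c2) mod m = (b1 + c1) - (b12 + c12) + (b2 + c2)] (mod m)"
      by (intro cong_add cong_diff) auto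
    ultimately show ?thesis by (simp add: cong_def algebra_simps)
  qed
  show ?thesis
    unfolding d1_def by (intro restrict_ext) (auto simp: topological_group_mult_closed[OF G] *)
qed

lemma B2_coset:
  assumes G: "topological_group G"
  shows "class2 p G z = {(\<lambda>x\<in>carrier G \<times> carrier G. (d1 p G b x + z x) mod int p) | b. b \<in> C1 p G}"
  unfolding class2_def r_coset_def B2_def by (auto simp: Z2_def cochain_group_def topspace_gtop[OF G])

lemma one_H2: "\<one>\<^bsub>H2 p G\<^esub> = B2 p G"
  by (simp add: H2_def)

text \<open>Adding \<open>c\<close> is a bijection of the group of 1-cochains, so translation by \<open>d1 c\<close> permutes the
  coboundaries.\<close>

lemma class2_d1:
  assumes G: "topological_group G" and p: "p > 0" and c: "c \<in> C1 p G"
  shows "class2 p G (d1 p G c) = \<one>\<^bsub>H2 p G\<^esub>"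
proof -
  have "d1 p G b \<in> class2 p G (d1 p G c)" if b: "b \<in> C1 p G" for b
  proof -
    let ?b = "\<lambda>g\<in>carrier G. (1 * b g + (-1) * c g) mod int p"
    have "?b \<in> C1 p G" by (rule C1_add[OF G p b c])
    moreover have "(\<lambda>g\<in>carrier G. (?b g + c g) mod int p) = b"
      using b C1_range[OF G b] by (intro extensionalityI[of _ "carrier G"]) (auto simp: C1_iff[OF G] mod_simps)
    ultimately show ?thesis unfolding B2_coset[OF G] d1_add[OF G] by force
  qed
  moreover have "x \<in> B2 p G" if x: "x \<in> class2 p G (d1 p G c)" for x
  proof -
    obtain b where b: "b \<in> C1 p G" "x = d1 p G (\<lambda>g\<in>carrier G. (b g + c g) mod int p)"
      using x unfolding B2_coset[OF G] d1_add[OF G] by blast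
    have "(\<lambda>g\<in>carrier G. (1 * b g + 1 * c g) mod int p) \<in> C1 p G"
      by (rule C1_add[OF G p b(1) c])
    then show ?thesis using b(2) by (simp add: B2_def)
  qed
  ultimately show ?thesis unfolding one_H2 B2_def by blast
qed

lemma d1_zero: "topological_group G \<Longrightarrow> d1 p G (\<lambda>g\<in>carrier G. 0) = (\<lambda>x\<in>carrier G \<times> carrier G. 0)"
  by (intro ext) (auto simp: d1_def restrict_def topological_group_mult_closed)

lemma class2_self:
  assumes G: "topological_group G" and p: "p > 0"
  shows "(\<lambda>x\<in>carrier G \<times> carrier G. F x mod int p) \<in> class2 p G (\<lambda>x\<in>carrier G \<times> carrier G. F x mod int p)"
proof -
  let ?F = "\<lambda>x\<in>carrier G \<times> carrier G. F x mod int p"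
  have "?F = (\<lambda>x\<in>carrier G \<times> carrier G. (d1 p G (\<lambda>g\<in>carrier G. 0) x + ?F x) mod int p)"
    unfolding d1_zero[OF G] by (intro restrict_ext) simp
  then show ?thesis
    unfolding B2_coset[OF G] using C1_zero[OF G p] by blast
qed

lemma cup_zero_iff:
  assumes G: "topological_group G" and p: "p > 0"
  shows "cup p G \<alpha> \<beta> = \<one>\<^bsub>H2 p G\<^esub> \<longleftrightarrow> cup_zero p G \<alpha> \<beta>"
proof
  assume "cup p G \<alpha> \<beta> = \<one>\<^bsub>H2 p G\<^esub>"
  then have "cprod p G \<alpha> \<beta> \<in> B2 p G"
    using class2_self[OF G p, of "\<lambda>x. \<alpha> (fst x) * \<beta> (snd x)"] by (simp add: cup_def one_H2 cprod_eq)
  then obtain c where c: "c \<in> C1 p G" "d1 p G c = cprod p G \<alpha> \<beta>" by (auto simp: B2_def)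
  then show "cup_zero p G \<alpha> \<beta>"
    by (auto simp: cup_zero_def d1_eq_iff[OF G p] cprod_eq)
next
  assume "cup_zero p G \<alpha> \<beta>"
  then obtain c where c: "c \<in> C1 p G" "d1 p G c = cprod p G \<alpha> \<beta>" 
    by (auto simp: cup_zero_def d1_eq_iff[OF G p] cprod_eq)
  then show "cup p G \<alpha> \<beta> = \<one>\<^bsub>H2 p G\<^esub>"
    using class2_d1[OF G p c(1)] by (simp add: cup_def)
qed

text \<open>The corner entry of the matrix is a cochain whose coboundary is the value of the defining set formed
  by all the other entries.\<close>

lemma strong_massey_vanishing_if_liftable:
  assumes G: "topological_group G" and p: "p > 0" and L: "massey_liftable p G" and n: "n > 0"
  shows "strong_massey_vanishing p n G"
  unfolding strong_massey_vanishing_def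
proof (intro allI impI)
  fix \<alpha> assume *: "(\<forall>i\<in>{1..n}. \<alpha> i \<in> H1 p G) \<and> (\<forall>i\<in>{1..n-1}. cup p G (\<alpha> i) (\<alpha> (Suc i)) = \<one>\<^bsub>H2 p G\<^esub>)"
  then have "\<forall>i\<in>{1..<Suc n}. \<alpha> i \<in> H1 p G"
    and "\<forall>i. 1 \<le> i \<and> Suc i < Suc n \<longrightarrow> cup_zero p G (\<alpha> i) (\<alpha> (Suc i))"
    by (auto simp flip: cup_zero_iff[OF G p])
  then have "massey_lift p G 1 (Suc n) \<alpha>"
    using L unfolding massey_liftable_def by blast
  then obtain c where c: "unipotent_system p G 1 (Suc n) c" "\<forall>i\<in>{1..<Suc n}. c i i = \<alpha> i"
    by (auto simp: massey_lift_def)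
  have d: "d1 p G (c i j) = massey_sum p G c i j" if "1 \<le> i" "i \<le> j" "j \<le> n" for i j
    using c(1) that by (simp add: unipotent_system_def massey_sum_eq d1_eq_iff[OF G p])
  have "defining_set p G n \<alpha> c"
    using c d by (auto simp: defining_set_def unipotent_system_def)
  moreover have "class2 p G (massey_sum p G c 1 n) = \<one>\<^bsub>H2 p G\<^esub>"
    using class2_d1[OF G p, of "c 1 n"] d[of 1 n] c(1) n by (auto simp: unipotent_system_def)
  ultimately show "\<one>\<^bsub>H2 p G\<^esub> \<in> massey_product p G n \<alpha>"
    unfolding massey_product_def by fastforce
qed

section \<open>Cutting, scaling and pulling back unipotent matrices\<close>

lemma massey_lift_cong:
  "massey_lift p G a b \<alpha> \<Longrightarrow> (\<And>i. i \<in> {a..<b} \<Longrightarrow> \<alpha> i = \<beta> i) \<Longrightarrow> massey_lift p G a b \<beta>"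
  unfolding massey_lift_def by (metis (no_types, lifting))

text \<open>If a superdiagonal entry vanishes the matrix can be taken block diagonal: it is filled on both sides
  of the position \<open>k\<close>, and every entry whose range of indices contains \<open>k\<close> is 0.\<close>

lemma massey_lift_split:
  assumes G: "topological_group G" and p: "p > 0"
    and k: "a \<le> k" "k < b" and zero: "\<alpha> k = (\<lambda>g\<in>carrier G. 0)"
    and l: "massey_lift p G a k \<alpha>" and r: "massey_lift p G (Suc k) b \<alpha>"
  shows "massey_lift p G a b \<alpha>"
proof -
  obtain c where c: "unipotent_system p G a k c" "\<forall>i\<in>{a..<k}. c i i = \<alpha> i" using l by (auto simp: massey_lift_def)
  obtain d where d: "unipotent_system p G (Suc k) b d" "\<forall>i\<in>{Suc k..<b}. d i i = \<alpha> i" using r by (auto simp: massey_lift_def)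
  define e where "e i j = (if j < k then c i j else if k < i then d i j else (\<lambda>g\<in>carrier G. 0))" for i j
  have "unipotent_system p G a b e"
    unfolding unipotent_system_def
  proof (intro allI impI)
    fix i j assume ij: "a \<le> i \<and> i \<le> j \<and> j < b"
    consider "j < k" | "k < i" | "i \<le> k" "k \<le> j" by linarith
    then show "e i j \<in> C1 p G \<and> (\<forall>g\<in>carrier G. \<forall>h\<in>carrier G.
        [e i j (g \<otimes>\<^bsub>G\<^esub> h) = e i j g + e i j h - (\<Sum>k=i..<j. e i k g * e (Suc k) j h)] (mod int p))"
    proof cases
      case 1
      then have "(\<Sum>k=i..<j. e i k g * e (Suc k) j h) = (\<Sum>k=i..<j. c i k g * c (Suc k) j h)" for g h
        by (intro sum.cong) (auto simp: e_def)
      then show ?thesis using c(1) 1 ij by (simp add: e_def unipotent_system_def)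
    next
      case 2
      then have "(\<Sum>k=i..<j. e i k g * e (Suc k) j h) = (\<Sum>k=i..<j. d i k g * d (Suc k) j h)" for g h
        by (intro sum.cong) (auto simp: e_def)
      moreover have "e i j = d i j" using 2 ij by (simp add: e_def)
      ultimately show ?thesis using d(1) 2 ij by (simp add: unipotent_system_def)
    next
      case 3
      have "(\<Sum>k=i..<j. e i k g * e (Suc k) j h) = 0" if "g \<in> carrier G" "h \<in> carrier G" for g h
      proof (intro sum.neutral ballI)
        fix l assume l: "l \<in> {i..<j}"
        show "e i l g * e (Suc l) j h = 0"
          using 3 l that by (cases "l < k") (auto simp: e_def)
      qed
      moreover have "e i j = (\<lambda>g\<in>carrier G. 0)" using 3 by (simp add: e_def)
      ultimately show ?thesis using C1_zero[OF G p] by (simp add: topological_group_mult_closed[OF G])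
    qed
  qed
  moreover have "\<forall>i\<in>{a..<b}. e i i = \<alpha> i"
    using c(2) d(2) zero by (force simp: e_def not_less le_less)
  ultimately show ?thesis by (auto simp: massey_lift_def)
qed

text \<open>Cutting at the zero entries reduces every construction to segments consisting of nonzero
  characters, which is where non-degeneracy can be used.\<close>

lemma massey_lift_if_zero_free:
  assumes G: "topological_group G" and p: "p > 0"
    and lift: "\<And>a' b'. \<lbrakk>a \<le> a'; b' \<le> b; \<forall>i\<in>{a'..<b'}. \<alpha> i \<noteq> (\<lambda>g\<in>carrier G. 0)\<rbrakk> \<Longrightarrow> massey_lift p G a' b' \<alpha>"
  shows "massey_lift p G a b \<alpha>"
proof -
  have "massey_lift p G a' b' \<alpha>" if "a \<le> a'" "b' \<le> b" for a' b'
    using that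
  proof (induction "b' - a'" arbitrary: a' b' rule: less_induct)
    case less
    show ?case
    proof (cases "\<forall>i\<in>{a'..<b'}. \<alpha> i \<noteq> (\<lambda>g\<in>carrier G. 0)")
      case True
      then show ?thesis using lift less.prems by blast
    next
      case False
      then obtain k where k: "a' \<le> k" "k < b'" "\<alpha> k = (\<lambda>g\<in>carrier G. 0)" by auto
      show ?thesis
      proof (rule massey_lift_split[OF G p k(1,2), where \<alpha> = \<alpha>])
        show "massey_lift p G a' k \<alpha>" by (rule less.hyps) (use k less.prems in linarith)+
        show "massey_lift p G (Suc k) b' \<alpha>" by (rule less.hyps) (use k less.prems in linarith)+
      qed (rule k(3))
    qed
  qed
  then show ?thesis by simp
qed

text \<open>Conjugation by a diagonal matrix multiplies the entry \<open>(i, j)\<close> by a product of ratios of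
  consecutive diagonal entries, here \<open>r i * \<dots> * r j\<close>.  Stated with the ratios themselves, the identity
  holds even if some of them are 0 modulo \<open>p\<close>.\<close>

lemma massey_lift_scale:
  assumes G: "topological_group G" and p: "p > 0" and lift: "massey_lift p G a b \<alpha>"
  shows "massey_lift p G a b (\<lambda>i. \<lambda>g\<in>carrier G. (r i * \<alpha> i g) mod int p)"
proof -
  obtain c where c: "unipotent_system p G a b c" "\<forall>i\<in>{a..<b}. c i i = \<alpha> i" using lift by (auto simp: massey_lift_def)
  define e where "e i j = (\<lambda>g\<in>carrier G. ((\<Prod>l=i..j. r l) * c i j g) mod int p)" for i j
  have "unipotent_system p G a b e"
    unfolding unipotent_system_def
  proof (intro allI impI conjI ballI)
    fix i j assume ij: "a \<le> i \<and> i \<le> j \<and> j < b"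
    have "c i j \<in> C1 p G" using c(1) ij by (simp add: unipotent_system_def)
    then show "e i j \<in> C1 p G"
      using C1_add[OF G p, of "c i j" "c i j" "\<Prod>l=i..j. r l" 0] by (simp add: e_def)
    fix g h assume gh: "g \<in> carrier G" "h \<in> carrier G"
    let ?r = "\<Prod>l=i..j. r l"
    have "[e i j (g \<otimes>\<^bsub>G\<^esub> h) = ?r * c i j (g \<otimes>\<^bsub>G\<^esub> h)] (mod int p)"
      using gh by (simp add: e_def topological_group_mult_closed[OF G])
    also have "[?r * c i j (g \<otimes>\<^bsub>G\<^esub> h) = ?r * (c i j g + c i j h - (\<Sum>k=i..<j. c i k g * c (Suc k) j h))] (mod int p)"
      using c(1) ij gh by (intro cong_mult cong_refl) (simp add: unipotent_system_def)
    also have "?r * (c i j g + c i j h - (\<Sum>k=i..<j. c i k g * c (Suc k) j h)) =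
        ?r * c i j g + ?r * c i j h - (\<Sum>k=i..<j. ((\<Prod>l=i..k. r l) * c i k g) * ((\<Prod>l=Suc k..j. r l) * c (Suc k) j h))"
    proof -
      have "?r = (\<Prod>l=i..k. r l) * (\<Prod>l=Suc k..j. r l)" if "k \<in> {i..<j}" for k
      proof -
        have "{i..j} = {i..k} \<union> {Suc k..j}" using that by auto
        moreover have "{i..k} \<inter> {Suc k..j} = {}" by auto
        ultimately show ?thesis by (simp add: prod.union_disjoint)
      qed
      then have "(\<Sum>k=i..<j. ?r * (c i k g * c (Suc k) j h)) = (\<Sum>k=i..<j. ((\<Prod>l=i..k. r l) * c i k g) * ((\<Prod>l=Suc k..j. r l) * c (Suc k) j h))"
        by (intro sum.cong) simp_all
      then show ?thesis by (simp add: algebra_simps sum_distrib_left)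
    qed
    also have "[\<dots> = e i j g + e i j h - (\<Sum>k=i..<j. e i k g * e (Suc k) j h)] (mod int p)"
      using gh by (intro cong_add cong_diff cong_sum cong_mult) (simp_all add: e_def cong_sym_eq)
    finally show "[e i j (g \<otimes>\<^bsub>G\<^esub> h) = e i j g + e i j h - (\<Sum>k=i..<j. e i k g * e (Suc k) j h)] (mod int p)" .
  qed
  moreover have "\<forall>i\<in>{a..<b}. e i i = (\<lambda>g\<in>carrier G. (r i * \<alpha> i g) mod int p)"
    using c(2) by (simp add: e_def)
  ultimately show ?thesis by (auto simp: massey_lift_def)
qed

lemma cont_hom_closed: "\<phi> \<in> cont_hom G K \<Longrightarrow> g \<in> carrier G \<Longrightarrow> \<phi> g \<in> carrier K"
  by (auto simp: cont_hom_def hom_def)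

lemma cont_hom_mult: "\<phi> \<in> cont_hom G K \<Longrightarrow> g \<in> carrier G \<Longrightarrow> h \<in> carrier G \<Longrightarrow> \<phi> (g \<otimes>\<^bsub>G\<^esub> h) = \<phi> g \<otimes>\<^bsub>K\<^esub> \<phi> h"
  by (auto simp: cont_hom_def hom_def)

lemma cont_hom_comp:
  assumes "\<phi> \<in> cont_hom G K" "f \<in> cont_hom K H"
  shows "(\<lambda>x. f (\<phi> x)) \<in> cont_hom G H"
  using assms Group.hom_compose[of \<phi> G K f H] continuous_map_compose[of "gtop G" "gtop K" \<phi> "gtop H" f]
  by (simp add: cont_hom_def comp_def)

text \<open>Restricted to the carrier, since cochains are extensional.\<close>

definition pull :: "'a topgroup \<Rightarrow> ('a \<Rightarrow> 'b) \<Rightarrow> ('b \<Rightarrow> int) \<Rightarrow> 'a \<Rightarrow> int" where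
  "pull G \<phi> c = (\<lambda>g\<in>carrier G. c (\<phi> g))"

lemma pull_apply: "g \<in> carrier G \<Longrightarrow> pull G \<phi> c g = c (\<phi> g)"
  by (simp add: pull_def)

lemma pull_cochain:
  assumes G: "topological_group G" and K: "topological_group K" and \<phi>: "\<phi> \<in> cont_hom G K" and c: "c \<in> C1 p K"
  shows "pull G \<phi> c \<in> C1 p G"
proof -
  have "continuous_map (gtop G) (discrete_topology {0..<int p}) (c \<circ> \<phi>)"
    using \<phi> c by (auto simp: cont_hom_def C1_iff[OF K] intro: continuous_map_compose)
  then have "continuous_map (gtop G) (discrete_topology {0..<int p}) (pull G \<phi> c)"
    by (rule continuous_map_eq) (simp add: pull_def topspace_gtop[OF G])
  then show ?thesis by (simp add: C1_iff[OF G]) (simp add: pull_def)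
qed

lemma pull_H1:
  assumes G: "topological_group G" and K: "topological_group K" and p: "p > 0"
    and \<phi>: "\<phi> \<in> cont_hom G K" and c: "c \<in> H1 p K"
  shows "pull G \<phi> c \<in> H1 p G"
  using c \<phi> unfolding H1_iff[OF G p] H1_iff[OF K p]
  by (auto simp: pull_apply pull_cochain[OF G K] topological_group_mult_closed[OF G] cont_hom_mult cont_hom_closed)

lemma pull_cup_zero:
  assumes G: "topological_group G" and K: "topological_group K" 
    and \<phi>: "\<phi> \<in> cont_hom G K" and c: "cup_zero p K \<alpha> \<beta>"
  shows "cup_zero p G (pull G \<phi> \<alpha>) (pull G \<phi> \<beta>)"
proof -
  obtain c where c: "c \<in> C1 p K" "\<forall>g\<in>carrier K. \<forall>h\<in>carrier K.
     [c (g \<otimes>\<^bsub>K\<^esub> h) = c g + c h - \<alpha> g * \<beta> h] (mod int p)" using c by (auto simp: cup_zero_def)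
  show ?thesis
    unfolding cup_zero_def using c(2) \<phi>
    by (intro bexI[OF _ pull_cochain[OF G K \<phi> c(1)]])
      (auto simp: pull_apply topological_group_mult_closed[OF G] cont_hom_mult cont_hom_closed)
qed

lemma pull_massey_lift:
  assumes G: "topological_group G" and K: "topological_group K" 
    and \<phi>: "\<phi> \<in> cont_hom G K" and lift: "massey_lift p K a b \<alpha>"
  shows "massey_lift p G a b (\<lambda>i. pull G \<phi> (\<alpha> i))"
proof -
  obtain c where c: "unipotent_system p K a b c" "\<forall>i\<in>{a..<b}. c i i = \<alpha> i" using lift by (auto simp: massey_lift_def)
  have "unipotent_system p G a b (\<lambda>i j. pull G \<phi> (c i j))"
    using c(1) \<phi> unfolding unipotent_system_def
    by (auto simp: pull_apply topological_group_mult_closed[OF G] cont_hom_mult cont_hom_closed pull_cochain[OF G K])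
  then show ?thesis
    unfolding massey_lift_def using c(2) by auto
qed

section \<open>Lifting homomorphisms to finite p-groups\<close>

definition finite_p_group :: "nat \<Rightarrow> ('q, 'm) monoid_scheme \<Rightarrow> bool" where
  "finite_p_group p Q \<longleftrightarrow> group Q \<and> (\<exists>k. card (carrier Q) = p ^ k)"

definition dhom :: "'a topgroup \<Rightarrow> ('q, 'm) monoid_scheme \<Rightarrow> ('a \<Rightarrow> 'q) set" where
  "dhom G Q = {f \<in> hom G Q. continuous_map (gtop G) (discrete_topology (carrier Q)) f}"

lemma pro_p_topological_group: "pro_p_group p G \<Longrightarrow> topological_group G"
  by (simp add: pro_p_group_def profinite_group_def)

lemma pro_p_group_discrete:
  fixes H :: "'a topgroup"
  assumes p: "prime p" and H: "finite_p_group p H" and top: "gtop H = discrete_topology (carrier H)"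
  shows "pro_p_group p H"
proof -
  interpret group H using H by (simp add: finite_p_group_def)
  obtain k where k: "card (carrier H) = p ^ k" using H by (auto simp: finite_p_group_def)
  have fin: "finite (carrier H)" using k p by (intro card_ge_0_finite) (simp add: prime_gt_0_nat)
  have "topological_group H"
    unfolding topological_group_def top
    by (auto simp: is_group prod_topology_discrete_topology[symmetric] continuous_map_def)
  moreover have "\<exists>V. subgroup V H \<and> openin (gtop H) V \<and> V \<subseteq> U" if "openin (gtop H) U" "\<one>\<^bsub>H\<^esub> \<in> U" for U
    using that by (intro exI[of _ "{\<one>\<^bsub>H\<^esub>}"]) (auto simp: top triv_subgroup)
  moreover have "\<exists>j. card (rcosets\<^bsub>H\<^esub> N) = p ^ j" if "N \<lhd> H" for N
  proof -
    have "card (rcosets\<^bsub>H\<^esub> N) * card N = p ^ k"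
      using lagrange[of N] that k by (simp add: order_def normal_imp_subgroup)
    then have "card (rcosets\<^bsub>H\<^esub> N) dvd p ^ k" by (metis dvd_triv_left)
    then show ?thesis using divides_primepow_nat[OF p] by blast
  qed
  ultimately show ?thesis
    unfolding pro_p_group_def profinite_group_def
    by (simp add: top fin Hausdorff_space_discrete_topology compact_space_discrete_topology)
qed

text \<open>The universal properties only speak of groups whose elements are sequences of integers.  A finite
  group is carried over to that type by any injection, here with values in the constant sequences.\<close>

lemma ex_discrete_copy:
  fixes Q :: "('q, 'm) monoid_scheme"
  assumes p: "prime p" and Q: "finite_p_group p Q"
  shows "\<exists>(H :: (nat \<Rightarrow> int) topgroup) e. pro_p_group p H \<and> e \<in> iso Q H \<and> gtop H = discrete_topology (carrier H)"
proof -
  interpret group Q using Q by (simp add: finite_p_group_def)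
  obtain k where k: "card (carrier Q) = p ^ k" using Q by (auto simp: finite_p_group_def)
  have fin: "finite (carrier Q)" using k p by (intro card_ge_0_finite) (simp add: prime_gt_0_nat)
  obtain e0 :: "'q \<Rightarrow> nat" where e0: "inj_on e0 (carrier Q)"
    using finite_imp_inj_to_nat_seg[OF fin] by blast
  define e :: "'q \<Rightarrow> nat \<Rightarrow> int" where "e x = (\<lambda>_. int (e0 x))" for x
  have inj: "inj_on e (carrier Q)"
    using e0 by (auto simp: inj_on_def e_def dest: fun_cong)
  define d where "d = inv_into (carrier Q) e"
  have de: "d (e x) = x" if "x \<in> carrier Q" for x using inj that by (simp add: d_def)
  define H :: "(nat \<Rightarrow> int) topgroup" where
    "H = \<lparr>carrier = e ` carrier Q, mult = (\<lambda>x y. e (d x \<otimes>\<^bsub>Q\<^esub> d y)), one = e \<one>\<^bsub>Q\<^esub>,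
          gtop = discrete_topology (e ` carrier Q)\<rparr>"
  have iso: "e \<in> iso Q H"
    using inj by (auto simp: iso_def hom_def bij_betw_def H_def de)
  have "group H"
  proof (rule groupI)
    fix x assume "x \<in> carrier H"
    then obtain y where y: "y \<in> carrier Q" "x = e y" by (auto simp: H_def)
    show "\<exists>z\<in>carrier H. z \<otimes>\<^bsub>H\<^esub> x = \<one>\<^bsub>H\<^esub>"
      using y by (intro bexI[of _ "e (inv\<^bsub>Q\<^esub> y)"]) (auto simp: H_def de)
  qed (auto simp: H_def de m_assoc)
  moreover have "card (carrier H) = p ^ k"
    using inj k by (simp add: H_def card_image)
  ultimately have "pro_p_group p H"
    by (intro pro_p_group_discrete p) (auto simp: finite_p_group_def, simp add: H_def)
  then show ?thesis using iso by (intro exI[of _ H] exI[of _ e]) (simp add: H_def)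
qed

lemma dhom_discrete_copy:
  assumes G: "topological_group G" and e: "e \<in> iso Q H" and top: "gtop H = discrete_topology (carrier H)"
    and f: "f \<in> dhom G Q"
  shows "(\<lambda>g\<in>carrier G. e (f g)) \<in> cont_hom G H \<inter> extensional (carrier G)"
proof -
  have "continuous_map (discrete_topology (carrier Q)) (gtop H) e"
    using e by (auto simp: top continuous_map_def iso_def hom_def)
  then have "continuous_map (gtop G) (gtop H) (e \<circ> f)"
    using f by (auto simp: dhom_def intro: continuous_map_compose)
  then have "continuous_map (gtop G) (gtop H) (\<lambda>g\<in>carrier G. e (f g))"
    by (rule continuous_map_eq) (simp add: topspace_gtop[OF G])
  moreover have "e \<circ> f \<in> hom G H"
    using f e unfolding dhom_def iso_def by (blast intro: Group.hom_compose)
  then have "(\<lambda>g\<in>carrier G. e (f g)) \<in> hom G H"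
    by (auto simp: hom_def topological_group_mult_closed[OF G] Pi_iff)
  ultimately show ?thesis by (simp add: cont_hom_def)
qed

lemma cont_hom_discrete_copy:
  assumes G: "topological_group G" and Q: "group Q" and e: "e \<in> iso Q H" and top: "gtop H = discrete_topology (carrier H)"
    and f: "f \<in> cont_hom G H"
  shows "(\<lambda>g. inv_into (carrier Q) e (f g)) \<in> dhom G Q"
proof -
  let ?d = "inv_into (carrier Q) e"
  have d: "?d \<in> iso H Q" using e Q by (rule group.iso_set_sym[rotated])
  have "continuous_map (gtop H) (discrete_topology (carrier Q)) ?d"
    using d by (auto simp: top continuous_map_def iso_def hom_def)
  then have "continuous_map (gtop G) (discrete_topology (carrier Q)) (?d \<circ> f)"
    using f by (auto simp: cont_hom_def intro: continuous_map_compose)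
  moreover have "?d \<circ> f \<in> hom G Q"
    using f d unfolding cont_hom_def iso_def by (blast intro: Group.hom_compose)
  ultimately show ?thesis by (simp add: dhom_def comp_def)
qed

lemma dhom_comp:
  assumes "f \<in> dhom G Q" "\<pi> \<in> hom Q R"
  shows "(\<lambda>g. \<pi> (f g)) \<in> dhom G R"
proof -
  have "continuous_map (discrete_topology (carrier Q)) (discrete_topology (carrier R)) \<pi>"
    using assms(2) by (auto simp: continuous_map_def hom_def)
  then have "continuous_map (gtop G) (discrete_topology (carrier R)) (\<pi> \<circ> f)"
    using assms(1) by (auto simp: dhom_def intro: continuous_map_compose)
  moreover have "\<pi> \<circ> f \<in> hom G R"
    using assms by (auto simp: dhom_def intro: Group.hom_compose)
  ultimately show ?thesis by (simp add: dhom_def comp_def)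
qed

lemma dhom_closed: "f \<in> dhom G Q \<Longrightarrow> g \<in> carrier G \<Longrightarrow> f g \<in> carrier Q"
  by (auto simp: dhom_def hom_def)

text \<open>The common core of the lifting properties of free groups and of free products.  The points \<open>pt j\<close>
  play the role of generators: prescribed values on them that lift \<open>h\<close> extend to a homomorphism to \<open>Q\<close>,
  and its composite with \<open>\<pi>\<close> agrees with \<open>h\<close> on the points, hence everywhere by uniqueness for the
  target \<open>R\<close>.  The points are indexed rather than collected in a set because the structure maps of a free product are not known to be
  injective.\<close>

lemma lifting_if_generated:
  fixes G :: "'a topgroup"
  assumes p: "prime p" and G: "topological_group G" and pt: "\<And>j. j \<in> J \<Longrightarrow> pt j \<in> carrier G"
    and Q: "finite_p_group p Q" and R: "finite_p_group p R" and \<pi>: "\<pi> \<in> hom Q R" and h: "h \<in> dhom G R"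
    and \<psi>: "\<And>j. j \<in> J \<Longrightarrow> \<psi> j \<in> carrier Q" "\<And>j. j \<in> J \<Longrightarrow> \<pi> (\<psi> j) = h (pt j)"
    and ex: "\<And>(H :: (nat \<Rightarrow> int) topgroup) e. \<lbrakk>pro_p_group p H; e \<in> iso Q H; gtop H = discrete_topology (carrier H)\<rbrakk> \<Longrightarrow>
       \<exists>f\<in>cont_hom G H. \<forall>j\<in>J. f (pt j) = e (\<psi> j)"
    and uniq: "\<And>(H :: (nat \<Rightarrow> int) topgroup) f f'. \<lbrakk>pro_p_group p H; f \<in> cont_hom G H \<inter> extensional (carrier G);
       f' \<in> cont_hom G H \<inter> extensional (carrier G); \<And>j. j \<in> J \<Longrightarrow> f (pt j) = f' (pt j)\<rbrakk> \<Longrightarrow> f = f'"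
  shows "\<exists>f\<in>dhom G Q. \<forall>g\<in>carrier G. \<pi> (f g) = h g"
proof -
  obtain HQ :: "(nat \<Rightarrow> int) topgroup" and eQ where HQ: "pro_p_group p HQ" "eQ \<in> iso Q HQ" "gtop HQ = discrete_topology (carrier HQ)"
    using ex_discrete_copy[OF p Q] by blast
  obtain HR :: "(nat \<Rightarrow> int) topgroup" and eR where HR: "pro_p_group p HR" "eR \<in> iso R HR" "gtop HR = discrete_topology (carrier HR)"
    using ex_discrete_copy[OF p R] by blast
  have injQ: "inj_on eQ (carrier Q)" and injR: "inj_on eR (carrier R)"
    using HQ(2) HR(2) by (auto simp: iso_def bij_betw_def)
  obtain f where f: "f \<in> cont_hom G HQ" "\<forall>j\<in>J. f (pt j) = eQ (\<psi> j)"
    using ex[OF HQ] by blast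
  define f' where "f' g = inv_into (carrier Q) eQ (f g)" for g
  have f': "f' \<in> dhom G Q"
    unfolding f'_def using cont_hom_discrete_copy[OF G _ HQ(2,3) f(1)] Q by (simp add: finite_p_group_def)
  have f'_pt: "f' (pt j) = \<psi> j" if "j \<in> J" for j
    using that f(2) \<psi>(1) injQ by (simp add: f'_def)
  have eq: "(\<lambda>g\<in>carrier G. eR (\<pi> (f' g))) = (\<lambda>g\<in>carrier G. eR (h g))"
    using f'_pt pt \<psi>(2)
    by (intro uniq[OF HR(1)] dhom_discrete_copy[OF G HR(2,3)] dhom_comp[OF f' \<pi>] h) simp
  have "\<pi> (f' g) = h g" if g: "g \<in> carrier G" for g
    using fun_cong[OF eq, of g] g inj_onD[OF injR] dhom_closed[OF dhom_comp[OF f' \<pi>] g] dhom_closed[OF h g] by simp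
  then show ?thesis using f' by blast
qed

lemma free_pro_p_lifting:
  assumes p: "prime p" and F: "free_pro_p_on p F X"
    and Q: "finite_p_group p Q" and R: "finite_p_group p R" and \<pi>: "\<pi> \<in> hom Q R"
    and h: "h \<in> dhom F R" and sub: "h ` carrier F \<subseteq> \<pi> ` carrier Q"
  shows "\<exists>f\<in>dhom F Q. \<forall>g\<in>carrier F. \<pi> (f g) = h g"
proof -
  have X: "X \<subseteq> carrier F" and G: "topological_group F"
    using F by (auto simp: free_pro_p_on_def pro_p_topological_group)
  have univ: "\<exists>!f. f \<in> cont_hom F H \<inter> extensional (carrier F) \<and> (\<forall>x\<in>X. f x = \<phi> x)"
    if "pro_p_group p H" "\<phi> \<in> X \<rightarrow> carrier H" for H :: "(nat \<Rightarrow> int) topgroup" and \<phi>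
    using F that unfolding free_pro_p_on_def by blast
  \<comment> \<open>Any choice of preimages will do: there is no relation between free generators.\<close>
  define \<psi> where "\<psi> x = inv_into (carrier Q) \<pi> (h x)" for x
  have \<psi>: "\<psi> x \<in> carrier Q" "\<pi> (\<psi> x) = h x" if "x \<in> X" for x
    using sub X that unfolding \<psi>_def by (auto intro!: inv_into_into f_inv_into_f)
  show ?thesis
  proof (rule lifting_if_generated[OF p G _ Q R \<pi> h, where J = X and pt = "\<lambda>x. x" and \<psi> = \<psi>])
    fix H :: "(nat \<Rightarrow> int) topgroup" and e
    assume H: "pro_p_group p H" and e: "e \<in> iso Q H"
    have "(\<lambda>x. e (\<psi> x)) \<in> X \<rightarrow> carrier H" using \<psi> e by (auto simp: iso_def hom_def)
    then show "\<exists>f\<in>cont_hom F H. \<forall>x\<in>X. f x = e (\<psi> x)" using univ[OF H] by blast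
  next
    fix H :: "(nat \<Rightarrow> int) topgroup" and f f'
    assume H: "pro_p_group p H" and f: "f \<in> cont_hom F H \<inter> extensional (carrier F)"
      "f' \<in> cont_hom F H \<inter> extensional (carrier F)" "\<And>x. x \<in> X \<Longrightarrow> f x = f' x"
    have "f \<in> X \<rightarrow> carrier H" using f(1) X by (auto simp: cont_hom_def hom_def)
    from univ[OF H this] f show "f = f'" by auto
  qed (use X \<psi> in auto)
qed

lemma free_product_lifting:
  assumes p: "prime p" and F: "free_pro_p_product p G1 G2 G \<iota>1 \<iota>2" 
    and G1: "topological_group G1" and G2: "topological_group G2"
    and Q: "finite_p_group p Q" and R: "finite_p_group p R" and \<pi>: "\<pi> \<in> hom Q R"
    and h: "h \<in> dhom G R" 
    and f1: "f1 \<in> dhom G1 Q" "\<And>x. x \<in> carrier G1 \<Longrightarrow> \<pi> (f1 x) = h (\<iota>1 x)"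
    and f2: "f2 \<in> dhom G2 Q" "\<And>x. x \<in> carrier G2 \<Longrightarrow> \<pi> (f2 x) = h (\<iota>2 x)"
  shows "\<exists>f\<in>dhom G Q. \<forall>g\<in>carrier G. \<pi> (f g) = h g"
proof -
  have \<iota>: "\<iota>1 \<in> cont_hom G1 G" "\<iota>2 \<in> cont_hom G2 G" and G: "topological_group G"
    using F by (auto simp: free_pro_p_product_def pro_p_topological_group)
  have univ: "\<exists>!f. f \<in> cont_hom G H \<inter> extensional (carrier G) \<and>
                (\<forall>x\<in>carrier G1. f (\<iota>1 x) = k1 x) \<and> (\<forall>x\<in>carrier G2. f (\<iota>2 x) = k2 x)"
    if "pro_p_group p H" "k1 \<in> cont_hom G1 H" "k2 \<in> cont_hom G2 H" for H :: "(nat \<Rightarrow> int) topgroup" and k1 k2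
    using F that unfolding free_pro_p_product_def by blast
  let ?J = "carrier G1 <+> carrier G2"
  show ?thesis
  proof (rule lifting_if_generated[OF p G _ Q R \<pi> h, where J = ?J and pt = "case_sum \<iota>1 \<iota>2" and \<psi> = "case_sum f1 f2"])
    fix H :: "(nat \<Rightarrow> int) topgroup" and e
    assume H: "pro_p_group p H" "e \<in> iso Q H" "gtop H = discrete_topology (carrier H)"
    obtain f where "f \<in> cont_hom G H" "\<forall>x\<in>carrier G1. f (\<iota>1 x) = e (f1 x)" "\<forall>x\<in>carrier G2. f (\<iota>2 x) = e (f2 x)"
      using univ[OF H(1), of "\<lambda>x\<in>carrier G1. e (f1 x)" "\<lambda>x\<in>carrier G2. e (f2 x)"]
        dhom_discrete_copy[OF G1 H(2,3) f1(1)] dhom_discrete_copy[OF G2 H(2,3) f2(1)] by force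
    then show "\<exists>f\<in>cont_hom G H. \<forall>j\<in>?J. f (case_sum \<iota>1 \<iota>2 j) = e (case_sum f1 f2 j)"
      by (intro bexI[of _ f]) auto
  next
    fix H :: "(nat \<Rightarrow> int) topgroup" and f f'
    assume H: "pro_p_group p H" and f: "f \<in> cont_hom G H \<inter> extensional (carrier G)"
      "f' \<in> cont_hom G H \<inter> extensional (carrier G)"
      and eq: "\<And>j. j \<in> ?J \<Longrightarrow> f (case_sum \<iota>1 \<iota>2 j) = f' (case_sum \<iota>1 \<iota>2 j)"
    have "f \<in> cont_hom G H" using f(1) by simp
    from univ[OF H cont_hom_comp[OF \<iota>(1) this] cont_hom_comp[OF \<iota>(2) this]] f
    show "f = f'" using eq[OF InlI] eq[OF InrI] by auto
  qed (use \<iota> dhom_closed[OF f1(1)] dhom_closed[OF f2(1)] f1(2) f2(2) in \<open>auto simp: cont_hom_closed\<close>)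
qed

section \<open>Orientations modulo powers of p\<close>

lemma Zp_simps:
  "mult (Zp p) x y n = (x n * y n) mod int p ^ n"
  "add (Zp p) x y n = (x n + y n) mod int p ^ n"
  "one (Zp p) n = 1 mod int p ^ n"
  "zero (Zp p) n = 0"
  by (simp_all add: Zp_def)

lemma Zp_carrier: "x \<in> carrier (Zp p) \<longleftrightarrow> (\<forall>n. 0 \<le> x n \<and> x n < int p ^ n \<and> x (Suc n) mod int p ^ n = x n)"
  by (simp add: Zp_def)

lemma Zp_mod: "x \<in> carrier (Zp p) \<Longrightarrow> m \<le> n \<Longrightarrow> [x n = x m] (mod int p ^ m)"
proof (induction n)
  case (Suc n)
  show ?case
  proof (cases "m \<le> n")
    case True
    have "[x (Suc n) = x n] (mod int p ^ n)"
      using Suc.prems by (simp add: Zp_carrier cong_def)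
    then have "[x (Suc n) = x n] (mod int p ^ m)"
      by (rule cong_dvd_modulus) (simp add: le_imp_power_dvd True)
    then show ?thesis using Suc True cong_trans by blast
  qed (use Suc.prems in \<open>simp add: le_Suc_eq\<close>)
qed auto

lemma ZpI:
  assumes p: "p > 0" and F: "\<And>n. [F (Suc n) = F n] (mod int p ^ n)"
  shows "(\<lambda>n. F n mod int p ^ n) \<in> carrier (Zp p)"
  using p F by (auto simp: Zp_carrier mod_mod_cancel cong_def)

lemma Zp_closed:
  assumes p: "p > 0" and x: "x \<in> carrier (Zp p)" and y: "y \<in> carrier (Zp p)"
  shows "x \<oplus>\<^bsub>Zp p\<^esub> y \<in> carrier (Zp p)" "x \<otimes>\<^bsub>Zp p\<^esub> y \<in> carrier (Zp p)"
proof -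
  have "[x (Suc n) = x n] (mod int p ^ n)" "[y (Suc n) = y n] (mod int p ^ n)" for n
    using Zp_mod x y by auto
  then have "(\<lambda>n. (x n + y n) mod int p ^ n) \<in> carrier (Zp p)" "(\<lambda>n. (x n * y n) mod int p ^ n) \<in> carrier (Zp p)"
    by (auto intro!: ZpI p cong_add cong_mult)
  then show "x \<oplus>\<^bsub>Zp p\<^esub> y \<in> carrier (Zp p)" "x \<otimes>\<^bsub>Zp p\<^esub> y \<in> carrier (Zp p)"
    by (simp_all add: Zp_def)
qed

lemma Zp_add_pow: "([k] \<cdot>\<^bsub>Zp p\<^esub> y) n = (int k * y n) mod int p ^ n"
  by (induction k) (simp_all add: add_pow_def nat_pow_def Zp_def algebra_simps mod_simps)

lemma one_plus_cong:
  assumes "x \<in> one_plus p k"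
  shows "\<exists>y\<in>carrier (Zp p). \<forall>n. [x n = 1 + int p ^ k * y n] (mod int p ^ n)"
  using assms unfolding one_plus_def by (auto simp: Zp_simps Zp_add_pow cong_def mod_simps)

lemma one_plus_mod:
  assumes "x \<in> one_plus p k" "k \<le> n"
  shows "[x n = 1] (mod int p ^ k)"
proof -
  obtain y where "[x n = 1 + int p ^ k * y n] (mod int p ^ n)" using one_plus_cong[OF assms(1)] by blast
  then have "[x n = 1 + int p ^ k * y n] (mod int p ^ k)"
    by (rule cong_dvd_modulus) (simp add: le_imp_power_dvd assms(2))
  also have "[1 + int p ^ k * y n = 1 + 0] (mod int p ^ k)"
    by (intro cong_add) (auto simp: cong_def)
  finally show ?thesis by simp
qed

lemma one_plus_carrier:
  assumes p: "p > 0" and "x \<in> one_plus p k"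
  shows "x \<in> carrier (Zp p)"
proof -
  obtain y where y: "y \<in> carrier (Zp p)" "x = \<one>\<^bsub>Zp p\<^esub> \<oplus>\<^bsub>Zp p\<^esub> [(p ^ k)] \<cdot>\<^bsub>Zp p\<^esub> y"
    using assms(2) by (auto simp: one_plus_def)
  have "\<one>\<^bsub>Zp p\<^esub> \<in> carrier (Zp p)" using ZpI[OF p, of "\<lambda>_. 1"] by (simp add: Zp_def)
  moreover have "[(p ^ k)] \<cdot>\<^bsub>Zp p\<^esub> y = (\<lambda>n. (int p ^ k * y n) mod int p ^ n)"
    by (rule ext) (simp add: Zp_add_pow)
  moreover have "\<dots> \<in> carrier (Zp p)"
    using Zp_mod[OF y(1)] by (intro ZpI p cong_mult) auto
  ultimately show ?thesis using y(2) Zp_closed(1)[OF p] by simp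
qed

lemma orientation_residue:
  assumes p: "p > 0" and \<theta>: "\<theta> \<in> cont_hom G (principal_units p)" and g: "g \<in> carrier G"
  shows "\<theta> g \<in> carrier (Zp p)" "0 \<le> \<theta> g m" "\<theta> g m < int p ^ m" "m \<ge> 1 \<Longrightarrow> [\<theta> g m = 1] (mod int p)"
    and "h \<in> carrier G \<Longrightarrow> \<theta> (g \<otimes>\<^bsub>G\<^esub> h) m = (\<theta> g m * \<theta> h m) mod int p ^ m"
proof -
  have *: "\<theta> g \<in> one_plus p 1" using cont_hom_closed[OF \<theta> g] by (simp add: principal_units_def)
  then show Z: "\<theta> g \<in> carrier (Zp p)" by (rule one_plus_carrier[OF p])
  then show "0 \<le> \<theta> g m" "\<theta> g m < int p ^ m" by (simp_all add: Zp_carrier)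
  show "[\<theta> g m = 1] (mod int p)" if "m \<ge> 1" using one_plus_mod[OF * that] by simp
  show "\<theta> (g \<otimes>\<^bsub>G\<^esub> h) m = (\<theta> g m * \<theta> h m) mod int p ^ m" if "h \<in> carrier G"
    using cont_hom_mult[OF \<theta> g that] by (simp add: principal_units_def Zp_simps)
qed

lemma Zp_residue_continuous:
  "continuous_map (Zp_top p) (discrete_topology {0..<int p ^ m}) (\<lambda>x. x m)"
  unfolding Zp_top_def
  by (rule continuous_map_from_subtopology) (rule continuous_map_product_projection, simp)

lemma orientation_continuous:
  assumes \<theta>: "\<theta> \<in> cont_hom G (principal_units p)"
  shows "continuous_map (gtop G) (discrete_topology {0..<int p ^ m}) (\<lambda>g. \<theta> g m)"
proof -
  have "continuous_map (gtop G) (Zp_top p) \<theta>"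
    using \<theta> by (auto simp: cont_hom_def principal_units_def continuous_map_in_subtopology)
  from continuous_map_compose[OF this Zp_residue_continuous] show ?thesis by (simp add: comp_def)
qed

section \<open>Unipotent and affine groups over residue rings\<close>

text \<open>In a finite carrier right multiplication is injective, hence surjective, which provides left
  inverses.\<close>

lemma groupI_finite_cancel:
  assumes fin: "finite (carrier Q)"
    and closed: "\<And>x y. x \<in> carrier Q \<Longrightarrow> y \<in> carrier Q \<Longrightarrow> x \<otimes>\<^bsub>Q\<^esub> y \<in> carrier Q"
    and one: "\<one>\<^bsub>Q\<^esub> \<in> carrier Q"
    and assoc: "\<And>x y z. \<lbrakk>x \<in> carrier Q; y \<in> carrier Q; z \<in> carrier Q\<rbrakk> \<Longrightarrow> (x \<otimes>\<^bsub>Q\<^esub> y) \<otimes>\<^bsub>Q\<^esub> z = x \<otimes>\<^bsub>Q\<^esub> (y \<otimes>\<^bsub>Q\<^esub> z)"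
    and l_one: "\<And>x. x \<in> carrier Q \<Longrightarrow> \<one>\<^bsub>Q\<^esub> \<otimes>\<^bsub>Q\<^esub> x = x"
    and cancel: "\<And>x y z. \<lbrakk>x \<in> carrier Q; y \<in> carrier Q; z \<in> carrier Q; x \<otimes>\<^bsub>Q\<^esub> z = y \<otimes>\<^bsub>Q\<^esub> z\<rbrakk> \<Longrightarrow> x = y"
  shows "group Q"
proof (rule groupI)
  fix x assume x: "x \<in> carrier Q"
  have "inj_on (\<lambda>y. y \<otimes>\<^bsub>Q\<^esub> x) (carrier Q)" using cancel x by (auto simp: inj_on_def)
  then have "(\<lambda>y. y \<otimes>\<^bsub>Q\<^esub> x) ` carrier Q = carrier Q"
    using closed x fin by (intro endo_inj_surj) auto
  then show "\<exists>y\<in>carrier Q. y \<otimes>\<^bsub>Q\<^esub> x = \<one>\<^bsub>Q\<^esub>" using one by (metis imageE)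
qed (simp_all add: closed one assoc l_one)

definition triangle :: "nat \<Rightarrow> nat \<Rightarrow> (nat \<times> nat) set" where
  "triangle a b = {(i, j). a \<le> i \<and> i \<le> j \<and> j < b}"

text \<open>The unipotent upper triangular matrices over $\mathbb{F}_p$, with $I - u$ represented by \<open>u\<close>: since
  $(I-u)(I-v) = I - (u + v - uv)$, homomorphisms to this group are the systems of cochains considered
  above.\<close>

definition unitri :: "nat \<Rightarrow> nat \<Rightarrow> nat \<Rightarrow> (nat \<times> nat \<Rightarrow> int) monoid" where
  "unitri p a b = \<lparr>carrier = triangle a b \<rightarrow>\<^sub>E {0..<int p},
     mult = (\<lambda>u v. \<lambda>(i, j)\<in>triangle a b. (u (i, j) + v (i, j) - (\<Sum>k=i..<j. u (i, k) * v (Suc k, j))) mod int p),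
     one = (\<lambda>_\<in>triangle a b. 0)\<rparr>"

lemma finite_triangle: "finite (triangle a b)"
  by (rule finite_subset[of _ "{..<b} \<times> {..<b}"]) (auto simp: triangle_def)

text \<open>Both sides sum over $i \le l < k < j$.  This is associativity of matrix multiplication, and for
  the same reason the fact that the sums in a Massey product are cocycles.\<close>

lemma sum_triangle_swap:
  fixes f :: "nat \<Rightarrow> nat \<Rightarrow> int"
  shows "(\<Sum>k=i..<j. \<Sum>l=i..<k. f l k) = (\<Sum>l=i..<j. \<Sum>k=Suc l..<j. f l k)"
proof -
  have "(\<Sum>k=i..<j. \<Sum>l=i..<k. f l k) = (\<Sum>k=i..<j. \<Sum>l=i..<j. if l < k then f l k else 0)"
    by (intro sum.cong refl sum.mono_neutral_cong_left) auto
  also have "\<dots> = (\<Sum>l=i..<j. \<Sum>k=i..<j. if l < k then f l k else 0)"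
    by (rule sum.swap)
  also have "\<dots> = (\<Sum>l=i..<j. \<Sum>k=Suc l..<j. f l k)"
    by (intro sum.cong refl sum.mono_neutral_cong_right) auto
  finally show ?thesis .
qed

lemma unitri_mult:
  "(i, j) \<in> triangle a b \<Longrightarrow> (u \<otimes>\<^bsub>unitri p a b\<^esub> v) (i, j) = (u (i, j) + v (i, j) - (\<Sum>k=i..<j. u (i, k) * v (Suc k, j))) mod int p"
  by (simp add: unitri_def)

lemma unitri_assoc:
  assumes ij: "(i, j) \<in> triangle a b"
  shows "((u \<otimes>\<^bsub>unitri p a b\<^esub> v) \<otimes>\<^bsub>unitri p a b\<^esub> w) (i, j) = (u \<otimes>\<^bsub>unitri p a b\<^esub> (v \<otimes>\<^bsub>unitri p a b\<^esub> w)) (i, j)"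
proof -
  let ?m = "\<lambda>u v i j. u (i, j) + v (i, j) - (\<Sum>k=i..<j. u (i, k) * v (Suc k, j))"
  have t: "(i, k) \<in> triangle a b" "(Suc k, j) \<in> triangle a b" if "k \<in> {i..<j}" for k
    using ij that by (auto simp: triangle_def)
  define L where "L = ?m u v i j + w (i, j) - (\<Sum>k=i..<j. ?m u v i k * w (Suc k, j))"
  define R where "R = u (i, j) + ?m v w i j - (\<Sum>k=i..<j. u (i, k) * ?m v w (Suc k) j)"
  have "[(?m u v i j mod p) + w (i, j) - (\<Sum>k=i..<j. (?m u v i k mod p) * w (Suc k, j)) = L] (mod p)"
    unfolding L_def by (intro cong_diff cong_add cong_sum cong_mult) auto
  moreover have "((u \<otimes>\<^bsub>unitri p a b\<^esub> v) \<otimes>\<^bsub>unitri p a b\<^esub> w) (i, j) = 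
      ((?m u v i j mod p) + w (i, j) - (\<Sum>k=i..<j. (?m u v i k mod p) * w (Suc k, j))) mod p"
    using ij t by (simp add: unitri_mult)
  moreover have "L = R"
  proof -
    have "(\<Sum>k=i..<j. (\<Sum>l=i..<k. u (i, l) * v (Suc l, k)) * w (Suc k, j)) =
          (\<Sum>k=i..<j. \<Sum>l=i..<k. u (i, l) * (v (Suc l, k) * w (Suc k, j)))"
      by (simp only: sum_distrib_right mult.assoc)
    then have swap: "(\<Sum>k=i..<j. (\<Sum>l=i..<k. u (i, l) * v (Suc l, k)) * w (Suc k, j)) = 
         (\<Sum>l=i..<j. u (i, l) * (\<Sum>k=Suc l..<j. v (Suc l, k) * w (Suc k, j)))"
      by (simp only: sum_triangle_swap[of "\<lambda>l k. u (i, l) * (v (Suc l, k) * w (Suc k, j))"] sum_distrib_left)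
    have "(\<Sum>k=i..<j. ?m u v i k * w (Suc k, j)) = (\<Sum>k=i..<j. u (i, k) * w (Suc k, j)) +
        (\<Sum>k=i..<j. v (i, k) * w (Suc k, j)) - (\<Sum>k=i..<j. (\<Sum>l=i..<k. u (i, l) * v (Suc l, k)) * w (Suc k, j))"
      by (simp only: left_diff_distrib distrib_right sum.distrib sum_subtractf)
    moreover have "(\<Sum>k=i..<j. u (i, k) * ?m v w (Suc k) j) = (\<Sum>k=i..<j. u (i, k) * v (Suc k, j)) +
        (\<Sum>k=i..<j. u (i, k) * w (Suc k, j)) - (\<Sum>l=i..<j. u (i, l) * (\<Sum>k=Suc l..<j. v (Suc l, k) * w (Suc k, j)))"
      by (simp only: right_diff_distrib distrib_left sum.distrib sum_subtractf)
    ultimately show ?thesis unfolding L_def R_def using swap by linarith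
  qed
  moreover have "[u (i, j) + (?m v w i j mod p) - (\<Sum>k=i..<j. u (i, k) * (?m v w (Suc k) j mod p)) = R] (mod p)"
    unfolding R_def by (intro cong_diff cong_add cong_sum cong_mult) auto
  moreover have "(u \<otimes>\<^bsub>unitri p a b\<^esub> (v \<otimes>\<^bsub>unitri p a b\<^esub> w)) (i, j) =
     (u (i, j) + (?m v w i j mod p) - (\<Sum>k=i..<j. u (i, k) * (?m v w (Suc k) j mod p))) mod p"
    using ij t by (simp add: unitri_mult)
  ultimately show ?thesis by (simp only: cong_def)
qed

text \<open>Right cancellation is seen by recovering the entries of \<open>x\<close> one superdiagonal after the other: in the
  entry \<open>(i, j)\<close> of a product, the other entries of \<open>x\<close> that occur lie closer to the diagonal.\<close>

lemma finite_p_group_unitri: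
  assumes p: "prime p"
  shows "finite_p_group p (unitri p a b)"
proof -
  let ?U = "unitri p a b"
  have p0: "p > 0" using p by (simp add: prime_gt_0_nat)
  have car: "carrier ?U = triangle a b \<rightarrow>\<^sub>E {0..<int p}" by (simp add: unitri_def)
  have closed: "x \<otimes>\<^bsub>?U\<^esub> y \<in> carrier ?U" for x y
    using p0 by (auto simp: unitri_def)
  have "group ?U"
  proof (rule groupI_finite_cancel)
    show "finite (carrier ?U)" by (simp add: car finite_PiE finite_triangle)
    show "\<one>\<^bsub>?U\<^esub> \<in> carrier ?U" using p0 by (auto simp: unitri_def)
  next
    fix x y z
    assume "x \<in> carrier ?U" "y \<in> carrier ?U" "z \<in> carrier ?U"
    show "(x \<otimes>\<^bsub>?U\<^esub> y) \<otimes>\<^bsub>?U\<^esub> z = x \<otimes>\<^bsub>?U\<^esub> (y \<otimes>\<^bsub>?U\<^esub> z)"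
    proof (rule PiE_ext)
      show "(x \<otimes>\<^bsub>?U\<^esub> y) \<otimes>\<^bsub>?U\<^esub> z \<in> triangle a b \<rightarrow>\<^sub>E {0..<int p}" "x \<otimes>\<^bsub>?U\<^esub> (y \<otimes>\<^bsub>?U\<^esub> z) \<in> triangle a b \<rightarrow>\<^sub>E {0..<int p}"
        using closed unfolding car by blast+
    qed (use unitri_assoc in auto)
  next
    fix x assume x: "x \<in> carrier ?U"
    show "\<one>\<^bsub>?U\<^esub> \<otimes>\<^bsub>?U\<^esub> x = x"
    proof (rule PiE_ext)
      show "\<one>\<^bsub>?U\<^esub> \<otimes>\<^bsub>?U\<^esub> x \<in> triangle a b \<rightarrow>\<^sub>E {0..<int p}" using closed unfolding car by blast
      show x': "x \<in> triangle a b \<rightarrow>\<^sub>E {0..<int p}" using x by (simp add: car)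
      fix s assume s: "s \<in> triangle a b"
      obtain i j where ij: "s = (i, j)" by force
      have "(\<Sum>k=i..<j. \<one>\<^bsub>?U\<^esub> (i, k) * x (Suc k, j)) = 0"
        using s by (intro sum.neutral) (auto simp: unitri_def triangle_def ij)
      moreover have "0 \<le> x (i, j)" "x (i, j) < int p" using x' s ij by (auto simp: PiE_iff)
      ultimately show "(\<one>\<^bsub>?U\<^esub> \<otimes>\<^bsub>?U\<^esub> x) s = x s"
        using s by (simp add: ij unitri_mult) (simp add: unitri_def)
    qed
  next
    fix x y z assume x: "x \<in> carrier ?U" and y: "y \<in> carrier ?U" and eq: "x \<otimes>\<^bsub>?U\<^esub> z = y \<otimes>\<^bsub>?U\<^esub> z"
    have "(i, j) \<in> triangle a b \<Longrightarrow> x (i, j) = y (i, j)" for i j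
    proof (induction "j - i" arbitrary: j rule: less_induct)
      case less
      have "(\<Sum>k=i..<j. x (i, k) * z (Suc k, j)) = (\<Sum>k=i..<j. y (i, k) * z (Suc k, j))"
        using less.prems by (intro sum.cong refl arg_cong2[where f = "(*)"] less.hyps) (auto simp: triangle_def)
      with fun_cong[OF eq, of "(i, j)"]
      have "[x (i, j) + z (i, j) - (\<Sum>k=i..<j. x (i, k) * z (Suc k, j)) = y (i, j) + z (i, j) - (\<Sum>k=i..<j. x (i, k) * z (Suc k, j))] (mod int p)"
        using less.prems by (simp add: unitri_mult cong_def)
      then have "[x (i, j) = y (i, j)] (mod int p)"
        by (simp add: cong_iff_dvd_diff)
      moreover have "x (i, j) \<in> {0..<int p}" "y (i, j) \<in> {0..<int p}"
        using x y less.prems by (auto simp: car PiE_iff)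
      ultimately show ?case by (simp add: cong_def)
    qed
    then show "x = y"
      using x y by (intro PiE_ext[of x "triangle a b" "\<lambda>_. {0..<int p}"]) (auto simp: car)
  qed (rule closed)
  moreover have "card (carrier ?U) = p ^ card (triangle a b)"
    by (simp add: car card_PiE finite_triangle)
  ultimately show ?thesis by (auto simp: finite_p_group_def)
qed

text \<open>The group $\mathbb{Z}/p^m \rtimes (1+p\mathbb{Z})/p^m$ of affine maps $z \mapsto x + uz$.  A map
  $g \mapsto (c(g), \theta(g))$ to it is a homomorphism exactly if \<open>c\<close> is a 1-cocycle with values in
  $\mathbb{Z}_p(\theta)/p^m$.\<close>

definition affine_group :: "nat \<Rightarrow> nat \<Rightarrow> (int \<times> int) monoid" where
  "affine_group p m = \<lparr>carrier = {0..<int p ^ m} \<times> {u \<in> {0..<int p ^ m}. [u = 1] (mod int p)},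
     mult = (\<lambda>(x, u) (y, v). ((x + u * y) mod int p ^ m, (u * v) mod int p ^ m)),
     one = (0, 1 mod int p ^ m)\<rparr>"

lemma card_principal_residues:
  assumes p: "p > 1" and m: "m \<ge> 1"
  shows "card {u \<in> {0..<int p ^ m}. [u = 1] (mod int p)} = p ^ (m - 1)"
proof -
  obtain k where k: "m = Suc k" using m by (cases m) auto
  have "{u \<in> {0..<int p ^ m}. [u = 1] (mod int p)} = (\<lambda>x. 1 + int p * x) ` {0..<int p ^ k}" (is "?L = ?R")
  proof (intro equalityI subsetI)
    fix u assume u: "u \<in> ?L"
    then have "u mod int p = 1" using p by (simp add: cong_def)
    then have eq: "u = 1 + int p * (u div int p)" by (metis add.commute mult_div_mod_eq)
    moreover have "u div int p < int p ^ k"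
    proof -
      have "u < int p ^ k * int p" using u k by (simp add: mult.commute)
      moreover have "int p * (u div int p) < u" using eq by linarith
      ultimately have "int p * (u div int p) < int p * int p ^ k" by (simp add: mult.commute)
      then show ?thesis using p by simp
    qed
    moreover have "0 \<le> u div int p" using u p by (simp add: pos_imp_zdiv_nonneg_iff)
    ultimately show "u \<in> ?R" by (intro image_eqI[of _ _ "u div int p"]) auto
  next
    fix u assume "u \<in> ?R"
    then obtain x where x: "u = 1 + int p * x" "0 \<le> x" "x \<le> int p ^ k - 1" by force
    have "int p * x \<le> int p * (int p ^ k - 1)" using x(3) by (intro mult_left_mono) auto
    then have "u < int p ^ m" using x(1) p k by (simp add: algebra_simps)
    moreover have "u \<ge> 0" using x by simp
    moreover have "[u = 1] (mod int p)" by (simp add: x(1) cong_iff_dvd_diff)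
    ultimately show "u \<in> ?L" by auto
  qed
  moreover have "inj_on (\<lambda>x. 1 + int p * x) {0..<int p ^ k}" using p by (auto simp: inj_on_def)
  ultimately show ?thesis by (simp add: card_image k nat_power_eq)
qed

lemma cong_mod_power: "m \<ge> 1 \<Longrightarrow> [x mod int p ^ m = x] (mod int p)"
  by (rule cong_dvd_modulus[of _ _ "int p ^ m"]) (auto simp: dvd_power)

lemma finite_p_group_affine:
  assumes p: "prime p" and m: "m \<ge> 1"
  shows "finite_p_group p (affine_group p m)"
proof -
  let ?A = "affine_group p m" and ?q = "int p ^ m"
  have p1: "p > 1" by (rule prime_gt_1_nat[OF p])
  have one: "[1 mod ?q = 1] (mod int p)" by (rule cong_mod_power[OF m])
  have "group ?A"
  proof (rule groupI_finite_cancel)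
    have "carrier ?A \<subseteq> {0..<?q} \<times> {0..<?q}" by (auto simp: affine_group_def)
    then show "finite (carrier ?A)" by (rule finite_subset) simp
    show "\<one>\<^bsub>?A\<^esub> \<in> carrier ?A" using p1 one by (simp add: affine_group_def)
  next
    fix x y assume "x \<in> carrier ?A" "y \<in> carrier ?A"
    moreover have "[(u * v) mod ?q = 1] (mod int p)" if "[u = 1] (mod int p)" "[v = 1] (mod int p)" for u v
      using cong_trans[OF cong_mod_power[OF m, of "u * v"]] cong_mult[OF that] by simp
    ultimately show "x \<otimes>\<^bsub>?A\<^esub> y \<in> carrier ?A"
      using p1 by (auto simp: affine_group_def)
  next
    fix x y z
    have "((a + u * b) mod ?q + (u * v) mod ?q * c) mod ?q = (a + u * ((b + v * c) mod ?q)) mod ?q" for a u b v c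
    proof -
      have "[(a + u * b) mod ?q + (u * v) mod ?q * c = (a + u * b) + (u * v) * c] (mod ?q)"
        by (intro cong_add cong_mult) auto
      moreover have "[a + u * ((b + v * c) mod ?q) = a + u * (b + v * c)] (mod ?q)"
        by (intro cong_add cong_mult) auto
      ultimately show ?thesis by (simp add: cong_def algebra_simps)
    qed
    then show "(x \<otimes>\<^bsub>?A\<^esub> y) \<otimes>\<^bsub>?A\<^esub> z = x \<otimes>\<^bsub>?A\<^esub> (y \<otimes>\<^bsub>?A\<^esub> z)"
      by (auto simp: affine_group_def mod_simps mult.assoc split: prod.splits)
  next
    fix x assume "x \<in> carrier ?A"
    then show "\<one>\<^bsub>?A\<^esub> \<otimes>\<^bsub>?A\<^esub> x = x" by (auto simp: affine_group_def mod_mult_left_eq)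
  next
    fix x y z assume *: "x \<in> carrier ?A" "y \<in> carrier ?A" "z \<in> carrier ?A" "x \<otimes>\<^bsub>?A\<^esub> z = y \<otimes>\<^bsub>?A\<^esub> z"
    obtain a u b v c w where eq: "x = (a, u)" "y = (b, v)" "z = (c, w)" by (metis surj_pair)
    have "[w = 1] (mod int p)" using * eq by (simp add: affine_group_def)
    then have "coprime w ?q" by (metis cong_imp_coprime cong_sym coprime_1_left coprime_power_right_iff)
    moreover have "[u * w = v * w] (mod ?q)" using * eq by (simp add: affine_group_def cong_def)
    ultimately have "[u = v] (mod ?q)" using cong_mult_rcancel by blast
    then have uv: "u = v" using * eq by (simp add: affine_group_def cong_def)
    have "[a + u * c = b + u * c] (mod ?q)" using * eq uv by (simp add: affine_group_def cong_def)
    then have "[a = b] (mod ?q)" by (simp add: cong_add_rcancel)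
    then show "x = y" using * eq uv by (simp add: affine_group_def cong_def)
  qed
  moreover have "card (carrier ?A) = p ^ m * p ^ (m - 1)"
    using card_principal_residues[OF p1 m]
    by (simp add: affine_group_def card_cartesian_product nat_power_eq)
  ultimately show ?thesis by (auto simp: finite_p_group_def simp flip: power_add)
qed

lemma finite_p_group_integer_mod: "p > 0 \<Longrightarrow> finite_p_group p (integer_mod_group p)"
  unfolding finite_p_group_def by (auto simp: carrier_integer_mod_group intro: exI[of _ 1])

lemma finite_p_group_product:
  assumes "finite I" "p > 0"
  shows "finite_p_group p (product_group I (\<lambda>_. integer_mod_group p))"
  unfolding finite_p_group_def using assms 
  by (auto simp: card_PiE carrier_integer_mod_group)

lemma finite_p_group_DirProd:
  assumes "finite_p_group p Q" "finite_p_group p R"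
  shows "finite_p_group p (Q \<times>\<times> R)"
proof -
  have "carrier (Q \<times>\<times> R) = carrier Q \<times> carrier R" by (simp add: DirProd_def)
  then show ?thesis
    using assms unfolding finite_p_group_def
    by (auto simp: DirProd_group card_cartesian_product simp flip: power_add)
qed

section \<open>Unipotent matrices and twisted cocycles as homomorphisms\<close>

text \<open>The map $\mathrm{H}^1(G,\mathbb{Z}_p(\theta)/p^m) \to \mathrm{H}^1(G,\mathbb{F}_p)$ is surjective for
  all \<open>m\<close>.  It can be said with cocycles because coboundaries reduce to 0 modulo \<open>p\<close>.\<close>

definition kummerian :: "nat \<Rightarrow> 'a topgroup \<Rightarrow> ('a \<Rightarrow> nat \<Rightarrow> int) \<Rightarrow> bool" where
  "kummerian p G \<theta> \<longleftrightarrow> (\<forall>m\<ge>1. \<forall>\<alpha>\<in>H1 p G. \<exists>c\<in>C1 (p ^ m) G. \<forall>g\<in>carrier G.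
     [c g = \<alpha> g] (mod int p) \<and>
     (\<forall>h\<in>carrier G. [c (g \<otimes>\<^bsub>G\<^esub> h) = c g + \<theta> g m * c h] (mod int p ^ m)))"

lemma kummerianD:
  assumes "kummerian p G \<theta>" "m \<ge> 1" "\<alpha> \<in> H1 p G"
  obtains c where "c \<in> C1 (p ^ m) G" "\<And>g. g \<in> carrier G \<Longrightarrow> [c g = \<alpha> g] (mod int p)"
    "\<And>g h. g \<in> carrier G \<Longrightarrow> h \<in> carrier G \<Longrightarrow> [c (g \<otimes>\<^bsub>G\<^esub> h) = c g + \<theta> g m * c h] (mod int p ^ m)"
proof -
  have "\<exists>c\<in>C1 (p ^ m) G. \<forall>g\<in>carrier G. [c g = \<alpha> g] (mod int p) \<and>
     (\<forall>h\<in>carrier G. [c (g \<otimes>\<^bsub>G\<^esub> h) = c g + \<theta> g m * c h] (mod int p ^ m))"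
    using assms unfolding kummerian_def by simp
  then obtain c where "c \<in> C1 (p ^ m) G" "\<forall>g\<in>carrier G. [c g = \<alpha> g] (mod int p) \<and>
     (\<forall>h\<in>carrier G. [c (g \<otimes>\<^bsub>G\<^esub> h) = c g + \<theta> g m * c h] (mod int p ^ m))"
    by (elim bexE)
  then show ?thesis by (intro that[of c]) simp_all
qed

lemma dhomI:
  assumes "\<And>g. g \<in> carrier G \<Longrightarrow> f g \<in> carrier Q"
    and "\<And>g h. g \<in> carrier G \<Longrightarrow> h \<in> carrier G \<Longrightarrow> f (g \<otimes>\<^bsub>G\<^esub> h) = f g \<otimes>\<^bsub>Q\<^esub> f h"
    and "continuous_map (gtop G) (discrete_topology (carrier Q)) f"
  shows "f \<in> dhom G Q"
  using assms by (auto simp: dhom_def hom_def)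

lemma dhom_mult: "f \<in> dhom G Q \<Longrightarrow> g \<in> carrier G \<Longrightarrow> h \<in> carrier G \<Longrightarrow> f (g \<otimes>\<^bsub>G\<^esub> h) = f g \<otimes>\<^bsub>Q\<^esub> f h"
  by (auto simp: dhom_def hom_def)

definition diag :: "nat \<Rightarrow> nat \<Rightarrow> (nat \<times> nat \<Rightarrow> int) \<Rightarrow> nat \<Rightarrow> int" where
  "diag a b u = (\<lambda>i\<in>{a..<b}. u (i, i))"

abbreviation Fp_power :: "nat \<Rightarrow> nat \<Rightarrow> nat \<Rightarrow> (nat \<Rightarrow> int) monoid" where
  "Fp_power p a b \<equiv> product_group {a..<b} (\<lambda>_. integer_mod_group p)"

lemma diag_hom: "p > 0 \<Longrightarrow> diag a b \<in> hom (unitri p a b) (Fp_power p a b)"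
  by (auto simp: hom_def diag_def carrier_integer_mod_group unitri_def triangle_def PiE_iff intro!: restrict_ext)

lemma diag_surj:
  assumes "p > 0" "x \<in> carrier (Fp_power p a b)"
  shows "x \<in> diag a b ` carrier (unitri p a b)"
proof (rule image_eqI)
  let ?u = "\<lambda>(i, j)\<in>triangle a b. if i = j then x i else 0"
  show "?u \<in> carrier (unitri p a b)"
    using assms by (auto simp: unitri_def carrier_integer_mod_group PiE_iff triangle_def)
  show "x = diag a b ?u"
    using assms(2) by (intro extensionalityI[of _ "{a..<b}"]) (auto simp: diag_def triangle_def PiE_iff)
qed

lemma H1_family_dhom:
  assumes G: "topological_group G" and p: "p > 0" and \<alpha>: "\<forall>i\<in>{a..<b}. \<alpha> i \<in> H1 p G"
  shows "(\<lambda>g. \<lambda>i\<in>{a..<b}. \<alpha> i g) \<in> dhom G (Fp_power p a b)"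
proof (rule dhomI)
  have C: "\<alpha> i \<in> C1 p G" if "i \<in> {a..<b}" for i
    using \<alpha> that by (simp add: H1_iff[OF G p])
  show closed: "(\<lambda>i\<in>{a..<b}. \<alpha> i g) \<in> carrier (Fp_power p a b)" if "g \<in> carrier G" for g
    using C1_range[OF G C that] p by (auto simp: carrier_integer_mod_group)
  show "(\<lambda>i\<in>{a..<b}. \<alpha> i (g \<otimes>\<^bsub>G\<^esub> h)) = (\<lambda>i\<in>{a..<b}. \<alpha> i g) \<otimes>\<^bsub>Fp_power p a b\<^esub> (\<lambda>i\<in>{a..<b}. \<alpha> i h)"
    if gh: "g \<in> carrier G" "h \<in> carrier G" for g h
  proof -
    have "\<alpha> i (g \<otimes>\<^bsub>G\<^esub> h) = (\<alpha> i g + \<alpha> i h) mod int p" if i: "i \<in> {a..<b}" for i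
      using bspec[OF \<alpha> i] by (rule H1_mult[OF G p _ gh])
    then show ?thesis by (auto intro!: restrict_ext)
  qed
  show "continuous_map (gtop G) (discrete_topology (carrier (Fp_power p a b))) (\<lambda>g. \<lambda>i\<in>{a..<b}. \<alpha> i g)"
  proof (rule continuous_map_discreteI[of "{a..<b}" _ "\<lambda>_. {0..<int p}" \<alpha>])
    show "continuous_map (gtop G) (discrete_topology {0..<int p}) (\<alpha> i)" if "i \<in> {a..<b}" for i
      using C[OF that] by (simp add: C1_iff[OF G])
  qed (use closed in \<open>auto simp: topspace_gtop[OF G] intro!: restrict_ext\<close>)
qed

text \<open>This is the criterion of Dwyer: the Massey product vanishes exactly if the given superdiagonal
  lifts to a homomorphism to the unipotent group.\<close>

lemma massey_lift_iff_dhom: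
  assumes G: "topological_group G" and p: "p > 0"
  shows "massey_lift p G a b \<alpha> \<longleftrightarrow> (\<forall>i\<in>{a..<b}. \<alpha> i \<in> C1 p G) \<and>
    (\<exists>f\<in>dhom G (unitri p a b). \<forall>g\<in>carrier G. diag a b (f g) = (\<lambda>i\<in>{a..<b}. \<alpha> i g))"
proof (intro iffI conjI ballI)
  assume "massey_lift p G a b \<alpha>"
  then obtain c where c: "unipotent_system p G a b c" "\<forall>i\<in>{a..<b}. c i i = \<alpha> i" by (auto simp: massey_lift_def)
  have C: "c i j \<in> C1 p G" if "(i, j) \<in> triangle a b" for i j
    using c(1) that by (auto simp: unipotent_system_def triangle_def)
  show "\<alpha> i \<in> C1 p G" if "i \<in> {a..<b}" for i
    using C[of i i] c(2) that by (simp add: triangle_def)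
  let ?f = "\<lambda>g. \<lambda>(i, j)\<in>triangle a b. c i j g"
  have closed: "?f g \<in> carrier (unitri p a b)" if "g \<in> carrier G" for g
    using C1_range[OF G C that] by (auto simp: unitri_def)
  have "?f \<in> dhom G (unitri p a b)"
  proof (rule dhomI)
    show "?f (g \<otimes>\<^bsub>G\<^esub> h) = ?f g \<otimes>\<^bsub>unitri p a b\<^esub> ?f h" if gh: "g \<in> carrier G" "h \<in> carrier G" for g h
    proof (rule extensionalityI[of _ "triangle a b"])
      fix s assume s: "s \<in> triangle a b"
      obtain i j where ij: "s = (i, j)" by force
      have "[c i j (g \<otimes>\<^bsub>G\<^esub> h) = c i j g + c i j h - (\<Sum>k=i..<j. c i k g * c (Suc k) j h)] (mod int p)"
        using c(1) s gh by (auto simp: unipotent_system_def triangle_def ij)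
      moreover have "(\<Sum>k=i..<j. ?f g (i, k) * ?f h (Suc k, j)) = (\<Sum>k=i..<j. c i k g * c (Suc k) j h)"
        using s by (intro sum.cong) (auto simp: triangle_def ij)
      ultimately show "?f (g \<otimes>\<^bsub>G\<^esub> h) s = (?f g \<otimes>\<^bsub>unitri p a b\<^esub> ?f h) s"
        using s C1_range(3)[OF G C topological_group_mult_closed[OF G gh], of i j]
        by (simp add: ij unitri_mult cong_def)
    qed (auto simp: unitri_def)
    show "continuous_map (gtop G) (discrete_topology (carrier (unitri p a b))) ?f"
    proof (rule continuous_map_discreteI[of "triangle a b" _ "\<lambda>_. {0..<int p}" "\<lambda>(i, j). c i j"])
      show "continuous_map (gtop G) (discrete_topology {0..<int p}) (case s of (i, j) \<Rightarrow> c i j)" if "s \<in> triangle a b" for s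
        using C[of "fst s" "snd s"] that by (simp add: C1_iff[OF G] case_prod_beta)
    next
      fix x y assume eq: "\<And>s. s \<in> triangle a b \<Longrightarrow> (case s of (i, j) \<Rightarrow> c i j) x = (case s of (i, j) \<Rightarrow> c i j) y"
      show "?f x = ?f y"
      proof (rule restrict_ext)
        fix s assume "s \<in> triangle a b"
        from eq[OF this] show "(case s of (i, j) \<Rightarrow> c i j x) = (case s of (i, j) \<Rightarrow> c i j y)"
          by (simp add: case_prod_beta)
      qed
    next
      show "?f x \<in> carrier (unitri p a b)" if "x \<in> topspace (gtop G)" for x
        using that by (intro closed) (simp add: topspace_gtop[OF G])
    qed (rule finite_triangle)
  qed (rule closed)
  moreover have "diag a b (?f g) = (\<lambda>i\<in>{a..<b}. \<alpha> i g)" for g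
    using c(2) by (auto simp: diag_def triangle_def intro!: restrict_ext)
  ultimately show "\<exists>f\<in>dhom G (unitri p a b). \<forall>g\<in>carrier G. diag a b (f g) = (\<lambda>i\<in>{a..<b}. \<alpha> i g)"
    by (intro bexI[of _ ?f] ballI)
next
  assume *: "(\<forall>i\<in>{a..<b}. \<alpha> i \<in> C1 p G) \<and>
    (\<exists>f\<in>dhom G (unitri p a b). \<forall>g\<in>carrier G. diag a b (f g) = (\<lambda>i\<in>{a..<b}. \<alpha> i g))"
  then obtain f where f: "f \<in> dhom G (unitri p a b)" "\<And>g. g \<in> carrier G \<Longrightarrow> diag a b (f g) = (\<lambda>i\<in>{a..<b}. \<alpha> i g)"
    by blast
  define c where "c i j = (\<lambda>g\<in>carrier G. f g (i, j) mod int p)" for i j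
  have f_mod: "f g (i, j) mod int p = f g (i, j)" if "g \<in> carrier G" "(i, j) \<in> triangle a b" for g i j
    using dhom_closed[OF f(1) that(1)] that(2) by (auto simp: unitri_def PiE_iff)
  have "unipotent_system p G a b c"
    unfolding unipotent_system_def
  proof (intro allI impI conjI ballI)
    fix i j assume ij: "a \<le> i \<and> i \<le> j \<and> j < b"
    show "c i j \<in> C1 p G"
      unfolding c_def
      by (rule C1I[OF G p, where f = f and g = f]) (use f(1) in \<open>auto simp: dhom_def\<close>)
    fix g h assume gh: "g \<in> carrier G" "h \<in> carrier G"
    have "(\<Sum>k=i..<j. f g (i, k) * f h (Suc k, j)) = (\<Sum>k=i..<j. c i k g * c (Suc k) j h)"
      using ij gh by (intro sum.cong) (auto simp: c_def f_mod triangle_def)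
    then show "[c i j (g \<otimes>\<^bsub>G\<^esub> h) = c i j g + c i j h - (\<Sum>k=i..<j. c i k g * c (Suc k) j h)] (mod int p)"
      using ij gh dhom_mult[OF f(1) gh]
      by (simp add: c_def unitri_mult triangle_def f_mod topological_group_mult_closed[OF G] cong_def)
  qed
  moreover have "c i i = \<alpha> i" if i: "i \<in> {a..<b}" for i
  proof (rule extensionalityI[of _ "carrier G"])
    fix g assume g: "g \<in> carrier G"
    show "c i i g = \<alpha> i g"
      using fun_cong[OF f(2)[OF g], of i] i f_mod[OF g, of i i] g by (simp add: c_def diag_def triangle_def)
  qed (use * i in \<open>auto simp: c_def C1_iff[OF G]\<close>)
  ultimately show "massey_lift p G a b \<alpha>" by (auto simp: massey_lift_def)
qed

text \<open>The translation part modulo \<open>p\<close> and the linear part; the latter is embedded in the affine group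
  again, which saves introducing the group of units as a further target.  It is a homomorphism because
  the linear parts are congruent to 1 modulo \<open>p\<close>.\<close>

definition affine_reduce :: "nat \<Rightarrow> int \<times> int \<Rightarrow> int \<times> int \<times> int" where
  "affine_reduce p = (\<lambda>(x, u). (x mod int p, 0, u))"

lemma affine_reduce_hom:
  assumes p: "p > 0" and m: "m \<ge> 1"
  shows "affine_reduce p \<in> hom (affine_group p m) (integer_mod_group p \<times>\<times> affine_group p m)"
proof -
  have "((x + u * y) mod int p ^ m) mod int p = (x mod int p + y mod int p) mod int p" if "[u = 1] (mod int p)" for x u y
  proof -
    have "[(x + u * y) mod int p ^ m = x + u * y] (mod int p)" by (rule cong_mod_power[OF m])
    also have "[x + u * y = x + 1 * y] (mod int p)" using that by (intro cong_add cong_mult) auto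
    finally show ?thesis by (simp add: cong_def mod_add_eq)
  qed
  moreover have "[(u * v) mod int p ^ m = 1] (mod int p)" if "[u = 1] (mod int p)" "[v = 1] (mod int p)" for u v
    using cong_trans[OF cong_mod_power[OF m, of "u * v"]] cong_mult[OF that] by simp
  ultimately show ?thesis
    using p by (auto simp: hom_def affine_reduce_def affine_group_def carrier_integer_mod_group DirProd_def)
qed

lemma kummer_target_dhom:
  assumes G: "topological_group G" and p: "p > 0" and m: "m \<ge> 1"
    and \<theta>: "\<theta> \<in> cont_hom G (principal_units p)" and \<alpha>: "\<alpha> \<in> H1 p G"
  shows "(\<lambda>g. (\<alpha> g, 0, \<theta> g m)) \<in> dhom G (integer_mod_group p \<times>\<times> affine_group p m)"
proof (rule dhomI)
  have C: "\<alpha> \<in> C1 p G" using \<alpha> by (simp add: H1_iff[OF G p])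
  show closed: "(\<alpha> g, 0, \<theta> g m) \<in> carrier (integer_mod_group p \<times>\<times> affine_group p m)" if g: "g \<in> carrier G" for g
    using C1_range[OF G C g] p orientation_residue(2-4)[OF p \<theta> g, of m] m
    by (simp add: DirProd_def carrier_integer_mod_group affine_group_def)
  show "(\<alpha> (g \<otimes>\<^bsub>G\<^esub> h), 0, \<theta> (g \<otimes>\<^bsub>G\<^esub> h) m) = (\<alpha> g, 0, \<theta> g m) \<otimes>\<^bsub>integer_mod_group p \<times>\<times> affine_group p m\<^esub> (\<alpha> h, 0, \<theta> h m)"
    if gh: "g \<in> carrier G" "h \<in> carrier G" for g h
    using orientation_residue(5)[OF p \<theta> gh(1), of h m] gh \<alpha> C1_range(3)[OF G C topological_group_mult_closed[OF G gh]]
    by (simp add: DirProd_def affine_group_def H1_iff[OF G p] cong_def)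
  have "continuous_map (gtop G) (discrete_topology {0..<int p}) \<alpha>" using C by (simp add: C1_iff[OF G])
  then show "continuous_map (gtop G) (discrete_topology (carrier (integer_mod_group p \<times>\<times> affine_group p m))) (\<lambda>g. (\<alpha> g, 0, \<theta> g m))"
    by (rule continuous_map_discrete_pairI[OF _ orientation_continuous[OF \<theta>]])
       (use closed in \<open>auto simp: topspace_gtop[OF G]\<close>)
qed

lemma kummer_cocycle_dhom:
  assumes G: "topological_group G" and p: "p > 0" and m: "m \<ge> 1"
    and \<theta>: "\<theta> \<in> cont_hom G (principal_units p)" and c: "c \<in> C1 (p ^ m) G"
    and cocycle: "\<forall>g\<in>carrier G. \<forall>h\<in>carrier G. [c (g \<otimes>\<^bsub>G\<^esub> h) = c g + \<theta> g m * c h] (mod int p ^ m)"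
  shows "(\<lambda>g. (c g, \<theta> g m)) \<in> dhom G (affine_group p m)"
proof (rule dhomI)
  show closed: "(c g, \<theta> g m) \<in> carrier (affine_group p m)" if g: "g \<in> carrier G" for g
    using C1_range[OF G c g] orientation_residue(2-4)[OF p \<theta> g, of m] m by (simp add: affine_group_def)
  show "(c (g \<otimes>\<^bsub>G\<^esub> h), \<theta> (g \<otimes>\<^bsub>G\<^esub> h) m) = (c g, \<theta> g m) \<otimes>\<^bsub>affine_group p m\<^esub> (c h, \<theta> h m)"
    if gh: "g \<in> carrier G" "h \<in> carrier G" for g h
    using orientation_residue(5)[OF p \<theta> gh(1), of h m] gh cocycle C1_range(3)[OF G c topological_group_mult_closed[OF G gh]]
    by (simp add: affine_group_def cong_def)
  have "continuous_map (gtop G) (discrete_topology {0..<int (p ^ m)}) c" using c by (simp add: C1_iff[OF G])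
  then show "continuous_map (gtop G) (discrete_topology (carrier (affine_group p m))) (\<lambda>g. (c g, \<theta> g m))"
    by (rule continuous_map_discrete_pairI[OF _ orientation_continuous[OF \<theta>]])
       (use closed in \<open>auto simp: topspace_gtop[OF G]\<close>)
qed

lemma kummer_cocycle_from_dhom:
  assumes G: "topological_group G" and p: "p > 0" and m: "m \<ge> 1"
    and f: "f \<in> dhom G (affine_group p m)" and lift: "\<forall>g\<in>carrier G. affine_reduce p (f g) = (\<alpha> g, 0, \<theta> g m)"
  shows "\<exists>c\<in>C1 (p ^ m) G. \<forall>g\<in>carrier G. [c g = \<alpha> g] (mod int p) \<and>
     (\<forall>h\<in>carrier G. [c (g \<otimes>\<^bsub>G\<^esub> h) = c g + \<theta> g m * c h] (mod int p ^ m))"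
proof (intro bexI ballI conjI)
  let ?c = "\<lambda>g\<in>carrier G. fst (f g) mod int (p ^ m)"
  have f_mod: "fst (f g) mod int (p ^ m) = fst (f g)" if "g \<in> carrier G" for g
    using dhom_closed[OF f that] by (auto simp: affine_group_def)
  show "?c \<in> C1 (p ^ m) G"
    by (rule C1I[where f = f and g = f]) (use G p f in \<open>auto simp: dhom_def\<close>)
  fix g assume g: "g \<in> carrier G"
  have fg: "f g = (fst (f g), \<theta> g m)" "[fst (f g) = \<alpha> g] (mod int p)"
  proof -
    have *: "fst (f g) mod int p = \<alpha> g \<and> snd (f g) = \<theta> g m"
      using bspec[OF lift g] by (simp add: affine_reduce_def split: prod.splits)
    then show "f g = (fst (f g), \<theta> g m)" by (metis prod.collapse)
    show "[fst (f g) = \<alpha> g] (mod int p)" using conjunct1[OF *] by (metis cong_def mod_mod_trivial)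
  qed
  then show "[?c g = \<alpha> g] (mod int p)" using g f_mod[OF g] by simp
  fix h assume h: "h \<in> carrier G"
  have "fst (f (g \<otimes>\<^bsub>G\<^esub> h)) = (fst (f g) + \<theta> g m * fst (f h)) mod int p ^ m"
    using dhom_mult[OF f g h] fg(1) by (simp add: affine_group_def split: prod.splits)
  then show "[?c (g \<otimes>\<^bsub>G\<^esub> h) = ?c g + \<theta> g m * ?c h] (mod int p ^ m)"
    using g h f_mod topological_group_mult_closed[OF G g h] by (simp add: cong_def)
qed

section \<open>Free groups and free products\<close>

text \<open>A free group is projective for finite \<open>p\<close>-groups, so every superdiagonal lifts.\<close>

lemma massey_liftable_free:
  assumes p: "prime p" and F: "free_pro_p_on p F X"
  shows "massey_liftable p F"
  unfolding massey_liftable_def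
proof (intro allI impI, elim conjE)
  have p0: "p > 0" by (rule prime_gt_0_nat[OF p])
  have G: "topological_group F" using F by (auto simp: free_pro_p_on_def pro_p_topological_group)
  fix a b :: nat and \<alpha> assume \<alpha>: "\<forall>i\<in>{a..<b}. \<alpha> i \<in> H1 p F"
  have h: "(\<lambda>g. \<lambda>i\<in>{a..<b}. \<alpha> i g) \<in> dhom F (Fp_power p a b)" by (rule H1_family_dhom[OF G p0 \<alpha>])
  have "\<exists>f\<in>dhom F (unitri p a b). \<forall>g\<in>carrier F. diag a b (f g) = (\<lambda>i\<in>{a..<b}. \<alpha> i g)"
  proof (rule free_pro_p_lifting[OF p F finite_p_group_unitri[OF p] _ diag_hom[OF p0] h])
    show "finite_p_group p (Fp_power p a b)" by (rule finite_p_group_product) (simp_all add: p0)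
    show "(\<lambda>g. \<lambda>i\<in>{a..<b}. \<alpha> i g) ` carrier F \<subseteq> diag a b ` carrier (unitri p a b)"
      using dhom_closed[OF h] diag_surj[OF p0] by blast
  qed
  then show "massey_lift p F a b \<alpha>"
    using \<alpha> by (simp add: massey_lift_iff_dhom[OF G p0] H1_iff[OF G p0])
qed

text \<open>By projectivity again, now with the affine group as target.\<close>

lemma kummerian_free:
  assumes p: "prime p" and F: "free_pro_p_on p F X" and \<theta>: "\<theta> \<in> cont_hom F (principal_units p)"
  shows "kummerian p F \<theta>"
  unfolding kummerian_def
proof (intro allI impI ballI)
  have p0: "p > 0" by (rule prime_gt_0_nat[OF p])
  have G: "topological_group F" using F by (auto simp: free_pro_p_on_def pro_p_topological_group)
  fix m :: nat and \<alpha> assume m: "m \<ge> 1" and \<alpha>: "\<alpha> \<in> H1 p F"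
  have C: "\<alpha> \<in> C1 p F" using \<alpha> by (simp add: H1_iff[OF G p0])
  have "\<exists>f\<in>dhom F (affine_group p m). \<forall>g\<in>carrier F. affine_reduce p (f g) = (\<alpha> g, 0, \<theta> g m)"
  proof (rule free_pro_p_lifting[OF p F finite_p_group_affine[OF p m] _ affine_reduce_hom[OF p0 m] kummer_target_dhom[OF G p0 m \<theta> \<alpha>]])
    show "finite_p_group p (integer_mod_group p \<times>\<times> affine_group p m)"
      by (intro finite_p_group_DirProd finite_p_group_integer_mod finite_p_group_affine p m p0)
    show "(\<lambda>g. (\<alpha> g, 0, \<theta> g m)) ` carrier F \<subseteq> affine_reduce p ` carrier (affine_group p m)"
    proof (intro image_subsetI image_eqI)
      fix g assume g: "g \<in> carrier F"
      show "(\<alpha> g, 0, \<theta> g m) = affine_reduce p (\<alpha> g, \<theta> g m)"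
        using C1_range[OF G C g] by (simp add: affine_reduce_def)
      have "int p \<le> int p ^ m" using m p0 by (intro self_le_power) auto
      then have "\<alpha> g < int p ^ m" using C1_range(2)[OF G C g] by linarith
      then show "(\<alpha> g, \<theta> g m) \<in> carrier (affine_group p m)"
        using C1_range(1)[OF G C g] orientation_residue(2-4)[OF p0 \<theta> g, of m] m by (simp add: affine_group_def)
    qed
  qed
  then show "\<exists>c\<in>C1 (p ^ m) F. \<forall>g\<in>carrier F. [c g = \<alpha> g] (mod int p) \<and>
     (\<forall>h\<in>carrier F. [c (g \<otimes>\<^bsub>F\<^esub> h) = c g + \<theta> g m * c h] (mod int p ^ m))"
    using kummer_cocycle_from_dhom[OF G p0 m] by blast
qed

lemma massey_liftable_pull_dhom:
  assumes p: "p > 0" and K: "topological_group K" and G: "topological_group G" and \<iota>: "\<iota> \<in> cont_hom K G"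
    and L: "massey_liftable p K"
    and \<alpha>: "\<forall>i\<in>{a..<b}. \<alpha> i \<in> H1 p G" 
    and cup: "\<forall>i. a \<le> i \<and> Suc i < b \<longrightarrow> cup_zero p G (\<alpha> i) (\<alpha> (Suc i))"
  shows "\<exists>f\<in>dhom K (unitri p a b). \<forall>x\<in>carrier K. diag a b (f x) = (\<lambda>i\<in>{a..<b}. \<alpha> i (\<iota> x))"
proof -
  have "\<forall>i\<in>{a..<b}. pull K \<iota> (\<alpha> i) \<in> H1 p K"
    using pull_H1[OF K G p \<iota>] \<alpha> by blast
  moreover have "\<forall>i. a \<le> i \<and> Suc i < b \<longrightarrow> cup_zero p K (pull K \<iota> (\<alpha> i)) (pull K \<iota> (\<alpha> (Suc i)))"
    using pull_cup_zero[OF K G \<iota>] cup by blast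
  ultimately have "massey_lift p K a b (\<lambda>i. pull K \<iota> (\<alpha> i))"
    by (rule massey_liftableD[OF L])
  then show ?thesis
    unfolding massey_lift_iff_dhom[OF K p] by (simp add: pull_apply)
qed

text \<open>The lifts on the two factors are glued by the universal property.\<close>

lemma massey_liftable_free_product:
  assumes p: "prime p" and F: "free_pro_p_product p G1 G2 G \<iota>1 \<iota>2"
    and G1: "topological_group G1" and G2: "topological_group G2"
    and L1: "massey_liftable p G1" and L2: "massey_liftable p G2"
  shows "massey_liftable p G"
  unfolding massey_liftable_def
proof (intro allI impI, elim conjE)
  have p0: "p > 0" by (rule prime_gt_0_nat[OF p])
  have \<iota>: "\<iota>1 \<in> cont_hom G1 G" "\<iota>2 \<in> cont_hom G2 G" and G: "topological_group G"
    using F by (auto simp: free_pro_p_product_def pro_p_topological_group)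
  fix a b :: nat and \<alpha> assume \<alpha>: "\<forall>i\<in>{a..<b}. \<alpha> i \<in> H1 p G" 
    and cup: "\<forall>i. a \<le> i \<and> Suc i < b \<longrightarrow> cup_zero p G (\<alpha> i) (\<alpha> (Suc i))"
  obtain f1 where f1: "f1 \<in> dhom G1 (unitri p a b)" "\<And>x. x \<in> carrier G1 \<Longrightarrow> diag a b (f1 x) = (\<lambda>i\<in>{a..<b}. \<alpha> i (\<iota>1 x))"
    using massey_liftable_pull_dhom[OF p0 G1 G \<iota>(1) L1 \<alpha> cup] by blast
  obtain f2 where f2: "f2 \<in> dhom G2 (unitri p a b)" "\<And>x. x \<in> carrier G2 \<Longrightarrow> diag a b (f2 x) = (\<lambda>i\<in>{a..<b}. \<alpha> i (\<iota>2 x))"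
    using massey_liftable_pull_dhom[OF p0 G2 G \<iota>(2) L2 \<alpha> cup] by blast
  have "finite_p_group p (Fp_power p a b)" by (rule finite_p_group_product) (simp_all add: p0)
  then have "\<exists>f\<in>dhom G (unitri p a b). \<forall>g\<in>carrier G. diag a b (f g) = (\<lambda>i\<in>{a..<b}. \<alpha> i g)"
    using f1(2) f2(2)
    by (intro free_product_lifting[OF p F G1 G2 finite_p_group_unitri[OF p] _ diag_hom[OF p0]
          H1_family_dhom[OF G p0 \<alpha>] f1(1) _ f2(1)])
  then show "massey_lift p G a b \<alpha>"
    using \<alpha> by (simp add: massey_lift_iff_dhom[OF G p0] H1_iff[OF G p0])
qed

lemma kummerian_free_product:
  assumes p: "prime p" and F: "free_pro_p_product p G1 G2 G \<iota>1 \<iota>2"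
    and G1: "topological_group G1" and G2: "topological_group G2"
    and \<theta>: "\<theta> \<in> cont_hom G (principal_units p)"
    and \<theta>1: "\<theta>1 \<in> cont_hom G1 (principal_units p)" "\<forall>x\<in>carrier G1. \<theta> (\<iota>1 x) = \<theta>1 x"
    and \<theta>2: "\<theta>2 \<in> cont_hom G2 (principal_units p)" "\<forall>x\<in>carrier G2. \<theta> (\<iota>2 x) = \<theta>2 x"
    and L1: "kummerian p G1 \<theta>1" and L2: "kummerian p G2 \<theta>2"
  shows "kummerian p G \<theta>"
  unfolding kummerian_def
proof (intro allI impI ballI)
  have p0: "p > 0" by (rule prime_gt_0_nat[OF p])
  have \<iota>: "\<iota>1 \<in> cont_hom G1 G" "\<iota>2 \<in> cont_hom G2 G" and G: "topological_group G"
    using F by (auto simp: free_pro_p_product_def pro_p_topological_group)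
  fix m :: nat and \<alpha> assume m: "m \<ge> 1" and \<alpha>: "\<alpha> \<in> H1 p G"
  have C: "\<alpha> \<in> C1 p G" using \<alpha> by (simp add: H1_iff[OF G p0])
  obtain c1 where c1: "c1 \<in> C1 (p ^ m) G1" "\<forall>g\<in>carrier G1. [c1 g = \<alpha> (\<iota>1 g)] (mod int p)"
     "\<forall>g\<in>carrier G1. \<forall>h\<in>carrier G1. [c1 (g \<otimes>\<^bsub>G1\<^esub> h) = c1 g + \<theta>1 g m * c1 h] (mod int p ^ m)"
    by (rule kummerianD[OF L1 m pull_H1[OF G1 G p0 \<iota>(1) \<alpha>]]) (simp add: pull_apply)
  obtain c2 where c2: "c2 \<in> C1 (p ^ m) G2" "\<forall>g\<in>carrier G2. [c2 g = \<alpha> (\<iota>2 g)] (mod int p)"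
     "\<forall>g\<in>carrier G2. \<forall>h\<in>carrier G2. [c2 (g \<otimes>\<^bsub>G2\<^esub> h) = c2 g + \<theta>2 g m * c2 h] (mod int p ^ m)"
    by (rule kummerianD[OF L2 m pull_H1[OF G2 G p0 \<iota>(2) \<alpha>]]) (simp add: pull_apply)
  have "\<exists>f\<in>dhom G (affine_group p m). \<forall>g\<in>carrier G. affine_reduce p (f g) = (\<alpha> g, 0, \<theta> g m)"
  proof (rule free_product_lifting[OF p F G1 G2 finite_p_group_affine[OF p m] _ affine_reduce_hom[OF p0 m] kummer_target_dhom[OF G p0 m \<theta> \<alpha>],
        where ?f1.0 = "\<lambda>x. (c1 x, \<theta>1 x m)" and ?f2.0 = "\<lambda>x. (c2 x, \<theta>2 x m)"])
    show "(\<lambda>x. (c1 x, \<theta>1 x m)) \<in> dhom G1 (affine_group p m)" "(\<lambda>x. (c2 x, \<theta>2 x m)) \<in> dhom G2 (affine_group p m)"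
      by (rule kummer_cocycle_dhom[OF G1 p0 m \<theta>1(1) c1(1,3)] kummer_cocycle_dhom[OF G2 p0 m \<theta>2(1) c2(1,3)])+
    show "finite_p_group p (integer_mod_group p \<times>\<times> affine_group p m)"
      by (intro finite_p_group_DirProd finite_p_group_integer_mod finite_p_group_affine p m p0)
    show "affine_reduce p (c1 x, \<theta>1 x m) = (\<alpha> (\<iota>1 x), 0, \<theta> (\<iota>1 x) m)" if "x \<in> carrier G1" for x
      using that c1(2) \<theta>1(2) C1_range(3)[OF G C cont_hom_closed[OF \<iota>(1) that]] by (simp add: affine_reduce_def cong_def)
    show "affine_reduce p (c2 x, \<theta>2 x m) = (\<alpha> (\<iota>2 x), 0, \<theta> (\<iota>2 x) m)" if "x \<in> carrier G2" for x
      using that c2(2) \<theta>2(2) C1_range(3)[OF G C cont_hom_closed[OF \<iota>(2) that]] by (simp add: affine_reduce_def cong_def)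
  qed
  then show "\<exists>c\<in>C1 (p ^ m) G. \<forall>g\<in>carrier G. [c g = \<alpha> g] (mod int p) \<and>
     (\<forall>h\<in>carrier G. [c (g \<otimes>\<^bsub>G\<^esub> h) = c g + \<theta> g m * c h] (mod int p ^ m))"
    using kummer_cocycle_from_dhom[OF G p0 m] by blast
qed

section \<open>Demushkin groups\<close>

text \<open>The canonical orientation is characterised by this property; only the passage from a class to a
  cocycle in it is needed.\<close>

lemma kummerian_canonical:
  assumes G: "topological_group G" and p: "p > 0" and can: "canonical_orientation p G \<theta>"
  shows "kummerian p G \<theta>"
  unfolding kummerian_def
proof (intro allI impI ballI)
  fix m :: nat and \<alpha> assume m: "m \<ge> 1" and \<alpha>: "\<alpha> \<in> H1 p G"
  obtain C where C: "C \<in> carrier (H1_tw p G \<theta> m)" "(\<lambda>c. \<lambda>g\<in>carrier G. c g mod int p) ` C = {\<alpha>}"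
    using can m \<alpha> unfolding canonical_orientation_def reduction_surj_def by blast
  obtain c where c: "c \<in> carrier (Z1_tw p G \<theta> m)" "C = B1_tw p G \<theta> m #>\<^bsub>Z1_tw p G \<theta> m\<^esub> c"
    using C(1) by (auto simp: H1_tw_def carrier_FactGroup)
  have c1: "c \<in> C1 (p ^ m) G" 
    and coc: "\<forall>g\<in>carrier G. \<forall>h\<in>carrier G. c (g \<otimes>\<^bsub>G\<^esub> h) = (c g + \<theta> g m * c h) mod int p ^ m"
    using c(1) by (auto simp: Z1_tw_def)
  \<comment> \<open>The zero coboundary shows that the representative \<open>c\<close> belongs to its coset.\<close>
  have "(\<lambda>g\<in>carrier G. (\<theta> g m * 0 - 0) mod int p ^ m) \<in> B1_tw p G \<theta> m"
    unfolding B1_tw_def using p by (intro CollectI exI[of _ 0]) simp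
  moreover have "(\<lambda>g\<in>carrier G. (\<theta> g m * 0 - 0) mod int p ^ m) \<otimes>\<^bsub>Z1_tw p G \<theta> m\<^esub> c = c"
    using c1 C1_range(3)[OF G c1]
    by (intro extensionalityI[of _ "carrier G"]) (auto simp: Z1_tw_def cochain_group_def topspace_gtop[OF G] C1_iff[OF G])
  ultimately have "c \<in> C" unfolding c(2) r_coset_def by force
  then have "(\<lambda>g\<in>carrier G. c g mod int p) = \<alpha>" using C(2) by blast
  then have "[c g = \<alpha> g] (mod int p)" if "g \<in> carrier G" for g
    using that by (auto simp: cong_def)
  then show "\<exists>c\<in>C1 (p ^ m) G. \<forall>g\<in>carrier G. [c g = \<alpha> g] (mod int p) \<and>
     (\<forall>h\<in>carrier G. [c (g \<otimes>\<^bsub>G\<^esub> h) = c g + \<theta> g m * c h] (mod int p ^ m))"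
    using coc by (intro bexI[OF _ c1]) (simp add: cong_def)
qed

lemma C2I:
  assumes G: "topological_group G" and p: "p > 0" and I: "finite I"
    and e: "\<And>i. i \<in> I \<Longrightarrow> e i \<in> C1 p G"
    and F: "\<And>x y. \<lbrakk>x \<in> carrier G \<times> carrier G; y \<in> carrier G \<times> carrier G;
       \<And>i. i \<in> I \<Longrightarrow> e i (fst x) = e i (fst y) \<and> e i (snd x) = e i (snd y)\<rbrakk> \<Longrightarrow> F x = F y"
  shows "(\<lambda>x\<in>carrier G \<times> carrier G. F x mod int p) \<in> C2 p G"
proof -
  let ?X = "prod_topology (gtop G) (gtop G)"
  have cont: "continuous_map ?X (discrete_topology {0..<int p}) (\<lambda>x. e i (if b then fst x else snd x))" if "i \<in> I" for i b
  proof -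
    have 1: "continuous_map (gtop G) (discrete_topology {0..<int p}) (e i)"
      using e[OF that] by (simp add: C1_iff[OF G])
    have 2: "continuous_map ?X (gtop G) (\<lambda>x. if b then fst x else snd x)"
      by (cases b) (simp_all add: continuous_map_fst continuous_map_snd)
    show ?thesis using continuous_map_compose[OF 2 1] by (simp add: comp_def)
  qed
  have "continuous_map ?X (discrete_topology {0..<int p}) (\<lambda>x\<in>carrier G \<times> carrier G. F x mod int p)"
  proof (rule continuous_map_discreteI[of "I \<times> UNIV" _ "\<lambda>_. {0..<int p}" "\<lambda>(i, b) x. e i (if b then fst x else snd x)"])
    show "finite (I \<times> (UNIV :: bool set))" using I by simp
    show "continuous_map ?X (discrete_topology {0..<int p}) (case s of (i, b) \<Rightarrow> \<lambda>x. e i (if b then fst x else snd x))"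
      if "s \<in> I \<times> UNIV" for s
      using cont that by auto
    show "(\<lambda>x\<in>carrier G \<times> carrier G. F x mod int p) x \<in> {0..<int p}" if "x \<in> topspace ?X" for x
      using that p by (auto simp: topspace_gtop[OF G])
  next
    fix x y assume xy: "x \<in> topspace ?X" "y \<in> topspace ?X"
      and eq: "\<And>s. s \<in> I \<times> (UNIV :: bool set) \<Longrightarrow> (case s of (i, b) \<Rightarrow> \<lambda>x. e i (if b then fst x else snd x)) x =
         (case s of (i, b) \<Rightarrow> \<lambda>x. e i (if b then fst x else snd x)) y"
    have "F x = F y"
    proof (rule F)
      show "e i (fst x) = e i (fst y) \<and> e i (snd x) = e i (snd y)" if "i \<in> I" for i
        using eq[of "(i, True)"] eq[of "(i, False)"] that by simp
    qed (use xy in \<open>simp_all add: topspace_gtop[OF G]\<close>)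
    then show "(\<lambda>x\<in>carrier G \<times> carrier G. F x mod int p) x = (\<lambda>x\<in>carrier G \<times> carrier G. F x mod int p) y"
      using xy by (simp add: topspace_gtop[OF G])
  qed
  then show ?thesis by (simp add: cochains_def topspace_gtop[OF G])
qed

lemma Z2_iff:
  assumes G: "topological_group G" and C: "(\<lambda>x\<in>carrier G \<times> carrier G. F x mod int p) \<in> C2 p G"
  shows "(\<lambda>x\<in>carrier G \<times> carrier G. F x mod int p) \<in> carrier (Z2 p G) \<longleftrightarrow>
    (\<forall>g1\<in>carrier G. \<forall>g2\<in>carrier G. \<forall>g3\<in>carrier G.
      [F (g1, g2) - F (g1, g2 \<otimes>\<^bsub>G\<^esub> g3) + F (g1 \<otimes>\<^bsub>G\<^esub> g2, g3) - F (g2, g3) = 0] (mod int p))"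
proof -
  let ?F = "\<lambda>x\<in>carrier G \<times> carrier G. F x mod int p"
  have "d2 p G ?F = (\<lambda>(g1, g2, g3)\<in>carrier G \<times> carrier G \<times> carrier G.
     (F (g1, g2) - F (g1, g2 \<otimes>\<^bsub>G\<^esub> g3) + F (g1 \<otimes>\<^bsub>G\<^esub> g2, g3) - F (g2, g3)) mod int p)"
  proof -
    have "(w mod m - x mod m + y mod m - z mod m) mod m = (w - x + y - z) mod m" for w x y z m :: int
    proof -
      have "[w mod m - x mod m + y mod m - z mod m = w - x + y - z] (mod m)"
        by (intro cong_add cong_diff) auto
      then show ?thesis by (simp add: cong_def)
    qed
    then show ?thesis
      unfolding d2_def by (intro restrict_ext) (auto simp: topological_group_mult_closed[OF G])
  qed
  moreover have "(\<lambda>(g1, g2, g3)\<in>A. H g1 g2 g3 mod int p) = (\<lambda>x\<in>A. 0) \<longleftrightarrow> (\<forall>(g1, g2, g3)\<in>A. [H g1 g2 g3 = 0] (mod int p))"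
    for A :: "('a \<times> 'a \<times> 'a) set" and H
  proof -
    have "restrict f A = restrict g A \<longleftrightarrow> (\<forall>x\<in>A. f x = g x)" for f g :: "'a \<times> 'a \<times> 'a \<Rightarrow> int"
      by (metis restrict_apply' restrict_ext)
    then show ?thesis by (simp add: cong_def case_prod_beta)
  qed
  ultimately have "d2 p G ?F = (\<lambda>x\<in>carrier G \<times> carrier G \<times> carrier G. 0) \<longleftrightarrow>
    (\<forall>(g1, g2, g3)\<in>carrier G \<times> carrier G \<times> carrier G. [F (g1, g2) - F (g1, g2 \<otimes>\<^bsub>G\<^esub> g3) + F (g1 \<otimes>\<^bsub>G\<^esub> g2, g3) - F (g2, g3) = 0] (mod int p))"
    by simp
  moreover have "?F \<in> carrier (Z2 p G) \<longleftrightarrow> d2 p G ?F = (\<lambda>x\<in>carrier G \<times> carrier G \<times> carrier G. 0)"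
    using C by (simp add: Z2_def)
  ultimately show ?thesis by auto
qed

lemma cprod_Z2:
  assumes G: "topological_group G" and p: "p > 0" and \<alpha>: "\<alpha> \<in> H1 p G" and \<beta>: "\<beta> \<in> H1 p G"
  shows "cprod p G \<alpha> \<beta> \<in> carrier (Z2 p G)"
proof -
  have "\<alpha> \<in> C1 p G" "\<beta> \<in> C1 p G" using \<alpha> \<beta> by (auto simp: H1_iff[OF G p])
  then have "(\<lambda>x\<in>carrier G \<times> carrier G. (\<alpha> (fst x) * \<beta> (snd x)) mod int p) \<in> C2 p G"
  proof (intro C2I[OF G p, of UNIV "\<lambda>b. if b then \<alpha> else \<beta>"])
    fix x y assume "\<And>b. b \<in> UNIV \<Longrightarrow> (if b then \<alpha> else \<beta>) (fst x) = (if b then \<alpha> else \<beta>) (fst y) \<and>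
      (if b then \<alpha> else \<beta>) (snd x) = (if b then \<alpha> else \<beta>) (snd y)"
    from this[of True] this[of False] show "\<alpha> (fst x) * \<beta> (snd x) = \<alpha> (fst y) * \<beta> (snd y)" by simp
  qed auto
  then show ?thesis
  proof (simp only: cprod_eq Z2_iff[OF G], intro ballI)
    fix g1 g2 g3 assume g: "g1 \<in> carrier G" "g2 \<in> carrier G" "g3 \<in> carrier G"
    have "[\<alpha> g1 * \<beta> g2 - \<alpha> g1 * \<beta> (g2 \<otimes>\<^bsub>G\<^esub> g3) + \<alpha> (g1 \<otimes>\<^bsub>G\<^esub> g2) * \<beta> g3 - \<alpha> g2 * \<beta> g3 =
       \<alpha> g1 * \<beta> g2 - \<alpha> g1 * (\<beta> g2 + \<beta> g3) + (\<alpha> g1 + \<alpha> g2) * \<beta> g3 - \<alpha> g2 * \<beta> g3] (mod int p)"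
      using \<alpha> \<beta> g by (intro cong_add cong_diff cong_mult cong_refl) (auto simp: H1_iff[OF G p])
    then show "[\<alpha> (fst (g1, g2)) * \<beta> (snd (g1, g2)) - \<alpha> (fst (g1, g2 \<otimes>\<^bsub>G\<^esub> g3)) * \<beta> (snd (g1, g2 \<otimes>\<^bsub>G\<^esub> g3)) +
        \<alpha> (fst (g1 \<otimes>\<^bsub>G\<^esub> g2, g3)) * \<beta> (snd (g1 \<otimes>\<^bsub>G\<^esub> g2, g3)) - \<alpha> (fst (g2, g3)) * \<beta> (snd (g2, g3)) = 0] (mod int p)"
      by (simp add: algebra_simps)
  qed
qed

lemma Z2_mult: "topological_group G \<Longrightarrow> z \<otimes>\<^bsub>Z2 p G\<^esub> w = (\<lambda>x\<in>carrier G \<times> carrier G. (z x + w x) mod int p)"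
  by (simp add: Z2_def cochain_group_def topspace_gtop)

lemma C2_eq:
  assumes G: "topological_group G" and z: "z \<in> C2 p G"
  shows "z = (\<lambda>x\<in>carrier G \<times> carrier G. z x mod int p)"
proof (rule extensionalityI[of _ "carrier G \<times> carrier G"])
  show "z \<in> extensional (carrier G \<times> carrier G)"
    using z by (simp add: cochains_def topspace_gtop[OF G])
  fix x assume x: "x \<in> carrier G \<times> carrier G"
  then have "z x \<in> {0..<int p}"
    using z by (auto simp: cochains_def topspace_gtop[OF G] continuous_map_def)
  then show "z x = (\<lambda>x\<in>carrier G \<times> carrier G. z x mod int p) x" using x by simp
qed simp

lemma Z2_closed:
  assumes G: "topological_group G" and p: "p > 0" and z: "z \<in> carrier (Z2 p G)" and w: "w \<in> carrier (Z2 p G)"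
  shows "z \<otimes>\<^bsub>Z2 p G\<^esub> w \<in> carrier (Z2 p G)"
proof -
  have zw: "z \<in> C2 p G" "w \<in> C2 p G" using z w by (auto simp: Z2_def)
  note eq = C2_eq[OF G zw(1)] C2_eq[OF G zw(2)]
  let ?X = "prod_topology (gtop G) (gtop G)"
  have "continuous_map ?X (discrete_topology {0..<int p}) z" "continuous_map ?X (discrete_topology {0..<int p}) w"
    using zw by (simp_all add: cochains_def)
  then have "continuous_map ?X (discrete_topology {0..<int p}) (\<lambda>x\<in>carrier G \<times> carrier G. (z x + w x) mod int p)"
    by (rule continuous_map_discrete_pairI) (use p in \<open>simp_all add: topspace_gtop[OF G]\<close>)
  then have C: "(\<lambda>x\<in>carrier G \<times> carrier G. (z x + w x) mod int p) \<in> C2 p G"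
    by (simp add: cochains_def topspace_gtop[OF G])
  have zc: "[z (g1, g2) - z (g1, g2 \<otimes>\<^bsub>G\<^esub> g3) + z (g1 \<otimes>\<^bsub>G\<^esub> g2, g3) - z (g2, g3) = 0] (mod int p)"
    and wc: "[w (g1, g2) - w (g1, g2 \<otimes>\<^bsub>G\<^esub> g3) + w (g1 \<otimes>\<^bsub>G\<^esub> g2, g3) - w (g2, g3) = 0] (mod int p)"
    if "g1 \<in> carrier G" "g2 \<in> carrier G" "g3 \<in> carrier G" for g1 g2 g3
    using Z2_iff[OF G, of z p] Z2_iff[OF G, of w p] z w zw that unfolding eq[symmetric] by auto
  show ?thesis
    unfolding Z2_mult[OF G] Z2_iff[OF G C]
  proof (intro ballI)
    fix g1 g2 g3 assume "g1 \<in> carrier G" "g2 \<in> carrier G" "g3 \<in> carrier G"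
    from cong_add[OF zc[OF this] wc[OF this]]
    show "[z (g1, g2) + w (g1, g2) - (z (g1, g2 \<otimes>\<^bsub>G\<^esub> g3) + w (g1, g2 \<otimes>\<^bsub>G\<^esub> g3)) +
      (z (g1 \<otimes>\<^bsub>G\<^esub> g2, g3) + w (g1 \<otimes>\<^bsub>G\<^esub> g2, g3)) - (z (g2, g3) + w (g2, g3)) = 0] (mod int p)"
      by (simp add: algebra_simps)
  qed
qed

text \<open>This makes the isomorphism with
  $\mathbb{Z}/p$ additive on representatives.\<close>

lemma class2_mult:
  assumes G: "topological_group G" and p: "p > 0"
  shows "class2 p G z <#>\<^bsub>Z2 p G\<^esub> class2 p G w = class2 p G (z \<otimes>\<^bsub>Z2 p G\<^esub> w)"
proof -
  let ?add = "\<lambda>z w. \<lambda>x\<in>carrier G \<times> carrier G. (z x + w x) mod int p"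
  have rearrange: "?add (?add (d1 p G b) z) (?add (d1 p G c) w) = ?add (?add (d1 p G b) (d1 p G c)) (?add z w)" for b c
  proof (rule restrict_ext)
    fix x assume x: "x \<in> carrier G \<times> carrier G"
    have "[?add (d1 p G b) z x + ?add (d1 p G c) w x = (d1 p G b x + z x) + (d1 p G c x + w x)] (mod int p)"
      using x by (intro cong_add) auto
    moreover have "[?add (d1 p G b) (d1 p G c) x + ?add z w x = (d1 p G b x + d1 p G c x) + (z x + w x)] (mod int p)"
      using x by (intro cong_add) auto
    ultimately show "(?add (d1 p G b) z x + ?add (d1 p G c) w x) mod int p =
        (?add (d1 p G b) (d1 p G c) x + ?add z w x) mod int p"
      by (simp add: cong_def algebra_simps)
  qed
  have add: "\<exists>e\<in>C1 p G. ?add (d1 p G b) (d1 p G c) = d1 p G e" if "b \<in> C1 p G" "c \<in> C1 p G" for b c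
    using C1_add[OF G p that, of 1 1] by (intro bexI[of _ "\<lambda>g\<in>carrier G. (b g + c g) mod int p"]) (simp_all add: d1_add[OF G])
  have zero: "?add (d1 p G b) (d1 p G (\<lambda>g\<in>carrier G. 0)) = d1 p G b" for b
    unfolding d1_zero[OF G] by (rule ext) (auto simp: d1_def)
  show ?thesis
    unfolding set_mult_def Z2_mult[OF G] B2_coset[OF G]
  proof (intro equalityI subsetI)
    fix x assume "x \<in> (\<Union>h\<in>{?add (d1 p G b) z |b. b \<in> C1 p G}. \<Union>k\<in>{?add (d1 p G b) w |b. b \<in> C1 p G}. {?add h k})"
    then obtain b c where bc: "b \<in> C1 p G" "c \<in> C1 p G" "x = ?add (?add (d1 p G b) z) (?add (d1 p G c) w)" by blast
    obtain e where e: "e \<in> C1 p G" "?add (d1 p G b) (d1 p G c) = d1 p G e"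
      using add[OF bc(1,2)] by blast
    have "x = ?add (d1 p G e) (?add z w)" by (simp only: bc(3) rearrange e(2))
    then show "x \<in> {?add (d1 p G b) (?add z w) |b. b \<in> C1 p G}" using e(1) by blast
  next
    fix x assume "x \<in> {?add (d1 p G b) (?add z w) |b. b \<in> C1 p G}"
    then obtain b where b: "b \<in> C1 p G" "x = ?add (d1 p G b) (?add z w)" by blast
    then have "x = ?add (?add (d1 p G b) z) (?add (d1 p G (\<lambda>g\<in>carrier G. 0)) w)"
      by (simp only: rearrange zero)
    then show "x \<in> (\<Union>h\<in>{?add (d1 p G b) z |b. b \<in> C1 p G}. \<Union>k\<in>{?add (d1 p G b) w |b. b \<in> C1 p G}. {?add h k})"
      using b(1) C1_zero[OF G p] by blast
  qed
qed

text \<open>The second cohomology group has order \<open>p\<close>, so any class $\alpha\cup\beta \neq 0$ generates it, and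
  the multiples of it are the classes $\alpha\cup k\beta$.  Non-degeneracy provides such a \<open>\<beta>\<close>.\<close>

lemma demushkin_cup_surj:
  assumes p: "prime p" and D: "demushkin p G"
    and \<alpha>: "\<alpha> \<in> H1 p G" "\<alpha> \<noteq> (\<lambda>g\<in>carrier G. 0)"
    and z: "z \<in> carrier (Z2 p G)"
  shows "\<exists>\<beta>\<in>H1 p G. z \<otimes>\<^bsub>Z2 p G\<^esub> cprod p G \<alpha> \<beta> \<in> B2 p G"
proof -
  have p0: "p > 0" by (rule prime_gt_0_nat[OF p])
  have G: "topological_group G" using D unfolding demushkin_def by (blast intro: pro_p_topological_group)
  obtain \<phi> where \<phi>: "\<phi> \<in> iso (H2 p G) (integer_mod_group p)"
    using D by (auto simp: demushkin_def is_iso_def)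
  define \<Phi> where "\<Phi> w = \<phi> (class2 p G w)" for w
  have car: "class2 p G w \<in> carrier (H2 p G)" if "w \<in> carrier (Z2 p G)" for w
    using that by (auto simp: H2_def carrier_FactGroup class2_def)
  have \<Phi>_range: "0 \<le> \<Phi> w" "\<Phi> w < int p" if "w \<in> carrier (Z2 p G)" for w
    using \<phi> car[OF that] p0 by (auto simp: iso_def hom_def carrier_integer_mod_group \<Phi>_def)
  have \<Phi>_add: "\<Phi> (v \<otimes>\<^bsub>Z2 p G\<^esub> w) = (\<Phi> v + \<Phi> w) mod int p" if "v \<in> carrier (Z2 p G)" "w \<in> carrier (Z2 p G)" for v w
  proof -
    have "\<phi> (class2 p G v \<otimes>\<^bsub>H2 p G\<^esub> class2 p G w) = (\<Phi> v + \<Phi> w) mod int p"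
      using \<phi> car[OF that(1)] car[OF that(2)] by (simp add: iso_def hom_def \<Phi>_def)
    moreover have "class2 p G v \<otimes>\<^bsub>H2 p G\<^esub> class2 p G w = class2 p G (v \<otimes>\<^bsub>Z2 p G\<^esub> w)"
      by (simp add: H2_def class2_mult[OF G p0])
    ultimately show ?thesis by (simp add: \<Phi>_def)
  qed
  have inj: "class2 p G v = class2 p G w" if "v \<in> carrier (Z2 p G)" "w \<in> carrier (Z2 p G)" "\<Phi> v = \<Phi> w" for v w
    using \<phi> car[OF that(1)] car[OF that(2)] that(3) by (auto simp: iso_def bij_betw_def \<Phi>_def dest: inj_onD)
  let ?zero = "\<lambda>x\<in>carrier G \<times> carrier G. 0 :: int"
  have zero_cprod: "?zero = cprod p G \<alpha> (\<lambda>g\<in>carrier G. 0)"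
    unfolding cprod_def by (intro restrict_ext) auto
  have zero: "?zero \<in> carrier (Z2 p G)"
    unfolding zero_cprod by (rule cprod_Z2[OF G p0 \<alpha>(1) H1_zero[OF G p0]])
  have class_zero: "class2 p G ?zero = \<one>\<^bsub>H2 p G\<^esub>"
    using class2_d1[OF G p0 C1_zero[OF G p0]] by (simp add: d1_zero[OF G])
  have \<Phi>0: "\<Phi> ?zero = 0"
  proof -
    have "?zero \<otimes>\<^bsub>Z2 p G\<^esub> ?zero = ?zero"
      unfolding Z2_mult[OF G] by (intro restrict_ext) simp
    then have "[\<Phi> ?zero + 0 = \<Phi> ?zero + \<Phi> ?zero] (mod int p)"
      using \<Phi>_add[OF zero zero] \<Phi>_range[OF zero] by (simp add: cong_def)
    then have "[0 = \<Phi> ?zero] (mod int p)" by (simp only: cong_add_lcancel)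
    then show ?thesis using \<Phi>_range[OF zero] by (simp add: cong_def)
  qed
  obtain \<beta> where \<beta>: "\<beta> \<in> H1 p G" "cup p G \<alpha> \<beta> \<noteq> \<one>\<^bsub>H2 p G\<^esub>"
    using D \<alpha> unfolding demushkin_def by blast
  let ?w = "cprod p G \<alpha> \<beta>"
  have w: "?w \<in> carrier (Z2 p G)" by (rule cprod_Z2[OF G p0 \<alpha>(1) \<beta>(1)])
  have "\<Phi> ?w \<noteq> 0"
    using inj[OF w zero] \<Phi>0 \<beta>(2) class_zero by (auto simp: cup_def)
  define \<beta>' where "\<beta>' k = (\<lambda>g\<in>carrier G. (int k * \<beta> g) mod int p)" for k :: nat
  have \<beta>': "\<beta>' k \<in> H1 p G" for k
    unfolding \<beta>'_def by (rule H1_scale[OF G p0 \<beta>(1)])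
  have multiple: "\<Phi> (cprod p G \<alpha> (\<beta>' k)) = (int k * \<Phi> ?w) mod int p" for k
  proof (induction k)
    case 0
    have "\<beta>' 0 = (\<lambda>g\<in>carrier G. 0)" by (simp add: \<beta>'_def)
    then have "\<Phi> (cprod p G \<alpha> (\<beta>' 0)) = 0" by (simp only: \<Phi>0 zero_cprod[symmetric])
    then show ?case by simp
  next
    case (Suc k)
    have "cprod p G \<alpha> (\<beta>' (Suc k)) = cprod p G \<alpha> (\<beta>' k) \<otimes>\<^bsub>Z2 p G\<^esub> ?w"
      unfolding Z2_mult[OF G] cprod_def
    proof (intro restrict_ext)
      fix x assume x: "x \<in> carrier G \<times> carrier G"
      then obtain g h where gh: "x = (g, h)" "g \<in> carrier G" "h \<in> carrier G" by auto
      have "[\<alpha> g * \<beta>' (Suc k) h = \<alpha> g * (int (Suc k) * \<beta> h)] (mod int p)"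
        using gh by (intro cong_mult) (auto simp: \<beta>'_def)
      moreover have "[(\<alpha> g * \<beta>' k h) mod int p + (\<alpha> g * \<beta> h) mod int p = \<alpha> g * (int k * \<beta> h) + \<alpha> g * \<beta> h] (mod int p)"
      proof (intro cong_add)
        have "[\<alpha> g * \<beta>' k h = \<alpha> g * (int k * \<beta> h)] (mod int p)"
          using gh by (intro cong_mult) (auto simp: \<beta>'_def)
        then show "[(\<alpha> g * \<beta>' k h) mod int p = \<alpha> g * (int k * \<beta> h)] (mod int p)" by simp
      qed auto
      ultimately show "(case x of (g1, g2) \<Rightarrow> \<alpha> g1 * \<beta>' (Suc k) g2 mod int p) =
         ((\<lambda>(g1, g2)\<in>carrier G \<times> carrier G. \<alpha> g1 * \<beta>' k g2 mod int p) x +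
          (\<lambda>(g1, g2)\<in>carrier G \<times> carrier G. \<alpha> g1 * \<beta> g2 mod int p) x) mod int p"
        using gh by (simp add: cong_def algebra_simps)
    qed
    then have "\<Phi> (cprod p G \<alpha> (\<beta>' (Suc k))) = (\<Phi> (cprod p G \<alpha> (\<beta>' k)) + \<Phi> ?w) mod int p"
      using \<Phi>_add[OF cprod_Z2[OF G p0 \<alpha>(1) \<beta>'] w] by simp
    also have "\<dots> = (int (Suc k) * \<Phi> ?w) mod int p"
      unfolding Suc.IH mod_add_left_eq by (simp add: algebra_simps)
    finally show ?case .
  qed
  have "coprime (\<Phi> ?w) (int p)"
  proof (rule ccontr)
    assume "\<not> coprime (\<Phi> ?w) (int p)"
    then have "int p dvd \<Phi> ?w"
      using p prime_imp_coprime[of "int p" "\<Phi> ?w"] by (auto simp: coprime_commute)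
    then show False using \<open>\<Phi> ?w \<noteq> 0\<close> \<Phi>_range[OF w] zdvd_imp_le by fastforce
  qed
  then obtain u where u: "[\<Phi> ?w * u = 1] (mod int p)" using cong_solve_coprime_int by blast
  \<comment> \<open>The multiple of \<open>\<beta>\<close> whose product with \<open>\<alpha>\<close> cancels \<open>z\<close>.\<close>
  define k where "k = nat ((- \<Phi> z * u) mod int p)"
  have "[int k * \<Phi> ?w = - \<Phi> z * u * \<Phi> ?w] (mod int p)"
    using p0 by (intro cong_mult) (auto simp: k_def)
  also have "[- \<Phi> z * u * \<Phi> ?w = - \<Phi> z * 1] (mod int p)"
    unfolding mult.assoc using u by (intro cong_mult) (simp_all add: mult.commute)
  finally have k: "[int k * \<Phi> ?w = - \<Phi> z] (mod int p)" by simp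
  let ?s = "z \<otimes>\<^bsub>Z2 p G\<^esub> cprod p G \<alpha> (\<beta>' k)"
  have "[\<Phi> z + (int k * \<Phi> ?w) mod int p = \<Phi> z + - \<Phi> z] (mod int p)"
    using k by (intro cong_add) auto
  then have "\<phi> (class2 p G ?s) = \<phi> (class2 p G ?zero)"
    using \<Phi>_add[OF z cprod_Z2[OF G p0 \<alpha>(1) \<beta>'[of k]]] \<Phi>0 multiple[of k] by (simp add: cong_def \<Phi>_def)
  moreover have "class2 p G ?s \<in> carrier (H2 p G)"
    by (intro car Z2_closed[OF G p0 z] cprod_Z2[OF G p0 \<alpha>(1) \<beta>'])
  ultimately have "class2 p G ?s = \<one>\<^bsub>H2 p G\<^esub>"
    using \<phi> car[OF zero] class_zero by (auto simp: iso_def bij_betw_def dest: inj_onD)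
  then have "?s \<in> B2 p G"
    using class2_self[OF G p0, of "\<lambda>x. z x + cprod p G \<alpha> (\<beta>' k) x"] by (simp add: one_H2 Z2_mult[OF G])
  then show ?thesis using \<beta>' by blast
qed

text \<open>Let the last column \<open>d\<close> of the matrix be known below row \<open>n\<close>.  The sum is the coboundary that the
  missing entry of row \<open>n\<close> must have, and it is a cocycle by associativity of matrix multiplication.\<close>

lemma massey_column_cocycle:
  assumes G: "topological_group G" and p: "p > 0" and n: "a \<le> n"
    and c: "unipotent_system p G a b c"
    and d: "\<And>i. n < i \<Longrightarrow> i \<le> b \<Longrightarrow> d i \<in> C1 p G"
      "\<And>i g h. n < i \<Longrightarrow> i \<le> b \<Longrightarrow> g \<in> carrier G \<Longrightarrow> h \<in> carrier G \<Longrightarrow>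
         [d i (g \<otimes>\<^bsub>G\<^esub> h) = d i g + d i h - (\<Sum>k=i..<b. c i k g * d (Suc k) h)] (mod int p)"
  shows "(\<lambda>x\<in>carrier G \<times> carrier G. (\<Sum>k=n..<b. c n k (fst x) * d (Suc k) (snd x)) mod int p) \<in> carrier (Z2 p G)"
proof -
  have cC: "c n k \<in> C1 p G" if "k \<in> {n..<b}" for k
    using c n that by (simp add: unipotent_system_def)
  have dC: "d (Suc k) \<in> C1 p G" if "k \<in> {n..<b}" for k
    using d(1) that by simp
  have C: "(\<lambda>x\<in>carrier G \<times> carrier G. (\<Sum>k=n..<b. c n k (fst x) * d (Suc k) (snd x)) mod int p) \<in> C2 p G"
  proof (rule C2I[OF G p, of "{n..<b} \<times> UNIV" "\<lambda>(k, s). if s then c n k else d (Suc k)"])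
    fix x y assume eq: "\<And>i. i \<in> {n..<b} \<times> (UNIV :: bool set) \<Longrightarrow>
      (case i of (k, s) \<Rightarrow> if s then c n k else d (Suc k)) (fst x) = (case i of (k, s) \<Rightarrow> if s then c n k else d (Suc k)) (fst y) \<and>
      (case i of (k, s) \<Rightarrow> if s then c n k else d (Suc k)) (snd x) = (case i of (k, s) \<Rightarrow> if s then c n k else d (Suc k)) (snd y)"
    show "(\<Sum>k=n..<b. c n k (fst x) * d (Suc k) (snd x)) = (\<Sum>k=n..<b. c n k (fst y) * d (Suc k) (snd y))"
    proof (rule sum.cong)
      fix k assume "k \<in> {n..<b}"
      then show "c n k (fst x) * d (Suc k) (snd x) = c n k (fst y) * d (Suc k) (snd y)"
        using eq[of "(k, True)"] eq[of "(k, False)"] by simp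
    qed simp
  qed (use cC dC in auto)
  show ?thesis
    unfolding Z2_iff[OF G C] fst_conv snd_conv
  proof (intro ballI)
    fix x y z assume x: "x \<in> carrier G" and y: "y \<in> carrier G" and z: "z \<in> carrier G"
    let ?T = "\<lambda>k. \<Sum>l=Suc k..<b. c (Suc k) l y * d (Suc l) z"
    let ?S = "\<lambda>k. \<Sum>l=n..<k. c n l x * c (Suc l) k y"
    have "[(\<Sum>k=n..<b. c n k x * d (Suc k) y) - (\<Sum>k=n..<b. c n k x * d (Suc k) (y \<otimes>\<^bsub>G\<^esub> z)) +
        (\<Sum>k=n..<b. c n k (x \<otimes>\<^bsub>G\<^esub> y) * d (Suc k) z) - (\<Sum>k=n..<b. c n k y * d (Suc k) z) =
       (\<Sum>k=n..<b. c n k x * d (Suc k) y) - (\<Sum>k=n..<b. c n k x * (d (Suc k) y + d (Suc k) z - ?T k)) +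
        (\<Sum>k=n..<b. (c n k x + c n k y - ?S k) * d (Suc k) z) - (\<Sum>k=n..<b. c n k y * d (Suc k) z)] (mod int p)"
      using c n x y z by (intro cong_add cong_diff cong_sum cong_mult cong_refl d(2)) (auto simp: unipotent_system_def)
    also have "(\<Sum>k=n..<b. c n k x * d (Suc k) y) - (\<Sum>k=n..<b. c n k x * (d (Suc k) y + d (Suc k) z - ?T k)) +
        (\<Sum>k=n..<b. (c n k x + c n k y - ?S k) * d (Suc k) z) - (\<Sum>k=n..<b. c n k y * d (Suc k) z) = 0"
    proof -
      have 1: "(\<Sum>k=n..<b. c n k x * (d (Suc k) y + d (Suc k) z - ?T k)) =
        (\<Sum>k=n..<b. c n k x * d (Suc k) y) + (\<Sum>k=n..<b. c n k x * d (Suc k) z) - (\<Sum>k=n..<b. c n k x * ?T k)"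
        by (simp only: right_diff_distrib distrib_left sum.distrib sum_subtractf)
      have 2: "(\<Sum>k=n..<b. (c n k x + c n k y - ?S k) * d (Suc k) z) =
        (\<Sum>k=n..<b. c n k x * d (Suc k) z) + (\<Sum>k=n..<b. c n k y * d (Suc k) z) - (\<Sum>k=n..<b. ?S k * d (Suc k) z)"
        by (simp only: left_diff_distrib distrib_right sum.distrib sum_subtractf)
      have "(\<Sum>k=n..<b. ?S k * d (Suc k) z) = (\<Sum>k=n..<b. c n k x * ?T k)"
        by (simp only: sum_distrib_right sum_distrib_left mult.assoc
            sum_triangle_swap[of "\<lambda>l k. c n l x * (c (Suc l) k y * d (Suc k) z)"])
      with 1 2 show ?thesis by linarith
    qed
    finally show "[(\<Sum>k=n..<b. c n k x * d (Suc k) y) - (\<Sum>k=n..<b. c n k x * d (Suc k) (y \<otimes>\<^bsub>G\<^esub> z)) +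
        (\<Sum>k=n..<b. c n k (x \<otimes>\<^bsub>G\<^esub> y) * d (Suc k) z) - (\<Sum>k=n..<b. c n k y * d (Suc k) z) = 0] (mod int p)" .
  qed
qed

text \<open>The last column of the matrix is built upwards from its lowest entry \<open>\<alpha> b\<close>.  The next entry, in row
  \<open>n\<close>, exists if the cocycle of the preceding lemma is a coboundary.  If it is not, the entry below it is
  altered by a character \<open>\<beta>\<close>, which does not disturb the relations already satisfied and changes the
  obstruction by $\alpha_n\cup\beta$; by the surjectivity assumption this removes the obstruction.  The lowest
  entry itself may not be altered, and there the assumption on cup products takes over.\<close>

lemma massey_column:
  assumes G: "topological_group G" and p: "p > 0"
    and surj: "\<And>i z. \<lbrakk>i \<in> {a..<b}; z \<in> carrier (Z2 p G)\<rbrakk> \<Longrightarrow>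
       \<exists>\<beta>\<in>H1 p G. z \<otimes>\<^bsub>Z2 p G\<^esub> cprod p G (\<alpha> i) \<beta> \<in> B2 p G"
    and ab: "a \<le> b" and c: "unipotent_system p G a b c" "\<forall>i\<in>{a..<b}. c i i = \<alpha> i" and \<alpha>: "\<alpha> b \<in> H1 p G"
    and cup: "\<And>i. \<lbrakk>a \<le> i; Suc i = b\<rbrakk> \<Longrightarrow> cup_zero p G (\<alpha> i) (\<alpha> b)"
  shows "\<exists>d. d b = \<alpha> b \<and> (\<forall>i. a \<le> i \<and> i \<le> b \<longrightarrow> d i \<in> C1 p G \<and> (\<forall>g\<in>carrier G. \<forall>h\<in>carrier G.
         [d i (g \<otimes>\<^bsub>G\<^esub> h) = d i g + d i h - (\<Sum>k=i..<b. c i k g * d (Suc k) h)] (mod int p)))"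
  using ab
proof (induction rule: inc_induct)
  case base
  show ?case
    using \<alpha> by (intro exI[of _ "\<lambda>_. \<alpha> b"]) (auto simp: H1_iff[OF G p])
next
  case (step n)
  then obtain d where db: "d b = \<alpha> b" and dC: "\<And>i. Suc n \<le> i \<Longrightarrow> i \<le> b \<Longrightarrow> d i \<in> C1 p G"
    and deq: "\<And>i g h. \<lbrakk>Suc n \<le> i; i \<le> b; g \<in> carrier G; h \<in> carrier G\<rbrakk> \<Longrightarrow>
         [d i (g \<otimes>\<^bsub>G\<^esub> h) = d i g + d i h - (\<Sum>k=i..<b. c i k g * d (Suc k) h)] (mod int p)"
    by blast
  have "\<exists>e\<in>C1 p G. \<exists>\<beta>\<in>H1 p G. (Suc n = b \<longrightarrow> \<beta> = (\<lambda>g\<in>carrier G. 0)) \<and> (\<forall>g\<in>carrier G. \<forall>h\<in>carrier G.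
      [e (g \<otimes>\<^bsub>G\<^esub> h) = e g + e h - ((\<Sum>k=n..<b. c n k g * d (Suc k) h) + \<alpha> n g * \<beta> h)] (mod int p))"
  proof (cases "Suc n = b")
    case True
    then obtain e where e: "e \<in> C1 p G" "\<forall>g\<in>carrier G. \<forall>h\<in>carrier G. [e (g \<otimes>\<^bsub>G\<^esub> h) = e g + e h - \<alpha> n g * \<alpha> b h] (mod int p)"
      using cup[of n] step.hyps unfolding cup_zero_def by blast
    have "{n..<b} = {n}" using True by auto
    moreover have "c n n = \<alpha> n" using c(2) step.hyps by simp
    ultimately show ?thesis
      using e True db by (intro bexI[OF _ e(1)] bexI[OF _ H1_zero[OF G p]]) simp
  next
    case False
    let ?F = "\<lambda>x. \<Sum>k=n..<b. c n k (fst x) * d (Suc k) (snd x)"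
    have "(\<lambda>x\<in>carrier G \<times> carrier G. ?F x mod int p) \<in> carrier (Z2 p G)"
      by (rule massey_column_cocycle[OF G p step.hyps(1) c(1)]) (use dC deq in auto)
    from surj[OF _ this, of n] step.hyps obtain \<beta> e where \<beta>: "\<beta> \<in> H1 p G" and e: "e \<in> C1 p G"
      and eq: "(\<lambda>x\<in>carrier G \<times> carrier G. ?F x mod int p) \<otimes>\<^bsub>Z2 p G\<^esub> cprod p G (\<alpha> n) \<beta> = d1 p G e"
      unfolding B2_def by auto
    have "(\<lambda>x\<in>carrier G \<times> carrier G. ?F x mod int p) \<otimes>\<^bsub>Z2 p G\<^esub> cprod p G (\<alpha> n) \<beta> =
      (\<lambda>x\<in>carrier G \<times> carrier G. (?F x + \<alpha> n (fst x) * \<beta> (snd x)) mod int p)"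
      unfolding Z2_mult[OF G] cprod_eq by (intro restrict_ext) (simp add: mod_add_eq)
    then have "d1 p G e = (\<lambda>x\<in>carrier G \<times> carrier G. (?F x + \<alpha> n (fst x) * \<beta> (snd x)) mod int p)"
      using eq by simp
    then have "\<forall>g\<in>carrier G. \<forall>h\<in>carrier G.
      [e (g \<otimes>\<^bsub>G\<^esub> h) = e g + e h - ((\<Sum>k=n..<b. c n k g * d (Suc k) h) + \<alpha> n g * \<beta> h)] (mod int p)"
      unfolding d1_eq_iff[OF G p] by simp
    then show ?thesis using \<beta> e False by blast
  qed
  then obtain e \<beta> where e: "e \<in> C1 p G" and \<beta>: "\<beta> \<in> H1 p G" and \<beta>0: "Suc n = b \<Longrightarrow> \<beta> = (\<lambda>g\<in>carrier G. 0)"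
    and eeq: "\<And>g h. g \<in> carrier G \<Longrightarrow> h \<in> carrier G \<Longrightarrow>
      [e (g \<otimes>\<^bsub>G\<^esub> h) = e g + e h - ((\<Sum>k=n..<b. c n k g * d (Suc k) h) + \<alpha> n g * \<beta> h)] (mod int p)"
    by blast
  \<comment> \<open>The entry below row \<open>n\<close> is altered by \<open>\<beta>\<close>, and \<open>e\<close> becomes the entry of row \<open>n\<close>.\<close>
  define f where "f = (\<lambda>g\<in>carrier G. (1 * d (Suc n) g + 1 * \<beta> g) mod int p)"
  have dSn: "d (Suc n) \<in> C1 p G" using dC step.hyps by simp
  have fC: "f \<in> C1 p G"
    unfolding f_def using \<beta> by (intro C1_add[OF G p dSn]) (simp add: H1_iff[OF G p])
  have f: "[f g = d (Suc n) g + \<beta> g] (mod int p)" if "g \<in> carrier G" for g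
    using that by (simp add: f_def)
  define d' where "d' i = (if i = n then e else if i = Suc n then f else d i)" for i
  have "d' b = \<alpha> b"
  proof (cases "Suc n = b")
    case True
    then have "f = d b"
      using dSn C1_range(3)[OF G dSn] \<beta>0 by (intro C1_eqI[OF G fC]) (auto simp: f_def)
    then show ?thesis using True db by (simp add: d'_def)
  qed (use step.hyps db in \<open>auto simp: d'_def\<close>)
  moreover have "d' i \<in> C1 p G" if "n \<le> i" "i \<le> b" for i
    using that e fC dC by (simp add: d'_def)
  moreover have "[d' i (g \<otimes>\<^bsub>G\<^esub> h) = d' i g + d' i h - (\<Sum>k=i..<b. c i k g * d' (Suc k) h)] (mod int p)"
    if i: "n \<le> i" "i \<le> b" and g: "g \<in> carrier G" and h: "h \<in> carrier G" for i g h
  proof -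
    have gh: "g \<otimes>\<^bsub>G\<^esub> h \<in> carrier G" by (rule topological_group_mult_closed[OF G g h])
    have same: "(\<Sum>k=i..<b. c i k g * d' (Suc k) h) = (\<Sum>k=i..<b. c i k g * d (Suc k) h)" if "n < i"
      using that by (intro sum.cong) (auto simp: d'_def)
    consider "i = n" | "i = Suc n" | "Suc n < i" using i by linarith
    then show ?thesis
    proof cases
      case 1
      have "(\<Sum>k=n..<b. c n k g * d' (Suc k) h) = c n n g * f h + (\<Sum>k=Suc n..<b. c n k g * d (Suc k) h)"
        using step.hyps by (simp add: sum.atLeast_Suc_lessThan d'_def)
      moreover have "[c n n g * f h = c n n g * d (Suc n) h + \<alpha> n g * \<beta> h] (mod int p)"
      proof -
        have "c n n = \<alpha> n" using c(2) step.hyps by simp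
        moreover have "[\<alpha> n g * f h = \<alpha> n g * (d (Suc n) h + \<beta> h)] (mod int p)"
          using f[OF h] by (intro cong_mult) auto
        ultimately show ?thesis by (simp add: algebra_simps)
      qed
      moreover have "(\<Sum>k=n..<b. c n k g * d (Suc k) h) = c n n g * d (Suc n) h + (\<Sum>k=Suc n..<b. c n k g * d (Suc k) h)"
        using step.hyps by (simp add: sum.atLeast_Suc_lessThan)
      ultimately have "[(\<Sum>k=n..<b. c n k g * d (Suc k) h) + \<alpha> n g * \<beta> h = (\<Sum>k=n..<b. c n k g * d' (Suc k) h)] (mod int p)"
        by (simp add: cong_iff_dvd_diff) (smt (verit, best) dvd_minus_iff)
      then have "[e g + e h - ((\<Sum>k=n..<b. c n k g * d (Suc k) h) + \<alpha> n g * \<beta> h) = e g + e h - (\<Sum>k=n..<b. c n k g * d' (Suc k) h)] (mod int p)"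
        by (intro cong_diff cong_refl)
      with eeq[OF g h] show ?thesis unfolding 1 by (auto simp: d'_def intro: cong_trans)
    next
      case 2
      have "[f (g \<otimes>\<^bsub>G\<^esub> h) = d (Suc n) (g \<otimes>\<^bsub>G\<^esub> h) + \<beta> (g \<otimes>\<^bsub>G\<^esub> h)] (mod int p)" by (rule f[OF gh])
      also have "[d (Suc n) (g \<otimes>\<^bsub>G\<^esub> h) + \<beta> (g \<otimes>\<^bsub>G\<^esub> h) =
          (d (Suc n) g + d (Suc n) h - (\<Sum>k=Suc n..<b. c (Suc n) k g * d (Suc k) h)) + (\<beta> g + \<beta> h)] (mod int p)"
        using \<beta> g h step.hyps by (intro cong_add deq) (auto simp: H1_iff[OF G p])
      also have "(d (Suc n) g + d (Suc n) h - (\<Sum>k=Suc n..<b. c (Suc n) k g * d (Suc k) h)) + (\<beta> g + \<beta> h) =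
          (d (Suc n) g + \<beta> g) + (d (Suc n) h + \<beta> h) - (\<Sum>k=Suc n..<b. c (Suc n) k g * d (Suc k) h)"
        by simp
      also have "[(d (Suc n) g + \<beta> g) + (d (Suc n) h + \<beta> h) - (\<Sum>k=Suc n..<b. c (Suc n) k g * d (Suc k) h) =
          f g + f h - (\<Sum>k=Suc n..<b. c (Suc n) k g * d (Suc k) h)] (mod int p)"
        using f[OF g] f[OF h] by (intro cong_add cong_diff cong_refl) (simp_all add: cong_sym)
      finally show ?thesis using same 2 by (simp add: d'_def)
    next
      case 3
      then show ?thesis using deq[of i g h] same i g h by (simp add: d'_def)
    qed
  qed
  ultimately show ?case by (intro exI[of _ d']) blast
qed

text \<open>On a segment of nonzero characters the columns are added one at a time.\<close>

lemma massey_liftable_demushkin: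
  assumes p: "prime p" and D: "demushkin p G"
  shows "massey_liftable p G"
  unfolding massey_liftable_def
proof (intro allI impI, elim conjE)
  have p0: "p > 0" by (rule prime_gt_0_nat[OF p])
  have G: "topological_group G" using D unfolding demushkin_def by (blast intro: pro_p_topological_group)
  fix a b :: nat and \<alpha> assume \<alpha>: "\<forall>i\<in>{a..<b}. \<alpha> i \<in> H1 p G" 
    and cup: "\<forall>i. a \<le> i \<and> Suc i < b \<longrightarrow> cup_zero p G (\<alpha> i) (\<alpha> (Suc i))"
  show "massey_lift p G a b \<alpha>"
  proof (rule massey_lift_if_zero_free[OF G p0])
    fix a' b' assume ab: "a \<le> a'" "b' \<le> b" and nz: "\<forall>i\<in>{a'..<b'}. \<alpha> i \<noteq> (\<lambda>g\<in>carrier G. 0)"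
    have "massey_lift p G a' (a' + n) \<alpha>" if "a' + n \<le> b'" for n
      using that
    proof (induction n)
      case 0
      show ?case by (auto simp: massey_lift_def unipotent_system_def)
    next
      case (Suc n)
      let ?b = "a' + n"
      obtain c where c: "unipotent_system p G a' ?b c" "\<forall>i\<in>{a'..<?b}. c i i = \<alpha> i"
        using Suc by (auto simp: massey_lift_def)
      have "\<exists>d. d ?b = \<alpha> ?b \<and> (\<forall>i. a' \<le> i \<and> i \<le> ?b \<longrightarrow> d i \<in> C1 p G \<and> (\<forall>g\<in>carrier G. \<forall>h\<in>carrier G.
         [d i (g \<otimes>\<^bsub>G\<^esub> h) = d i g + d i h - (\<Sum>k=i..<?b. c i k g * d (Suc k) h)] (mod int p)))"
      proof (rule massey_column[OF G p0 _ _ c])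
        show "\<exists>\<beta>\<in>H1 p G. z \<otimes>\<^bsub>Z2 p G\<^esub> cprod p G (\<alpha> i) \<beta> \<in> B2 p G" if "i \<in> {a'..<?b}" "z \<in> carrier (Z2 p G)" for i z
          using \<alpha> nz ab Suc.prems that by (intro demushkin_cup_surj[OF p D]) auto
        show "\<alpha> ?b \<in> H1 p G" using \<alpha> ab Suc.prems by simp
        show "cup_zero p G (\<alpha> i) (\<alpha> ?b)" if "a' \<le> i" "Suc i = ?b" for i
        proof -
          have "a \<le> i \<and> Suc i < b" using ab Suc.prems that by linarith
          then show ?thesis using cup that(2) by metis
        qed
      qed simp
      then obtain d where d: "d ?b = \<alpha> ?b" "\<And>i. a' \<le> i \<Longrightarrow> i \<le> ?b \<Longrightarrow> d i \<in> C1 p G"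
         "\<And>i g h. \<lbrakk>a' \<le> i; i \<le> ?b; g \<in> carrier G; h \<in> carrier G\<rbrakk> \<Longrightarrow>
            [d i (g \<otimes>\<^bsub>G\<^esub> h) = d i g + d i h - (\<Sum>k=i..<?b. c i k g * d (Suc k) h)] (mod int p)"
        by blast
      define c' where "c' i j = (if j = ?b then d i else c i j)" for i j
      have "unipotent_system p G a' (a' + Suc n) c'"
        unfolding unipotent_system_def
      proof (intro allI impI)
        fix i j assume ij: "a' \<le> i \<and> i \<le> j \<and> j < a' + Suc n"
        show "c' i j \<in> C1 p G \<and> (\<forall>g\<in>carrier G. \<forall>h\<in>carrier G.
          [c' i j (g \<otimes>\<^bsub>G\<^esub> h) = c' i j g + c' i j h - (\<Sum>k=i..<j. c' i k g * c' (Suc k) j h)] (mod int p))"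
        proof (cases "j = ?b")
          case True
          have "(\<Sum>k=i..<j. c' i k g * c' (Suc k) j h) = (\<Sum>k=i..<j. c i k g * d (Suc k) h)" for g h
            using True by (intro sum.cong) (auto simp: c'_def)
          then show ?thesis using d(2,3)[of i] ij True by (simp add: c'_def)
        next
          case False
          have "(\<Sum>k=i..<j. c' i k g * c' (Suc k) j h) = (\<Sum>k=i..<j. c i k g * c (Suc k) j h)" for g h
            using False ij by (intro sum.cong) (auto simp: c'_def)
          then show ?thesis using c(1) ij False by (simp add: c'_def unipotent_system_def)
        qed
      qed
      moreover have "\<forall>i\<in>{a'..<a' + Suc n}. c' i i = \<alpha> i"
        using c(2) d(1) by (auto simp: c'_def)
      ultimately show ?case by (auto simp: massey_lift_def)
    qed
    from this[of "b' - a'"] show "massey_lift p G a' b' \<alpha>"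
    proof (cases "a' \<le> b'")
      case False
      then show ?thesis by (auto simp: massey_lift_def unipotent_system_def)
    qed simp
  qed
qed

section \<open>Substitution matrices\<close>

text \<open>Congruence in $\mathbb{F}_p[x]/(x^{n+1})$.\<close>

definition trunc_cong :: "nat \<Rightarrow> nat \<Rightarrow> int poly \<Rightarrow> int poly \<Rightarrow> bool" where
  "trunc_cong p n f g \<longleftrightarrow> (\<forall>i\<le>n. [coeff f i = coeff g i] (mod int p))"

lemma trunc_cong_refl [simp]: "trunc_cong p n f f"
  by (simp add: trunc_cong_def)

lemma trunc_cong_sym: "trunc_cong p n f g \<Longrightarrow> trunc_cong p n g f"
  by (simp add: trunc_cong_def cong_sym_eq)

lemma trunc_cong_trans: "trunc_cong p n f g \<Longrightarrow> trunc_cong p n g h \<Longrightarrow> trunc_cong p n f h"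
  unfolding trunc_cong_def using cong_trans by blast

lemma trunc_cong_diff: "trunc_cong p n f g \<Longrightarrow> trunc_cong p n f' g' \<Longrightarrow> trunc_cong p n (f - f') (g - g')"
  by (simp add: trunc_cong_def cong_diff)

lemma trunc_cong_mult: "trunc_cong p n f g \<Longrightarrow> trunc_cong p n f' g' \<Longrightarrow> trunc_cong p n (f * f') (g * g')"
  unfolding trunc_cong_def coeff_mult by (intro allI impI cong_sum cong_mult) auto

lemma trunc_cong_power: "trunc_cong p n f g \<Longrightarrow> trunc_cong p n (f ^ k) (g ^ k)"
  by (induction k) (simp_all add: trunc_cong_mult)

abbreviation one_plus_X :: "int poly" where "one_plus_X \<equiv> [:1, 1:]"

lemma prime_dvd_prime_power_choose:
  assumes p: "prime p" and k: "0 < k" "k < p ^ m"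
  shows "p dvd (p ^ m choose k)"
proof (rule ccontr)
  assume "\<not> p dvd (p ^ m choose k)"
  then have "coprime (p ^ m) (p ^ m choose k)"
    using p by (simp add: prime_imp_coprime)
  moreover have "p ^ m dvd k * (p ^ m choose k)"
    using times_binomial_minus1_eq[OF k(1), of "p ^ m"] by simp
  ultimately have "p ^ m dvd k" by (simp add: coprime_dvd_mult_left_iff)
  then show False using k by (simp add: nat_dvd_not_less)
qed

text \<open>Modulo \<open>p\<close> this is $(1+x)^{p^m} = 1 + x^{p^m}$.\<close>

lemma trunc_cong_X1_prime_power:
  assumes p: "prime p" and n: "n < p ^ m"
  shows "trunc_cong p n (one_plus_X ^ (p ^ m)) 1"
  unfolding trunc_cong_def
proof (intro allI impI)
  fix i assume i: "i \<le> n"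
  have "[int (p ^ m choose i) = coeff 1 i] (mod int p)"
  proof (cases "i = 0")
    case False
    then have "p dvd (p ^ m choose i)" using i n by (intro prime_dvd_prime_power_choose[OF p]) auto
    then have "int p dvd int (p ^ m choose i)" by presburger
    then show ?thesis using False by (simp add: cong_0_iff coeff_1)
  qed simp
  then show "[coeff (one_plus_X ^ (p ^ m)) i = coeff 1 i] (mod int p)"
    using i n by (simp add: coeff_linear_poly_power)
qed

lemma trunc_cong_X1_power:
  assumes p: "prime p" and n: "n < p ^ m" and ab: "[a = b] (mod p ^ m)"
  shows "trunc_cong p n (one_plus_X ^ a) (one_plus_X ^ b)"
proof -
  have *: "trunc_cong p n (one_plus_X ^ a) (one_plus_X ^ (a mod p ^ m))" for a
  proof -
    have "one_plus_X ^ a = (one_plus_X ^ (p ^ m)) ^ (a div p ^ m) * one_plus_X ^ (a mod p ^ m)"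
      by (simp flip: power_mult power_add)
    moreover have "trunc_cong p n ((one_plus_X ^ (p ^ m)) ^ (a div p ^ m) * one_plus_X ^ (a mod p ^ m)) (1 ^ (a div p ^ m) * one_plus_X ^ (a mod p ^ m))"
      by (intro trunc_cong_mult trunc_cong_power trunc_cong_X1_prime_power p n trunc_cong_refl)
    ultimately show ?thesis by simp
  qed
  show ?thesis
    using *[of a] trunc_cong_sym[OF *[of b]] ab by (simp add: cong_def) (rule trunc_cong_trans)
qed

text \<open>The image of $x^j$ under the operator
  $F(x) \mapsto (1+x)^b F((1+x)^t - 1)$ on polynomials.  With $\mathbb{F}_p[x]/(x^{n+1})$ viewed as a quotient of
  the completed group algebra of $\mathbb{Z}_p$, where the generator is $1+x$, this is multiplication by the
  group element \<open>b\<close> after the automorphism induced by multiplication by \<open>t\<close>.  The operators therefore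
  compose like the affine maps $z \mapsto b + tz$, and their matrices are triangular.\<close>

definition aff_poly :: "nat \<Rightarrow> nat \<Rightarrow> nat \<Rightarrow> int poly" where
  "aff_poly b t j = one_plus_X ^ b * (one_plus_X ^ t - 1) ^ j"

lemma aff_poly_cong:
  assumes p: "prime p" and n: "n < p ^ m" and "[b = b'] (mod p ^ m)" "[t = t'] (mod p ^ m)"
  shows "trunc_cong p n (aff_poly b t j) (aff_poly b' t' j)"
  unfolding aff_poly_def
  by (intro trunc_cong_mult trunc_cong_power trunc_cong_diff trunc_cong_X1_power[OF p n] assms trunc_cong_refl)

lemma X1_power_minus_1: "\<exists>Q. one_plus_X ^ t - 1 = monom 1 1 * Q \<and> coeff Q 0 = int t \<and> coeff Q 1 = int (t choose 2)"
proof -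
  obtain a Q where Q: "one_plus_X ^ t - 1 = pCons a Q" by (metis pCons_cases)
  have "coeff (one_plus_X ^ t - 1) i = (if i = 0 then 0 else int (t choose i))" for i
    by (cases "i \<le> t") (auto simp: coeff_linear_poly_power coeff_1 coeff_eq_0 degree_linear_power binomial_eq_0)
  then have c: "coeff (pCons a Q) i = (if i = 0 then 0 else int (t choose i))" for i
    by (simp add: Q)
  have "a = 0" using c[of 0] by simp
  moreover have "coeff Q 0 = int t" using c[of 1] by simp
  moreover have "coeff Q 1 = int (t choose 2)" using c[of 2] by (simp add: numeral_2_eq_2)
  moreover have "pCons 0 Q = monom 1 1 * Q" by (simp add: monom_altdef)
  ultimately show ?thesis using Q by auto
qed

lemma aff_poly_lower: "i < j \<Longrightarrow> coeff (aff_poly b t j) i = 0"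
proof -
  assume ij: "i < j"
  obtain Q where Q: "one_plus_X ^ t - 1 = monom 1 1 * Q" using X1_power_minus_1 by blast
  have "aff_poly b t j = monom 1 j * (one_plus_X ^ b * Q ^ j)"
    by (simp add: aff_poly_def Q power_mult_distrib monom_power mult_ac)
  then show ?thesis using ij by (simp only: coeff_monom_mult if_True)
qed

text \<open>Modulo \<open>p\<close>, the assumptions on \<open>t\<close> say that $(1+x)^t - 1 \equiv x + 0\cdot x^2 + \dots$; the two leading
  coefficients are therefore those of $x^j(1+x)^b$.\<close>

lemma aff_poly_diagonals:
  assumes t: "[int t = 1] (mod int p)" "p dvd (t choose 2)"
  shows "[coeff (aff_poly b t j) j = 1] (mod int p)" "[coeff (aff_poly b t j) (Suc j) = int b] (mod int p)"
proof -
  obtain Q where Q: "one_plus_X ^ t - 1 = monom 1 1 * Q" "coeff Q 0 = int t" "coeff Q 1 = int (t choose 2)" 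
    using X1_power_minus_1 by blast
  have eq: "aff_poly b t j = monom 1 j * (one_plus_X ^ b * Q ^ j)"
    by (simp add: aff_poly_def Q(1) power_mult_distrib monom_power mult_ac)
  have "trunc_cong p 1 Q 1"
    unfolding trunc_cong_def
  proof (intro allI impI)
    fix i :: nat assume "i \<le> 1"
    then consider "i = 0" | "i = 1" by linarith
    then show "[coeff Q i = coeff 1 i] (mod int p)"
    proof cases
      case 2
      have "int p dvd int (t choose 2)" using t(2) by presburger
      then show ?thesis using Q(3) 2 by (simp add: cong_0_iff)
    qed (use t(1) Q(2) in simp)
  qed
  then have "trunc_cong p 1 (one_plus_X ^ b * Q ^ j) (one_plus_X ^ b * 1 ^ j)"
    by (intro trunc_cong_mult trunc_cong_power trunc_cong_refl)
  then have c: "[coeff (one_plus_X ^ b * Q ^ j) i = coeff (one_plus_X ^ b) i] (mod int p)" if "i \<le> 1" for i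
    using that by (simp add: trunc_cong_def)
  have "coeff (one_plus_X ^ b) 0 = 1" "coeff (one_plus_X ^ b) 1 = int b"
    by (simp add: coeff_0_power) (cases "b = 0"; simp add: coeff_linear_poly_power)
  then show "[coeff (aff_poly b t j) j = 1] (mod int p)" "[coeff (aff_poly b t j) (Suc j) = int b] (mod int p)"
    using c[of 0] c[of 1] unfolding eq coeff_monom_mult by simp_all
qed

lemma pcompose_power: "pcompose (f ^ n) g = pcompose f g ^ n" for f g :: "int poly"
  by (induction n) (simp_all add: pcompose_mult pcompose_1)

lemma pcompose_sum_coeff: "pcompose f g = (\<Sum>k\<le>degree f. smult (coeff f k) (g ^ k))" for f g :: "int poly"
proof -
  have "f = (\<Sum>k\<le>degree f. smult (coeff f k) (monom 1 1 ^ k))"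
    by (subst poly_as_sum_of_monoms[of f, symmetric]) (simp add: monom_power smult_monom)
  then have "pcompose f g = pcompose (\<Sum>k\<le>degree f. smult (coeff f k) (monom 1 1 ^ k)) g" by simp
  also have "\<dots> = (\<Sum>k\<le>degree f. smult (coeff f k) (g ^ k))"
    by (simp add: pcompose_sum pcompose_smult pcompose_power monom_altdef pcompose_pCons)
  finally show ?thesis .
qed

text \<open>Substituting $(1+x)^t - 1$ for \<open>x\<close> turns $1+x$ into $(1+x)^t$.\<close>

lemma aff_poly_compose: "aff_poly (b + t * b') (t * t') j = one_plus_X ^ b * pcompose (aff_poly b' t' j) (one_plus_X ^ t - 1)"
proof -
  have "pcompose one_plus_X (one_plus_X ^ t - 1) = one_plus_X ^ t" by (simp add: pcompose_pCons one_pCons)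
  then have "pcompose (aff_poly b' t' j) (one_plus_X ^ t - 1) = (one_plus_X ^ t) ^ b' * ((one_plus_X ^ t) ^ t' - 1) ^ j"
    by (simp add: aff_poly_def pcompose_mult pcompose_power pcompose_diff pcompose_1)
  then show ?thesis by (simp add: aff_poly_def power_add power_mult)
qed

lemma aff_poly_matrix_mult:
  "coeff (aff_poly (b + t * b') (t * t') j) i = (\<Sum>k=j..i. coeff (aff_poly b' t' j) k * coeff (aff_poly b t k) i)"
proof -
  let ?f = "aff_poly b' t' j"
  have "coeff (aff_poly (b + t * b') (t * t') j) i = (\<Sum>k\<le>degree ?f. coeff ?f k * coeff (aff_poly b t k) i)"
    by (simp add: aff_poly_compose pcompose_sum_coeff sum_distrib_left coeff_sum) (simp add: aff_poly_def mult_ac)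
  also have "\<dots> = (\<Sum>k\<le>max i (degree ?f). coeff ?f k * coeff (aff_poly b t k) i)"
    by (intro sum.mono_neutral_left) (auto simp: coeff_eq_0)
  also have "\<dots> = (\<Sum>k=j..i. coeff ?f k * coeff (aff_poly b t k) i)"
    by (intro sum.mono_neutral_right) (auto simp: aff_poly_lower not_le)
  finally show ?thesis .
qed

text \<open>For odd \<open>p\<close> the factor \<open>t - 1\<close> of $t(t-1)/2$ suffices; for \<open>p = 2\<close> the division by 2 costs one power,
  and this is what the congruence modulo 4 pays for.\<close>

lemma prime_dvd_choose_2:
  assumes p: "prime p" and t: "[int t = 1] (mod int p)" and 4: "p = 2 \<Longrightarrow> [int t = 1] (mod 4)"
  shows "p dvd (t choose 2)"
proof (cases "t = 0")
  case False
  have dvd: "p dvd t - 1"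
    using t False by (simp add: cong_iff_dvd_diff of_nat_diff flip: int_dvd_int_iff)
  show ?thesis
  proof (cases "p = 2")
    case True
    then have "4 dvd t - 1"
      using 4 False by (simp add: cong_iff_dvd_diff of_nat_diff flip: int_dvd_int_iff)
    then obtain q where "t - 1 = 4 * q" by blast
    then have "t * (t - 1) = 2 * (2 * (t * q))" by simp
    then have "t choose 2 = 2 * (t * q)" unfolding choose_two by presburger
    then show ?thesis using True by simp
  next
    case False
    have "2 * (t choose 2) = t * (t - 1)" using times_binomial_minus1_eq[of 2 t] by (simp add: mult.commute)
    then have "p dvd 2 * (t choose 2)" using dvd by simp
    then show ?thesis using p False by (metis prime_dvd_mult_iff primes_dvd_imp_eq two_is_prime_nat)
  qed
qed (simp add: binomial_eq_0)

text \<open>The cyclotomic part of the argument.  Lift \<open>\<epsilon>\<close> to a twisted cocycle \<open>B\<close> modulo a large power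
  of \<open>p\<close>.  Then $g \mapsto (z \mapsto B(g) + \theta(g)z)$ is a homomorphism to affine maps, and the
  substitution matrices turn it into unipotent matrices all of whose superdiagonal entries are \<open>\<epsilon>\<close>;
  a diagonal conjugation yields arbitrary multiples.\<close>

lemma massey_lift_proportional:
  assumes p: "prime p" and G: "topological_group G" and \<theta>: "\<theta> \<in> cont_hom G (principal_units p)"
    and 4: "p = 2 \<Longrightarrow> \<theta> ` carrier G \<subseteq> one_plus 2 2"
    and K: "kummerian p G \<theta>" and \<epsilon>: "\<epsilon> \<in> H1 p G"
  shows "massey_lift p G a e (\<lambda>i. \<lambda>g\<in>carrier G. (r i * \<epsilon> g) mod int p)"
proof -
  have p0: "p > 0" by (rule prime_gt_0_nat[OF p])
  have p1: "p > 1" by (rule prime_gt_1_nat[OF p])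
  \<comment> \<open>Large enough for $p^m$ to exceed all exponents that matter, and at least 2 so that the residue shows $\theta$ modulo 4.\<close>
  define m where "m = e + 2"
  have m1: "m \<ge> 1" by (simp add: m_def)
  have "m < p ^ m" using p1 by (intro power_gt_expt) simp
  then have em: "e < p ^ m" by (simp add: m_def)
  obtain B where B: "B \<in> C1 (p ^ m) G" "\<And>g. g \<in> carrier G \<Longrightarrow> [B g = \<epsilon> g] (mod int p)"
    "\<And>g h. g \<in> carrier G \<Longrightarrow> h \<in> carrier G \<Longrightarrow> [B (g \<otimes>\<^bsub>G\<^esub> h) = B g + \<theta> g m * B h] (mod int p ^ m)"
    using kummerianD[OF K m1 \<epsilon>] by blast
  define b where "b g = nat (B g)" for g
  define t where "t g = nat (\<theta> g m)" for g
  have b: "int (b g) = B g" and t: "int (t g) = \<theta> g m" if "g \<in> carrier G" for g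
    using C1_range(1)[OF G B(1) that] orientation_residue(2)[OF p0 \<theta> that] by (simp_all add: b_def t_def)
  have t1: "[int (t g) = 1] (mod int p)" if "g \<in> carrier G" for g
    using orientation_residue(4)[OF p0 \<theta> that m1] t[OF that] by simp
  have t2: "p dvd (t g choose 2)" if g: "g \<in> carrier G" for g
  proof (rule prime_dvd_choose_2[OF p t1[OF g]])
    assume "p = 2"
    then have "\<theta> g \<in> one_plus 2 2" using 4 g by blast
    then have "[\<theta> g m = 1] (mod int 2 ^ 2)" by (rule one_plus_mod) (simp add: m_def)
    then show "[int (t g) = 1] (mod 4)" by (simp add: t[OF g])
  qed
  define s where "s j i g = coeff (aff_poly (b g) (t g) j) i" for j i g
  have s_mult: "[s j i (g \<otimes>\<^bsub>G\<^esub> h) = (\<Sum>k=j..i. s j k h * s k i g)] (mod int p)"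
    if g: "g \<in> carrier G" and h: "h \<in> carrier G" and i: "i \<le> e" for i j g h
  proof -
    have gh: "g \<otimes>\<^bsub>G\<^esub> h \<in> carrier G" by (rule topological_group_mult_closed[OF G g h])
    have "[b (g \<otimes>\<^bsub>G\<^esub> h) = b g + t g * b h] (mod p ^ m)"
      using B(3)[OF g h] by (simp add: b t g h gh flip: cong_int_iff)
    moreover have "[t (g \<otimes>\<^bsub>G\<^esub> h) = t g * t h] (mod p ^ m)"
      using orientation_residue(5)[OF p0 \<theta> g h, of m] by (simp add: t g h gh flip: cong_int_iff)
    ultimately have "trunc_cong p e (aff_poly (b (g \<otimes>\<^bsub>G\<^esub> h)) (t (g \<otimes>\<^bsub>G\<^esub> h)) j) (aff_poly (b g + t g * b h) (t g * t h) j)"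
      by (rule aff_poly_cong[OF p em])
    then show ?thesis
      using i by (simp add: trunc_cong_def s_def aff_poly_matrix_mult)
  qed
  have diag: "[s j j g = 1] (mod int p)" "[s j (Suc j) g = \<epsilon> g] (mod int p)" if g: "g \<in> carrier G" for j g
  proof -
    show "[s j j g = 1] (mod int p)" unfolding s_def by (rule aff_poly_diagonals(1)[OF t1[OF g] t2[OF g]])
    have "[s j (Suc j) g = int (b g)] (mod int p)" unfolding s_def by (rule aff_poly_diagonals(2)[OF t1[OF g] t2[OF g]])
    then show "[s j (Suc j) g = \<epsilon> g] (mod int p)" unfolding b[OF g] using B(2)[OF g] by (rule cong_trans)
  qed
  have s_cont: "(\<lambda>g\<in>carrier G. (- s j i g) mod int p) \<in> C1 p G" for i j
    by (rule C1I[OF G p0 _ orientation_continuous[OF \<theta>, of m], where f = B and D = "{0..<int (p ^ m)}"])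
       (use B(1) in \<open>simp_all add: C1_iff[OF G] s_def b_def t_def\<close>)
  \<comment> \<open>The sign turns $I + W$ into $I - c$, and the indices are reflected in the antidiagonal because the substitution matrices multiply in the reverse order.\<close>
  define c where "c i j = (\<lambda>g\<in>carrier G. (- s (e - Suc j) (e - i) g) mod int p)" for i j
  have "unipotent_system p G a e c"
    unfolding unipotent_system_def
  proof (intro allI impI conjI ballI)
    fix i j assume ij: "a \<le> i \<and> i \<le> j \<and> j < e"
    show "c i j \<in> C1 p G" unfolding c_def by (rule s_cont)
    fix g h assume g: "g \<in> carrier G" and h: "h \<in> carrier G"
    let ?u = "e - Suc j" and ?v = "e - i"
    have cg: "[c i j x = - s (e - Suc j) (e - i) x] (mod int p)" if "x \<in> carrier G" for i j x
      using that by (simp add: c_def)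
    have uv: "?u < ?v" using ij by linarith
    have "(\<Sum>k=?u..?v. s ?u k h * s k ?v g) = s ?u ?u h * s ?u ?v g + (\<Sum>k=Suc ?u..<?v. s ?u k h * s k ?v g) + s ?u ?v h * s ?v ?v g"
    proof -
      have "{?u..?v} = insert ?u (insert ?v {Suc ?u..<?v})" using uv by auto
      then show ?thesis using uv by simp
    qed
    also have "(\<Sum>k=Suc ?u..<?v. s ?u k h * s k ?v g) = (\<Sum>l=i..<j. s (e - Suc l) ?v g * s ?u (e - Suc l) h)"
      by (rule sum.reindex_bij_witness[of _ "\<lambda>l. e - Suc l" "\<lambda>k. e - Suc k"]) (use ij in auto)
    finally have "[s ?u ?v (g \<otimes>\<^bsub>G\<^esub> h) = s ?u ?u h * s ?u ?v g + (\<Sum>l=i..<j. s (e - Suc l) ?v g * s ?u (e - Suc l) h) + s ?u ?v h * s ?v ?v g] (mod int p)"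
      using s_mult[OF g h, of ?v ?u] by simp
    also have "[s ?u ?u h * s ?u ?v g + (\<Sum>l=i..<j. s (e - Suc l) ?v g * s ?u (e - Suc l) h) + s ?u ?v h * s ?v ?v g =
       1 * s ?u ?v g + (\<Sum>l=i..<j. s (e - Suc l) ?v g * s ?u (e - Suc l) h) + s ?u ?v h * 1] (mod int p)"
      using diag(1) g h by (intro cong_add cong_mult cong_refl)
    finally have S: "[s ?u ?v (g \<otimes>\<^bsub>G\<^esub> h) = s ?u ?v g + s ?u ?v h + (\<Sum>l=i..<j. s (e - Suc l) ?v g * s ?u (e - Suc l) h)] (mod int p)"
      by (simp add: algebra_simps)
    have "[c i j (g \<otimes>\<^bsub>G\<^esub> h) = - s ?u ?v (g \<otimes>\<^bsub>G\<^esub> h)] (mod int p)"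
      by (rule cg[OF topological_group_mult_closed[OF G g h]])
    also have "[- s ?u ?v (g \<otimes>\<^bsub>G\<^esub> h) = - (s ?u ?v g + s ?u ?v h + (\<Sum>l=i..<j. s (e - Suc l) ?v g * s ?u (e - Suc l) h))] (mod int p)"
      using S by (simp only: cong_minus_minus_iff)
    also have "- (s ?u ?v g + s ?u ?v h + (\<Sum>l=i..<j. s (e - Suc l) ?v g * s ?u (e - Suc l) h)) =
       (- s ?u ?v g) + (- s ?u ?v h) - (\<Sum>l=i..<j. (- s (e - Suc l) ?v g) * (- s ?u (e - Suc l) h))"
      by simp
    also have "[(- s ?u ?v g) + (- s ?u ?v h) - (\<Sum>l=i..<j. (- s (e - Suc l) ?v g) * (- s ?u (e - Suc l) h)) =
       c i j g + c i j h - (\<Sum>l=i..<j. c i l g * c (Suc l) j h)] (mod int p)"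
      using g h by (intro cong_add cong_diff cong_sum cong_mult cong_sym[OF cg])
    finally show "[c i j (g \<otimes>\<^bsub>G\<^esub> h) = c i j g + c i j h - (\<Sum>l=i..<j. c i l g * c (Suc l) j h)] (mod int p)" .
  qed
  moreover have "c i i = (\<lambda>g\<in>carrier G. (- \<epsilon> g) mod int p)" if i: "i \<in> {a..<e}" for i
    unfolding c_def
  proof (rule restrict_ext)
    fix g assume g: "g \<in> carrier G"
    have "e - i = Suc (e - Suc i)" using i by auto
    then have "[- s (e - Suc i) (e - i) g = - \<epsilon> g] (mod int p)"
      using diag(2)[OF g, of "e - Suc i"] by (simp only: cong_minus_minus_iff)
    then show "(- s (e - Suc i) (e - i) g) mod int p = (- \<epsilon> g) mod int p" by (simp add: cong_def)
  qed
  ultimately have "massey_lift p G a e (\<lambda>i. \<lambda>g\<in>carrier G. (- \<epsilon> g) mod int p)"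
    by (auto simp: massey_lift_def)
  from massey_lift_scale[OF G p0 this, of "\<lambda>i. - r i"]
  have "massey_lift p G a e (\<lambda>i. \<lambda>g\<in>carrier G. (- r i * ((\<lambda>g\<in>carrier G. (- \<epsilon> g) mod int p) g)) mod int p)" .
  moreover have "(\<lambda>g\<in>carrier G. (- r i * ((\<lambda>g\<in>carrier G. (- \<epsilon> g) mod int p) g)) mod int p) = (\<lambda>g\<in>carrier G. (r i * \<epsilon> g) mod int p)" for i
  proof (rule restrict_ext)
    fix g assume "g \<in> carrier G"
    moreover have "[- r i * ((- \<epsilon> g) mod int p) = - r i * (- \<epsilon> g)] (mod int p)" by (intro cong_mult) auto
    ultimately show "(- r i * ((\<lambda>g\<in>carrier G. (- \<epsilon> g) mod int p) g)) mod int p = (r i * \<epsilon> g) mod int p" by (simp add: cong_def)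
  qed
  ultimately show ?thesis by simp
qed

section \<open>Semidirect products\<close>

definition Zp_scale :: "nat \<Rightarrow> nat \<Rightarrow> (nat \<Rightarrow> int) \<Rightarrow> nat \<Rightarrow> int" where
  "Zp_scale p k y = (\<lambda>n. (int k * y n) mod int p ^ n)"

lemma Zp_scale_closed: "p > 0 \<Longrightarrow> y \<in> carrier (Zp p) \<Longrightarrow> Zp_scale p k y \<in> carrier (Zp p)"
  unfolding Zp_scale_def using Zp_mod by (intro ZpI cong_mult) auto

lemma Zp_scale_Suc: "Zp_scale p (Suc k) y = Zp_scale p k y \<oplus>\<^bsub>Zp p\<^esub> y"
  by (rule ext) (simp add: Zp_scale_def Zp_simps distrib_right mod_add_right_eq add.commute)

lemma Zp_zero_closed: "p > 0 \<Longrightarrow> \<zero>\<^bsub>Zp p\<^esub> \<in> carrier (Zp p)"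
  by (simp add: Zp_def)

lemma Zp_one_closed: "p > 0 \<Longrightarrow> \<one>\<^bsub>Zp p\<^esub> \<in> carrier (Zp p)"
  using ZpI[of p "\<lambda>_. 1"] by (simp add: Zp_def)

lemma Zp_residue: "x \<in> carrier (Zp p) \<Longrightarrow> x n mod int p ^ n = x n"
  by (simp add: Zp_carrier)

lemma Zp_eqI: "x \<in> carrier (Zp p) \<Longrightarrow> y \<in> carrier (Zp p) \<Longrightarrow> (\<And>n. [x n = y n] (mod int p ^ n)) \<Longrightarrow> x = y"
  by (rule ext) (metis Zp_residue cong_def)

lemma one_plus_scale:
  "x \<in> one_plus p k \<Longrightarrow> \<exists>y\<in>carrier (Zp p). x = \<one>\<^bsub>Zp p\<^esub> \<oplus>\<^bsub>Zp p\<^esub> Zp_scale p (p ^ k) y"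
proof -
  have "[(p ^ k)] \<cdot>\<^bsub>Zp p\<^esub> y = Zp_scale p (p ^ k) y" for y
    by (rule ext) (simp add: Zp_scale_def Zp_add_pow)
  then show "x \<in> one_plus p k \<Longrightarrow> ?thesis" by (auto simp: one_plus_def)
qed

text \<open>For \<open>\<beta> = 0\<close> this says that additive maps commute with multiples; in general \<open>\<gamma>\<close> is a
  cochain with coboundary $\alpha\cdot\beta$ along $\mathbb{Z}_p$, and the binomial coefficient counts the
  correction terms.\<close>

lemma Zp_quadratic_scale:
  assumes p: "p > 0" and y: "y \<in> carrier (Zp p)"
    and add: "\<And>x z. x \<in> carrier (Zp p) \<Longrightarrow> z \<in> carrier (Zp p) \<Longrightarrow>
       [\<gamma> (x \<oplus>\<^bsub>Zp p\<^esub> z) = \<gamma> x + \<gamma> z - \<alpha> x * \<beta> z] (mod int p)"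
    and add_\<alpha>: "\<And>x z. x \<in> carrier (Zp p) \<Longrightarrow> z \<in> carrier (Zp p) \<Longrightarrow>
       [\<alpha> (x \<oplus>\<^bsub>Zp p\<^esub> z) = \<alpha> x + \<alpha> z] (mod int p)"
  shows "[\<alpha> (Zp_scale p k y) = int k * \<alpha> y] (mod int p) \<and>
    [\<gamma> (Zp_scale p k y) = int k * \<gamma> y - int (k choose 2) * (\<alpha> y * \<beta> y)] (mod int p)"
proof (induction k)
  case 0
  have z: "Zp_scale p 0 y = \<zero>\<^bsub>Zp p\<^esub>" by (simp add: Zp_scale_def Zp_def)
  have zz: "\<zero>\<^bsub>Zp p\<^esub> \<oplus>\<^bsub>Zp p\<^esub> \<zero>\<^bsub>Zp p\<^esub> = \<zero>\<^bsub>Zp p\<^esub>" by (rule ext) (simp add: Zp_simps)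
  have "[\<alpha> \<zero>\<^bsub>Zp p\<^esub> = 0] (mod int p)"
    using add_\<alpha>[OF Zp_zero_closed[OF p] Zp_zero_closed[OF p]] unfolding zz
    by (simp add: cong_iff_dvd_diff)
  moreover from this have "[\<alpha> \<zero>\<^bsub>Zp p\<^esub> * \<beta> \<zero>\<^bsub>Zp p\<^esub> = 0 * \<beta> \<zero>\<^bsub>Zp p\<^esub>] (mod int p)"
    by (intro cong_mult cong_refl)
  then have "[\<gamma> \<zero>\<^bsub>Zp p\<^esub> = 0] (mod int p)"
    using add[OF Zp_zero_closed[OF p] Zp_zero_closed[OF p]] unfolding zz
    by (simp add: cong_iff_dvd_diff) (metis add.commute diff_add_cancel dvd_add_right_iff)
  ultimately show ?case using z by (simp add: binomial_eq_0)
next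
  case (Suc k)
  have k: "Zp_scale p k y \<in> carrier (Zp p)" by (rule Zp_scale_closed[OF p y])
  have "[\<alpha> (Zp_scale p (Suc k) y) = \<alpha> (Zp_scale p k y) + \<alpha> y] (mod int p)"
    unfolding Zp_scale_Suc by (rule add_\<alpha>[OF k y])
  also have "[\<alpha> (Zp_scale p k y) + \<alpha> y = int k * \<alpha> y + \<alpha> y] (mod int p)"
    using Suc.IH by (intro cong_add) auto
  finally have "[\<alpha> (Zp_scale p (Suc k) y) = int (Suc k) * \<alpha> y] (mod int p)" by (simp add: algebra_simps)
  moreover have "[\<gamma> (Zp_scale p (Suc k) y) = \<gamma> (Zp_scale p k y) + \<gamma> y - \<alpha> (Zp_scale p k y) * \<beta> y] (mod int p)"
    unfolding Zp_scale_Suc by (rule add[OF k y])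
  moreover have "[\<gamma> (Zp_scale p k y) + \<gamma> y - \<alpha> (Zp_scale p k y) * \<beta> y =
      (int k * \<gamma> y - int (k choose 2) * (\<alpha> y * \<beta> y)) + \<gamma> y - (int k * \<alpha> y) * \<beta> y] (mod int p)"
    using Suc.IH by (intro cong_add cong_diff cong_mult) auto
  moreover have "(int k * \<gamma> y - int (k choose 2) * (\<alpha> y * \<beta> y)) + \<gamma> y - (int k * \<alpha> y) * \<beta> y =
      int (Suc k) * \<gamma> y - int (Suc k choose 2) * (\<alpha> y * \<beta> y)"
    by (simp add: numeral_2_eq_2 algebra_simps)
  ultimately show ?case using cong_trans by metis
qed

text \<open>Write $a = a_1\cdot 1 + p y$, where $a_1$ is the residue modulo \<open>p\<close>; an additive map to
  $\mathbb{F}_p$ kills $p y$.\<close>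

lemma Zp_character:
  assumes p: "p > 0" and a: "a \<in> carrier (Zp p)"
    and add: "\<And>x z. x \<in> carrier (Zp p) \<Longrightarrow> z \<in> carrier (Zp p) \<Longrightarrow>
       [\<alpha> (x \<oplus>\<^bsub>Zp p\<^esub> z) = \<alpha> x + \<alpha> z] (mod int p)"
  shows "[\<alpha> a = a 1 * \<alpha> \<one>\<^bsub>Zp p\<^esub>] (mod int p)"
proof -
  have scale: "[\<alpha> (Zp_scale p k y) = int k * \<alpha> y] (mod int p)" if "y \<in> carrier (Zp p)" for k y
    using Zp_quadratic_scale[OF p that, where \<alpha> = \<alpha> and \<beta> = "\<lambda>_. 0" and \<gamma> = \<alpha>] add by simp
  \<comment> \<open>Division by \<open>p\<close> loses one digit, hence the shift of the index.\<close>
  define F where "F n = (a (Suc n) - a 1) div int p" for n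
  have F: "int p * F n = a (Suc n) - a 1" for n
    using Zp_mod[OF a, of 1 "Suc n"] by (simp add: F_def cong_iff_dvd_diff)
  have y: "(\<lambda>n. F n mod int p ^ n) \<in> carrier (Zp p)" (is "?y \<in> _")
  proof (rule ZpI[OF p])
    fix n
    have "int p ^ Suc n dvd int p * F (Suc n) - int p * F n"
      using Zp_mod[OF a, of "Suc n" "Suc (Suc n)"] by (simp add: F cong_iff_dvd_diff)
    then have "int p * int p ^ n dvd int p * (F (Suc n) - F n)" by (simp add: algebra_simps)
    then show "[F (Suc n) = F n] (mod int p ^ n)" using p by (simp add: cong_iff_dvd_diff)
  qed
  have a1: "0 \<le> a 1" using a by (simp add: Zp_carrier)
  have one: "\<one>\<^bsub>Zp p\<^esub> \<in> carrier (Zp p)" by (rule Zp_one_closed[OF p])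
  have "a = Zp_scale p (nat (a 1)) \<one>\<^bsub>Zp p\<^esub> \<oplus>\<^bsub>Zp p\<^esub> Zp_scale p p ?y"
  proof (rule Zp_eqI[OF a])
    show "Zp_scale p (nat (a 1)) \<one>\<^bsub>Zp p\<^esub> \<oplus>\<^bsub>Zp p\<^esub> Zp_scale p p ?y \<in> carrier (Zp p)"
      by (intro Zp_closed Zp_scale_closed p y one)
    fix n
    have "[(Zp_scale p (nat (a 1)) \<one>\<^bsub>Zp p\<^esub> \<oplus>\<^bsub>Zp p\<^esub> Zp_scale p p ?y) n =
        (a 1 * (1 mod int p ^ n)) mod int p ^ n + (int p * (F n mod int p ^ n)) mod int p ^ n] (mod int p ^ n)"
      using a1 by (simp add: Zp_simps Zp_scale_def)
    also have "[(a 1 * (1 mod int p ^ n)) mod int p ^ n + (int p * (F n mod int p ^ n)) mod int p ^ n = a 1 * 1 + int p * F n] (mod int p ^ n)"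
      by (intro cong_add) (auto simp: cong_def mod_mult_right_eq)
    also have "a 1 * 1 + int p * F n = a (Suc n)" by (simp add: F)
    also have "[a (Suc n) = a n] (mod int p ^ n)" using Zp_mod[OF a, of n "Suc n"] by simp
    finally show "[a n = (Zp_scale p (nat (a 1)) \<one>\<^bsub>Zp p\<^esub> \<oplus>\<^bsub>Zp p\<^esub> Zp_scale p p ?y) n] (mod int p ^ n)"
      by (rule cong_sym)
  qed
  then have "[\<alpha> a = \<alpha> (Zp_scale p (nat (a 1)) \<one>\<^bsub>Zp p\<^esub>) + \<alpha> (Zp_scale p p ?y)] (mod int p)"
    using add[OF Zp_scale_closed[OF p one] Zp_scale_closed[OF p y]] by metis
  also have "[\<alpha> (Zp_scale p (nat (a 1)) \<one>\<^bsub>Zp p\<^esub>) + \<alpha> (Zp_scale p p ?y) = int (nat (a 1)) * \<alpha> \<one>\<^bsub>Zp p\<^esub> + int p * \<alpha> ?y] (mod int p)"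
    by (intro cong_add scale one y)
  also have "[int (nat (a 1)) * \<alpha> \<one>\<^bsub>Zp p\<^esub> + int p * \<alpha> ?y = a 1 * \<alpha> \<one>\<^bsub>Zp p\<^esub> + 0] (mod int p)"
    using a1 by (intro cong_add) (auto simp: cong_def)
  finally show ?thesis by simp
qed

text \<open>The value is idempotent and a unit.\<close>

lemma orientation_one:
  assumes p: "prime p" and G: "topological_group G" and \<theta>: "\<theta> \<in> cont_hom G (principal_units p)"
  shows "\<theta> \<one>\<^bsub>G\<^esub> = \<one>\<^bsub>Zp p\<^esub>"
proof (rule Zp_eqI)
  have p0: "p > 0" by (rule prime_gt_0_nat[OF p])
  interpret group G by (rule topological_group_group[OF G])
  note one = orientation_residue[OF p0 \<theta> one_closed]
  show "\<theta> \<one>\<^bsub>G\<^esub> \<in> carrier (Zp p)" "\<one>\<^bsub>Zp p\<^esub> \<in> carrier (Zp p)" using one Zp_one_closed[OF p0] by auto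
  fix n
  show "[\<theta> \<one>\<^bsub>G\<^esub> n = \<one>\<^bsub>Zp p\<^esub> n] (mod int p ^ n)"
  proof (cases "n = 0")
    case False
    have "coprime (\<theta> \<one>\<^bsub>G\<^esub> n) (int p ^ n)"
      using one(4)[of n] False by (metis One_nat_def Suc_leI cong_imp_coprime cong_sym coprime_1_left coprime_power_right_iff neq0_conv)
    moreover have "[\<theta> \<one>\<^bsub>G\<^esub> n * \<theta> \<one>\<^bsub>G\<^esub> n = 1 * \<theta> \<one>\<^bsub>G\<^esub> n] (mod int p ^ n)"
      using one(5)[OF one_closed, of n] by (simp add: cong_def) (metis mod_mod_trivial)
    ultimately have "[\<theta> \<one>\<^bsub>G\<^esub> n = 1] (mod int p ^ n)" using cong_mult_rcancel by blast
    then show ?thesis by (simp add: Zp_simps)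
  qed simp
qed

text \<open>The structure of $\mathbb{Z}_p \rtimes G_0$ transported to an isomorphic group \<open>G\<close>: the projection \<open>\<pi>\<close>
  to $G_0$ with its section \<open>s\<close>, the embedding \<open>t\<close> of $\mathbb{Z}_p$, and the first coordinate \<open>A\<close>,
  which is a twisted cocycle.\<close>

definition semidirect_split ::
  "nat \<Rightarrow> 'a topgroup \<Rightarrow> ('a \<Rightarrow> nat \<Rightarrow> int) \<Rightarrow> 'b topgroup \<Rightarrow> ('b \<Rightarrow> nat \<Rightarrow> int) \<Rightarrow>
   ('a \<Rightarrow> 'b) \<Rightarrow> ('b \<Rightarrow> 'a) \<Rightarrow> ('a \<Rightarrow> nat \<Rightarrow> int) \<Rightarrow> ((nat \<Rightarrow> int) \<Rightarrow> 'a) \<Rightarrow> bool" where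
  "semidirect_split p G \<theta> G0 \<theta>0 \<pi> s A t \<longleftrightarrow>
     \<pi> \<in> cont_hom G G0 \<and> s \<in> cont_hom G0 G \<and>
     (\<forall>x\<in>carrier G. A x \<in> carrier (Zp p)) \<and> continuous_map (gtop G) (Zp_top p) A \<and>
     (\<forall>x\<in>carrier G. \<forall>y\<in>carrier G. A (x \<otimes>\<^bsub>G\<^esub> y) = A x \<oplus>\<^bsub>Zp p\<^esub> (\<theta>0 (\<pi> x) \<otimes>\<^bsub>Zp p\<^esub> A y)) \<and>
     (\<forall>a\<in>carrier (Zp p). t a \<in> carrier G) \<and>
     (\<forall>a\<in>carrier (Zp p). \<forall>b\<in>carrier (Zp p). t (a \<oplus>\<^bsub>Zp p\<^esub> b) = t a \<otimes>\<^bsub>G\<^esub> t b) \<and>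
     (\<forall>x\<in>carrier G. x = t (A x) \<otimes>\<^bsub>G\<^esub> s (\<pi> x)) \<and>
     (\<forall>g\<in>carrier G0. \<forall>a\<in>carrier (Zp p). s g \<otimes>\<^bsub>G\<^esub> t a = t (\<theta>0 g \<otimes>\<^bsub>Zp p\<^esub> a) \<otimes>\<^bsub>G\<^esub> s g) \<and>
     (\<forall>x\<in>carrier G. \<theta> x = \<theta>0 (\<pi> x)) \<and> (\<forall>g\<in>carrier G0. \<theta> (s g) = \<theta>0 g)"

lemma semidirect_split_exists:
  assumes p: "prime p" and G: "topological_group G" and G0: "topological_group G0"
    and \<theta>0: "\<theta>0 \<in> cont_hom G0 (principal_units p)"
    and iso: "oriented_iso (Zp_semidirect p G0 \<theta>0) (\<theta>0 \<circ> snd) G \<theta>"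
  shows "\<exists>\<pi> s A t. semidirect_split p G \<theta> G0 \<theta>0 \<pi> s A t"
proof -
  have p0: "p > 0" by (rule prime_gt_0_nat[OF p])
  let ?S = "Zp_semidirect p G0 \<theta>0"
  interpret G0: group G0 by (rule topological_group_group[OF G0])
  have carS: "carrier ?S = carrier (Zp p) \<times> carrier G0" by (simp add: Zp_semidirect_def)
  have multS: "(a, g) \<otimes>\<^bsub>?S\<^esub> (b, h) = (a \<oplus>\<^bsub>Zp p\<^esub> (\<theta>0 g \<otimes>\<^bsub>Zp p\<^esub> b), g \<otimes>\<^bsub>G0\<^esub> h)" for a b g h
    by (simp add: Zp_semidirect_def)
  have topS: "gtop ?S = prod_topology (Zp_top p) (gtop G0)" by (simp add: Zp_semidirect_def)
  obtain f where f: "f \<in> iso ?S G" "homeomorphic_map (gtop ?S) (gtop G) f" "\<And>x. x \<in> carrier ?S \<Longrightarrow> \<theta> (f x) = \<theta>0 (snd x)"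
    using iso by (auto simp: oriented_iso_def)
  have bij: "bij_betw f (carrier ?S) (carrier G)" using f(1) by (simp add: iso_def)
  have f_closed: "f (a, g) \<in> carrier G" if "a \<in> carrier (Zp p)" "g \<in> carrier G0" for a g
    using bij that by (auto simp: carS bij_betw_def)
  have f_mult: "f (a \<oplus>\<^bsub>Zp p\<^esub> (\<theta>0 g \<otimes>\<^bsub>Zp p\<^esub> b), g \<otimes>\<^bsub>G0\<^esub> h) = f (a, g) \<otimes>\<^bsub>G\<^esub> f (b, h)"
    if "a \<in> carrier (Zp p)" "g \<in> carrier G0" "b \<in> carrier (Zp p)" "h \<in> carrier G0" for a b g h
    using f(1) that by (simp add: iso_def hom_def carS flip: multS)
  define e where "e = inv_into (carrier ?S) f"
  have e_closed: "e x \<in> carrier (Zp p) \<times> carrier G0" and fe: "f (e x) = x" if "x \<in> carrier G" for x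
    using bij that by (auto simp: e_def bij_betw_def f_inv_into_f simp flip: carS intro: inv_into_into)
  have ef: "e (f x) = x" if "x \<in> carrier (Zp p) \<times> carrier G0" for x
    using bij that by (simp add: e_def bij_betw_def inv_into_f_f carS)
  have topspaceS: "topspace (gtop ?S) = carrier ?S"
    using G0 p0 by (auto simp: topS carS topspace_gtop Zp_top_def Zp_carrier)
  have cont_f: "continuous_map (gtop ?S) (gtop G) f" using f(2) by (rule homeomorphic_imp_continuous_map)
  have cont_e: "continuous_map (gtop G) (gtop ?S) e"
  proof -
    obtain e' where e': "homeomorphic_maps (gtop ?S) (gtop G) f e'" using f(2) homeomorphic_map_maps by blast
    have "continuous_map (gtop G) (gtop ?S) e'" using e' by (simp add: homeomorphic_maps_def)
    moreover have "e' x = e x" if x: "x \<in> carrier G" for x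
    proof -
      have "e' (f (e x)) = e x"
        using e' e_closed[OF x] by (auto simp: homeomorphic_maps_def topspaceS carS)
      then show ?thesis by (simp add: fe[OF x])
    qed
    ultimately show ?thesis by (rule continuous_map_eq) (simp add: topspace_gtop[OF G])
  qed
  have Z0: "\<zero>\<^bsub>Zp p\<^esub> \<in> carrier (Zp p)" by (rule Zp_zero_closed[OF p0])
  have \<theta>Z: "\<theta>0 g \<in> carrier (Zp p)" if "g \<in> carrier G0" for g
    by (rule orientation_residue(1)[OF p0 \<theta>0 that])
  have add_zero: "a \<oplus>\<^bsub>Zp p\<^esub> (u \<otimes>\<^bsub>Zp p\<^esub> \<zero>\<^bsub>Zp p\<^esub>) = a" if "a \<in> carrier (Zp p)" for a u
    by (rule ext) (simp add: Zp_simps Zp_residue[OF that])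
  have zero_add: "\<zero>\<^bsub>Zp p\<^esub> \<oplus>\<^bsub>Zp p\<^esub> (u \<otimes>\<^bsub>Zp p\<^esub> a) = u \<otimes>\<^bsub>Zp p\<^esub> a" for a u
    by (rule ext) (simp add: Zp_simps)
  have one_mult: "\<one>\<^bsub>Zp p\<^esub> \<otimes>\<^bsub>Zp p\<^esub> a = a" if "a \<in> carrier (Zp p)" for a
  proof (rule Zp_eqI)
    show "[(\<one>\<^bsub>Zp p\<^esub> \<otimes>\<^bsub>Zp p\<^esub> a) n = a n] (mod int p ^ n)" for n
      by (simp add: Zp_simps cong_def mod_mult_left_eq)
  qed (use that Zp_closed(2)[OF p0 Zp_one_closed[OF p0] that] in auto)
  have \<theta>1: "\<theta>0 \<one>\<^bsub>G0\<^esub> = \<one>\<^bsub>Zp p\<^esub>" by (rule orientation_one[OF p G0 \<theta>0])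
  have e_mult: "e (x \<otimes>\<^bsub>G\<^esub> y) = (fst (e x) \<oplus>\<^bsub>Zp p\<^esub> (\<theta>0 (snd (e x)) \<otimes>\<^bsub>Zp p\<^esub> fst (e y)), snd (e x) \<otimes>\<^bsub>G0\<^esub> snd (e y))"
    if x: "x \<in> carrier G" and y: "y \<in> carrier G" for x y
  proof -
    obtain a g b h where eq: "e x = (a, g)" "e y = (b, h)" by (metis surj_pair)
    have mem: "a \<in> carrier (Zp p)" "g \<in> carrier G0" "b \<in> carrier (Zp p)" "h \<in> carrier G0"
      using e_closed[OF x] e_closed[OF y] eq by auto
    have "f (a \<oplus>\<^bsub>Zp p\<^esub> (\<theta>0 g \<otimes>\<^bsub>Zp p\<^esub> b), g \<otimes>\<^bsub>G0\<^esub> h) = x \<otimes>\<^bsub>G\<^esub> y"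
      using f_mult[OF mem] fe[OF x] fe[OF y] eq by simp
    then show ?thesis
      using ef[of "(a \<oplus>\<^bsub>Zp p\<^esub> (\<theta>0 g \<otimes>\<^bsub>Zp p\<^esub> b), g \<otimes>\<^bsub>G0\<^esub> h)"] mem \<theta>Z
      by (simp add: eq Zp_closed[OF p0])
  qed
  let ?\<pi> = "\<lambda>x. snd (e x)" and ?A = "\<lambda>x. fst (e x)" and ?s = "\<lambda>g. f (\<zero>\<^bsub>Zp p\<^esub>, g)" and ?t = "\<lambda>a. f (a, \<one>\<^bsub>G0\<^esub>)"
  have "?\<pi> \<in> cont_hom G G0"
  proof -
    have "continuous_map (gtop G) (gtop G0) (snd \<circ> e)"
      using cont_e unfolding topS by (rule continuous_map_compose) (rule continuous_map_snd)
    then show ?thesis using e_mult e_closed by (fastforce simp: cont_hom_def hom_def comp_def)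
  qed
  moreover have "?s \<in> cont_hom G0 G"
  proof -
    have "continuous_map (gtop G0) (gtop ?S) (\<lambda>g. (\<zero>\<^bsub>Zp p\<^esub>, g))"
      unfolding topS continuous_map_pairwise
      using Z0 by (auto simp: comp_def Zp_top_def Zp_carrier)
    from continuous_map_compose[OF this cont_f] have "continuous_map (gtop G0) (gtop G) ?s" by (simp add: comp_def)
    moreover have "?s (g \<otimes>\<^bsub>G0\<^esub> h) = ?s g \<otimes>\<^bsub>G\<^esub> ?s h" if "g \<in> carrier G0" "h \<in> carrier G0" for g h
      using f_mult[OF Z0 that(1) Z0 that(2)] by (simp add: add_zero[OF Z0])
    ultimately show ?thesis using f_closed[OF Z0] by (auto simp: cont_hom_def hom_def)
  qed
  moreover have "continuous_map (gtop G) (Zp_top p) ?A"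
  proof -
    have "continuous_map (gtop G) (Zp_top p) (fst \<circ> e)"
      using cont_e unfolding topS by (rule continuous_map_compose) (rule continuous_map_fst)
    then show ?thesis by (simp add: comp_def)
  qed
  moreover have "\<forall>x\<in>carrier G. ?A x \<in> carrier (Zp p)" using e_closed by (simp add: mem_Times_iff)
  moreover have "\<forall>x\<in>carrier G. \<forall>y\<in>carrier G. ?A (x \<otimes>\<^bsub>G\<^esub> y) = ?A x \<oplus>\<^bsub>Zp p\<^esub> (\<theta>0 (?\<pi> x) \<otimes>\<^bsub>Zp p\<^esub> ?A y)"
    by (simp add: e_mult)
  moreover have "\<forall>a\<in>carrier (Zp p). ?t a \<in> carrier G" using f_closed by simp
  moreover have "\<forall>a\<in>carrier (Zp p). \<forall>b\<in>carrier (Zp p). ?t (a \<oplus>\<^bsub>Zp p\<^esub> b) = ?t a \<otimes>\<^bsub>G\<^esub> ?t b"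
    using f_mult[OF _ G0.one_closed _ G0.one_closed] by (simp add: \<theta>1 one_mult)
  moreover have "\<forall>x\<in>carrier G. x = ?t (?A x) \<otimes>\<^bsub>G\<^esub> ?s (?\<pi> x)"
  proof
    fix x assume x: "x \<in> carrier G"
    have m: "?A x \<in> carrier (Zp p)" "?\<pi> x \<in> carrier G0" using e_closed[OF x] by (auto simp: mem_Times_iff)
    show "x = ?t (?A x) \<otimes>\<^bsub>G\<^esub> ?s (?\<pi> x)"
      using f_mult[OF m(1) G0.one_closed Z0 m(2)] fe[OF x] m by (simp add: add_zero)
  qed
  moreover have "\<forall>g\<in>carrier G0. \<forall>a\<in>carrier (Zp p). ?s g \<otimes>\<^bsub>G\<^esub> ?t a = ?t (\<theta>0 g \<otimes>\<^bsub>Zp p\<^esub> a) \<otimes>\<^bsub>G\<^esub> ?s g"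
  proof (intro ballI)
    fix g a assume g: "g \<in> carrier G0" and a: "a \<in> carrier (Zp p)"
    have ga: "\<theta>0 g \<otimes>\<^bsub>Zp p\<^esub> a \<in> carrier (Zp p)" by (rule Zp_closed(2)[OF p0 \<theta>Z[OF g] a])
    show "?s g \<otimes>\<^bsub>G\<^esub> ?t a = ?t (\<theta>0 g \<otimes>\<^bsub>Zp p\<^esub> a) \<otimes>\<^bsub>G\<^esub> ?s g"
      using f_mult[OF Z0 g a G0.one_closed] f_mult[OF ga G0.one_closed Z0 g] g by (simp add: zero_add add_zero[OF ga])
  qed
  moreover have "\<forall>x\<in>carrier G. \<theta> x = \<theta>0 (?\<pi> x)"
    using f(3) fe e_closed by (metis carS)
  moreover have "\<forall>g\<in>carrier G0. \<theta> (?s g) = \<theta>0 g"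
    using f(3) Z0 by (simp add: carS)
  ultimately have "semidirect_split p G \<theta> G0 \<theta>0 ?\<pi> ?s ?A ?t"
    unfolding semidirect_split_def by (intro conjI)
  then show ?thesis by blast
qed

context
  fixes p :: nat and G :: "'a topgroup" and \<theta> and G0 :: "'b topgroup" and \<theta>0 \<pi> s A t
  assumes p: "prime p" and G: "topological_group G" and G0: "topological_group G0"
    and \<theta>0: "\<theta>0 \<in> cont_hom G0 (principal_units p)"
    and split: "semidirect_split p G \<theta> G0 \<theta>0 \<pi> s A t"
begin

lemma split_facts:
  shows "\<pi> \<in> cont_hom G G0" "s \<in> cont_hom G0 G"
    "\<And>x. x \<in> carrier G \<Longrightarrow> A x \<in> carrier (Zp p)" "continuous_map (gtop G) (Zp_top p) A"
    "\<And>x y. x \<in> carrier G \<Longrightarrow> y \<in> carrier G \<Longrightarrow> A (x \<otimes>\<^bsub>G\<^esub> y) = A x \<oplus>\<^bsub>Zp p\<^esub> (\<theta>0 (\<pi> x) \<otimes>\<^bsub>Zp p\<^esub> A y)"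
    "\<And>a. a \<in> carrier (Zp p) \<Longrightarrow> t a \<in> carrier G"
    "\<And>a b. a \<in> carrier (Zp p) \<Longrightarrow> b \<in> carrier (Zp p) \<Longrightarrow> t (a \<oplus>\<^bsub>Zp p\<^esub> b) = t a \<otimes>\<^bsub>G\<^esub> t b"
    "\<And>x. x \<in> carrier G \<Longrightarrow> x = t (A x) \<otimes>\<^bsub>G\<^esub> s (\<pi> x)"
    "\<And>g a. g \<in> carrier G0 \<Longrightarrow> a \<in> carrier (Zp p) \<Longrightarrow> s g \<otimes>\<^bsub>G\<^esub> t a = t (\<theta>0 g \<otimes>\<^bsub>Zp p\<^esub> a) \<otimes>\<^bsub>G\<^esub> s g"
    "\<And>x. x \<in> carrier G \<Longrightarrow> \<theta> x = \<theta>0 (\<pi> x)" "\<And>g. g \<in> carrier G0 \<Longrightarrow> \<theta> (s g) = \<theta>0 g"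
  using split unfolding semidirect_split_def by blast+

lemma p_pos: "p > 0" by (rule prime_gt_0_nat[OF p])

text \<open>A character of \<open>G\<close> is determined by its value on the generator of $\mathbb{Z}_p$ and its restriction
  to the complement.\<close>

lemma split_H1:
  assumes \<alpha>: "\<alpha> \<in> H1 p G" and x: "x \<in> carrier G"
  shows "[\<alpha> x = A x 1 * \<alpha> (t \<one>\<^bsub>Zp p\<^esub>) + \<alpha> (s (\<pi> x))] (mod int p)"
proof -
  have hom: "[\<alpha> (g \<otimes>\<^bsub>G\<^esub> h) = \<alpha> g + \<alpha> h] (mod int p)" if "g \<in> carrier G" "h \<in> carrier G" for g h
    using \<alpha> that by (simp add: H1_iff[OF G p_pos])
  have Ax: "A x \<in> carrier (Zp p)" by (rule split_facts(3)[OF x])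
  have "[\<alpha> (t (A x)) = A x 1 * \<alpha> (t \<one>\<^bsub>Zp p\<^esub>)] (mod int p)"
    by (rule Zp_character[OF p_pos Ax, where \<alpha> = "\<lambda>a. \<alpha> (t a)"]) (simp add: split_facts(6,7) hom)
  moreover have "[\<alpha> x = \<alpha> (t (A x)) + \<alpha> (s (\<pi> x))] (mod int p)"
    using hom[of "t (A x)" "s (\<pi> x)"] split_facts(6)[OF Ax] cont_hom_closed[OF split_facts(2)]
      cont_hom_closed[OF split_facts(1) x] split_facts(8)[OF x] by simp
  ultimately show ?thesis using cong_add cong_refl cong_trans by blast
qed

text \<open>The coordinate \<open>A\<close> is itself a cocycle, so it lifts its own reduction; the rest is inflated
  from $G_0$.\<close>

lemma split_kummerian:
  assumes K: "kummerian p G0 \<theta>0"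
  shows "kummerian p G \<theta>"
  unfolding kummerian_def
proof (intro allI impI ballI)
  fix m :: nat and \<alpha> assume m: "m \<ge> 1" and \<alpha>: "\<alpha> \<in> H1 p G"
  obtain c0 where c0: "c0 \<in> C1 (p ^ m) G0" "\<And>g. g \<in> carrier G0 \<Longrightarrow> [c0 g = pull G0 s \<alpha> g] (mod int p)"
    "\<And>g h. g \<in> carrier G0 \<Longrightarrow> h \<in> carrier G0 \<Longrightarrow> [c0 (g \<otimes>\<^bsub>G0\<^esub> h) = c0 g + \<theta>0 g m * c0 h] (mod int p ^ m)"
    using kummerianD[OF K m pull_H1[OF G0 G p_pos split_facts(2) \<alpha>]] by blast
  let ?k = "\<alpha> (t \<one>\<^bsub>Zp p\<^esub>)"
  let ?c = "\<lambda>x\<in>carrier G. (?k * A x m + c0 (\<pi> x)) mod int (p ^ m)"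
  have c: "[?c x = ?k * A x m + c0 (\<pi> x)] (mod int p ^ m)" if "x \<in> carrier G" for x
    using that by simp
  show "\<exists>c\<in>C1 (p ^ m) G. \<forall>g\<in>carrier G. [c g = \<alpha> g] (mod int p) \<and>
     (\<forall>h\<in>carrier G. [c (g \<otimes>\<^bsub>G\<^esub> h) = c g + \<theta> g m * c h] (mod int p ^ m))"
  proof (intro bexI ballI conjI)
    show "?c \<in> C1 (p ^ m) G"
    proof (rule C1I[OF G, where f = "\<lambda>x. A x m" and g = "pull G \<pi> c0"])
      show "continuous_map (gtop G) (discrete_topology {0..<int p ^ m}) (\<lambda>x. A x m)"
        using continuous_map_compose[OF split_facts(4) Zp_residue_continuous] by (simp add: comp_def)
      show "continuous_map (gtop G) (discrete_topology {0..<int (p ^ m)}) (pull G \<pi> c0)"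
        using pull_cochain[OF G G0 split_facts(1) c0(1)] by (simp add: C1_iff[OF G])
    qed (use p_pos in \<open>simp_all add: pull_apply\<close>)
    fix x assume x: "x \<in> carrier G"
    have \<pi>x: "\<pi> x \<in> carrier G0" by (rule cont_hom_closed[OF split_facts(1) x])
    have "[?c x = ?k * A x m + c0 (\<pi> x)] (mod int p)"
      using c[OF x] by (rule cong_dvd_modulus) (use m in \<open>simp add: dvd_power\<close>)
    also have "[?k * A x m + c0 (\<pi> x) = ?k * A x 1 + \<alpha> (s (\<pi> x))] (mod int p)"
      using Zp_mod[OF split_facts(3)[OF x] m] c0(2)[OF \<pi>x]
      by (intro cong_add cong_mult cong_refl) (simp_all add: pull_apply \<pi>x)
    also have "[?k * A x 1 + \<alpha> (s (\<pi> x)) = \<alpha> x] (mod int p)"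
      using split_H1[OF \<alpha> x] by (simp add: cong_sym_eq mult.commute)
    finally show "[?c x = \<alpha> x] (mod int p)" .
    fix y assume y: "y \<in> carrier G"
    have \<pi>y: "\<pi> y \<in> carrier G0" by (rule cont_hom_closed[OF split_facts(1) y])
    have xy: "x \<otimes>\<^bsub>G\<^esub> y \<in> carrier G" by (rule topological_group_mult_closed[OF G x y])
    have "[?c (x \<otimes>\<^bsub>G\<^esub> y) = ?k * A (x \<otimes>\<^bsub>G\<^esub> y) m + c0 (\<pi> (x \<otimes>\<^bsub>G\<^esub> y))] (mod int p ^ m)" by (rule c[OF xy])
    also have "[?k * A (x \<otimes>\<^bsub>G\<^esub> y) m + c0 (\<pi> (x \<otimes>\<^bsub>G\<^esub> y)) =
        ?k * (A x m + \<theta>0 (\<pi> x) m * A y m) + (c0 (\<pi> x) + \<theta>0 (\<pi> x) m * c0 (\<pi> y))] (mod int p ^ m)"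
    proof (intro cong_add cong_mult cong_refl)
      show "[A (x \<otimes>\<^bsub>G\<^esub> y) m = A x m + \<theta>0 (\<pi> x) m * A y m] (mod int p ^ m)"
        by (simp add: split_facts(5)[OF x y] Zp_simps cong_def mod_add_right_eq)
      show "[c0 (\<pi> (x \<otimes>\<^bsub>G\<^esub> y)) = c0 (\<pi> x) + \<theta>0 (\<pi> x) m * c0 (\<pi> y)] (mod int p ^ m)"
        using c0(3)[OF \<pi>x \<pi>y] by (simp add: cont_hom_mult[OF split_facts(1) x y])
    qed
    also have "?k * (A x m + \<theta>0 (\<pi> x) m * A y m) + (c0 (\<pi> x) + \<theta>0 (\<pi> x) m * c0 (\<pi> y)) =
       (?k * A x m + c0 (\<pi> x)) + \<theta> x m * (?k * A y m + c0 (\<pi> y))"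
      by (simp add: split_facts(10)[OF x] algebra_simps)
    also have "[(?k * A x m + c0 (\<pi> x)) + \<theta> x m * (?k * A y m + c0 (\<pi> y)) = ?c x + \<theta> x m * ?c y] (mod int p ^ m)"
      by (intro cong_add cong_mult cong_refl cong_sym[OF c] x y)
    finally show "[?c (x \<otimes>\<^bsub>G\<^esub> y) = ?c x + \<theta> x m * ?c y] (mod int p ^ m)" .
  qed
qed

text \<open>Let \<open>z\<close> be the image of the generator of $\mathbb{Z}_p$ and evaluate a cochain \<open>c\<close> with coboundary
  $\alpha\cdot\beta$ on both sides of $s(g)\,z = z^{\theta(g)}\,s(g)$.  Since $\theta(g) = 1 + p^k y$ and
  $p$ divides $\binom{p^k}{2}$, the cochain does not distinguish \<open>z\<close> from its power, and what remains is
  the commutator relation below.  For \<open>p = 2\<close> the binomial coefficient is even only from $k = 2$ on, which is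
  where $\mathrm{Im}(\theta) \subseteq 1 + 4\mathbb{Z}_2$ enters.\<close>

lemma split_cup_zero:
  assumes 4: "p = 2 \<Longrightarrow> \<theta> ` carrier G \<subseteq> one_plus 2 2"
    and \<alpha>: "\<alpha> \<in> H1 p G" and \<beta>: "\<beta> \<in> H1 p G" and cup: "cup_zero p G \<alpha> \<beta>" and g: "g \<in> carrier G0"
  shows "[\<alpha> (s g) * \<beta> (t \<one>\<^bsub>Zp p\<^esub>) = \<alpha> (t \<one>\<^bsub>Zp p\<^esub>) * \<beta> (s g)] (mod int p)"
proof -
  let ?e = "\<one>\<^bsub>Zp p\<^esub>"
  \<comment> \<open>The least \<open>k\<close> with $2 < p^k$, so that \<open>p\<close> divides the binomial coefficient.\<close>
  define k :: nat where "k = (if p = 2 then 2 else 1)"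
  have p2: "p \<ge> 2" by (rule prime_ge_2_nat[OF p])
  have k: "2 < p ^ k" using p2 by (auto simp: k_def)
  have k1: "k \<ge> 1" by (simp add: k_def)
  have "\<theta>0 g \<in> one_plus p k"
  proof (cases "p = 2")
    case True
    have "\<theta> (s g) \<in> one_plus 2 2" using 4[OF True] cont_hom_closed[OF split_facts(2) g] by blast
    then show ?thesis using True by (simp add: k_def split_facts(11)[OF g])
  next
    case False
    then show ?thesis using cont_hom_closed[OF \<theta>0 g] by (simp add: k_def principal_units_def)
  qed
  then obtain y where y: "y \<in> carrier (Zp p)" and \<theta>y: "\<theta>0 g = ?e \<oplus>\<^bsub>Zp p\<^esub> Zp_scale p (p ^ k) y"
    using one_plus_scale by blast
  define z where "z = Zp_scale p (p ^ k) y"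
  have z: "z \<in> carrier (Zp p)" unfolding z_def by (rule Zp_scale_closed[OF p_pos y])
  have e: "?e \<in> carrier (Zp p)" by (rule Zp_one_closed[OF p_pos])
  obtain c where c: "[c (x \<otimes>\<^bsub>G\<^esub> w) = c x + c w - \<alpha> x * \<beta> w] (mod int p)" if "x \<in> carrier G" "w \<in> carrier G" for x w
    using cup unfolding cup_zero_def by blast
  have \<alpha>_hom: "[\<alpha> (x \<otimes>\<^bsub>G\<^esub> w) = \<alpha> x + \<alpha> w] (mod int p)" and \<beta>_hom: "[\<beta> (x \<otimes>\<^bsub>G\<^esub> w) = \<beta> x + \<beta> w] (mod int p)"
    if "x \<in> carrier G" "w \<in> carrier G" for x w
    using \<alpha> \<beta> that by (simp_all add: H1_iff[OF G p_pos])
  have pk: "[int (p ^ k) * x = 0] (mod int p)" for x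
    using k1 by (simp add: cong_0_iff dvd_power)
  have quad: "[\<alpha> (t z) = int (p ^ k) * \<alpha> (t y)] (mod int p) \<and>
      [c (t z) = int (p ^ k) * c (t y) - int (p ^ k choose 2) * (\<alpha> (t y) * \<beta> (t y))] (mod int p)"
    unfolding z_def
    by (rule Zp_quadratic_scale[OF p_pos y, where \<alpha> = "\<lambda>a. \<alpha> (t a)" and \<beta> = "\<lambda>a. \<beta> (t a)" and \<gamma> = "\<lambda>a. c (t a)"])
       (simp_all add: split_facts(6,7) c \<alpha>_hom)
  have \<alpha>z: "[\<alpha> (t z) = 0] (mod int p)" using quad pk cong_trans by blast
  have "[\<beta> (t z) = int (p ^ k) * \<beta> (t y)] (mod int p) \<and>
      [\<beta> (t z) = int (p ^ k) * \<beta> (t y) - int (p ^ k choose 2) * (\<beta> (t y) * 0)] (mod int p)"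
    unfolding z_def
    by (rule Zp_quadratic_scale[OF p_pos y, where \<alpha> = "\<lambda>a. \<beta> (t a)" and \<beta> = "\<lambda>a. 0" and \<gamma> = "\<lambda>a. \<beta> (t a)"])
       (simp_all add: split_facts(6,7) \<beta>_hom)
  then have \<beta>z: "[\<beta> (t z) = 0] (mod int p)" using pk cong_trans by blast
  have "p dvd (p ^ k choose 2)" by (rule prime_dvd_prime_power_choose[OF p _ k]) simp
  then have "int p dvd int (p ^ k choose 2)" by presburger
  then have "[int (p ^ k choose 2) * (\<alpha> (t y) * \<beta> (t y)) = 0] (mod int p)" by (simp add: cong_0_iff)
  with pk[of "c (t y)"] have "[int (p ^ k) * c (t y) - int (p ^ k choose 2) * (\<alpha> (t y) * \<beta> (t y)) = 0 - 0] (mod int p)"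
    by (rule cong_diff)
  then have cz: "[c (t z) = 0] (mod int p)" using quad cong_trans by fastforce
  have \<theta>t: "t (\<theta>0 g) = t ?e \<otimes>\<^bsub>G\<^esub> t z" unfolding \<theta>y z_def[symmetric] by (rule split_facts(7)[OF e z])
  have "[c (t (\<theta>0 g)) = c (t ?e) + c (t z) - \<alpha> (t ?e) * \<beta> (t z)] (mod int p)"
    unfolding \<theta>t by (rule c[OF split_facts(6)[OF e] split_facts(6)[OF z]])
  also have "[c (t ?e) + c (t z) - \<alpha> (t ?e) * \<beta> (t z) = c (t ?e) + 0 - \<alpha> (t ?e) * 0] (mod int p)"
    by (intro cong_add cong_diff cong_mult cong_refl cz \<beta>z)
  finally have c\<theta>: "[c (t (\<theta>0 g)) = c (t ?e)] (mod int p)" by simp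
  have "[\<alpha> (t (\<theta>0 g)) = \<alpha> (t ?e) + \<alpha> (t z)] (mod int p)"
    unfolding \<theta>t by (rule \<alpha>_hom[OF split_facts(6)[OF e] split_facts(6)[OF z]])
  also have "[\<alpha> (t ?e) + \<alpha> (t z) = \<alpha> (t ?e) + 0] (mod int p)" by (intro cong_add cong_refl \<alpha>z)
  finally have \<alpha>\<theta>: "[\<alpha> (t (\<theta>0 g)) = \<alpha> (t ?e)] (mod int p)" by simp
  have \<theta>Z: "\<theta>0 g \<in> carrier (Zp p)" by (rule orientation_residue(1)[OF p_pos \<theta>0 g])
  have "\<theta>0 g \<otimes>\<^bsub>Zp p\<^esub> ?e = \<theta>0 g"
    by (rule ext) (simp add: Zp_simps mod_mult_right_eq Zp_residue[OF \<theta>Z])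
  then have conj: "s g \<otimes>\<^bsub>G\<^esub> t ?e = t (\<theta>0 g) \<otimes>\<^bsub>G\<^esub> s g" using split_facts(9)[OF g e] by simp
  have sg: "s g \<in> carrier G" by (rule cont_hom_closed[OF split_facts(2) g])
  have 1: "[c (s g \<otimes>\<^bsub>G\<^esub> t ?e) = c (s g) + c (t ?e) - \<alpha> (s g) * \<beta> (t ?e)] (mod int p)"
    by (rule c[OF sg split_facts(6)[OF e]])
  have "[c (s g \<otimes>\<^bsub>G\<^esub> t ?e) = c (t (\<theta>0 g)) + c (s g) - \<alpha> (t (\<theta>0 g)) * \<beta> (s g)] (mod int p)"
    unfolding conj by (rule c[OF split_facts(6)[OF \<theta>Z] sg])
  also have "[c (t (\<theta>0 g)) + c (s g) - \<alpha> (t (\<theta>0 g)) * \<beta> (s g) = c (t ?e) + c (s g) - \<alpha> (t ?e) * \<beta> (s g)] (mod int p)"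
    by (intro cong_add cong_diff cong_mult cong_refl c\<theta> \<alpha>\<theta>)
  finally have "[c (s g) + c (t ?e) - \<alpha> (s g) * \<beta> (t ?e) = c (t ?e) + c (s g) - \<alpha> (t ?e) * \<beta> (s g)] (mod int p)"
    using 1 cong_sym cong_trans by blast
  then have "[(c (s g) + c (t ?e)) - \<alpha> (s g) * \<beta> (t ?e) = (c (s g) + c (t ?e)) - \<alpha> (t ?e) * \<beta> (s g)] (mod int p)"
    by (simp add: add.commute)
  then have "int p dvd \<alpha> (t ?e) * \<beta> (s g) - \<alpha> (s g) * \<beta> (t ?e)"
    by (simp add: cong_iff_dvd_diff)
  then show ?thesis by (simp add: cong_iff_dvd_diff dvd_diff_commute)
qed

text \<open>Write $\alpha_i = k_i\varphi + \alpha_i^0$ with $\varphi$ the first coordinate modulo \<open>p\<close> and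
  $\alpha_i^0$ inflated from $G_0$.  Vanishing cup products give
  $k_{i+1}\alpha_i^0 = k_i\alpha_{i+1}^0$.  If $k_i = 0 \neq k_{i+1}$ or conversely, one of the two
  characters is 0; hence on a segment of nonzero characters either all $k_i$ vanish, and the problem is
  inflated from $G_0$, or none does, and all $\alpha_i$ are the multiples $k_i\varepsilon$ of one character
  \<open>\<epsilon>\<close>, to which the cyclotomic construction applies.\<close>

lemma split_massey_liftable:
  assumes \<theta>: "\<theta> \<in> cont_hom G (principal_units p)" and 4: "p = 2 \<Longrightarrow> \<theta> ` carrier G \<subseteq> one_plus 2 2"
    and K: "kummerian p G \<theta>" and L: "massey_liftable p G0"
  shows "massey_liftable p G"
  unfolding massey_liftable_def
proof (intro allI impI, elim conjE)
  fix a b :: nat and \<alpha> assume \<alpha>: "\<forall>i\<in>{a..<b}. \<alpha> i \<in> H1 p G" 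
    and cup: "\<forall>i. a \<le> i \<and> Suc i < b \<longrightarrow> cup_zero p G (\<alpha> i) (\<alpha> (Suc i))"
  have e: "\<one>\<^bsub>Zp p\<^esub> \<in> carrier (Zp p)" by (rule Zp_one_closed[OF p_pos])
  define k where "k i = \<alpha> i (t \<one>\<^bsub>Zp p\<^esub>)" for i
  show "massey_lift p G a b \<alpha>"
  proof (rule massey_lift_if_zero_free[OF G p_pos])
    fix a' b' assume ab: "a \<le> a'" "b' \<le> b" and nz: "\<forall>i\<in>{a'..<b'}. \<alpha> i \<noteq> (\<lambda>g\<in>carrier G. 0)"
    have \<alpha>': "\<alpha> i \<in> H1 p G" "\<alpha> i \<in> C1 p G" if "a' \<le> i" "i < b'" for i
      using \<alpha> ab that by (auto simp: H1_iff[OF G p_pos])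
    have k_mod: "[k i = 0] (mod int p) \<longleftrightarrow> k i = 0" if "a' \<le> i" "i < b'" for i
      using C1_range(3)[OF G \<alpha>'(2)[OF that] split_facts(6)[OF e]] by (simp add: k_def cong_def)
    have k_coprime: "coprime (k i) (int p)" if "a' \<le> i" "i < b'" "k i \<noteq> 0" for i
    proof (rule ccontr)
      assume "\<not> coprime (k i) (int p)"
      then have "int p dvd k i" using p prime_imp_coprime[of "int p" "k i"] by (auto simp: coprime_commute)
      then show False using k_mod[OF that(1,2)] that(3) by (simp add: cong_0_iff)
    qed
    have rel: "[\<alpha> i (s g) * k (Suc i) = k i * \<alpha> (Suc i) (s g)] (mod int p)"
      if "a' \<le> i" "Suc i < b'" "g \<in> carrier G0" for i g
      unfolding k_def using \<alpha>' cup ab that by (intro split_cup_zero[OF 4]) auto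
    have nonzero: False if i: "a' \<le> i" "i < b'" and k0: "k i = 0" and s0: "\<And>g. g \<in> carrier G0 \<Longrightarrow> [\<alpha> i (s g) = 0] (mod int p)" for i
    proof -
      have "\<alpha> i = (\<lambda>g\<in>carrier G. 0)"
      proof (rule C1_eqI[OF G \<alpha>'(2)[OF i] C1_zero[OF G p_pos]])
        fix x assume x: "x \<in> carrier G"
        have "[\<alpha> i x = A x 1 * k i + \<alpha> i (s (\<pi> x))] (mod int p)"
          unfolding k_def by (rule split_H1[OF \<alpha>'(1)[OF i] x])
        also have "[A x 1 * k i + \<alpha> i (s (\<pi> x)) = A x 1 * k i + 0] (mod int p)"
          by (intro cong_add cong_refl s0 cont_hom_closed[OF split_facts(1) x])
        finally show "[\<alpha> i x = (\<lambda>g\<in>carrier G. 0) x] (mod int p)" using k0 x by simp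
      qed
      then show False using nz i by auto
    qed
    \<comment> \<open>If exactly one of two neighbours involves the first coordinate, the commutator relation kills the other one.\<close>
    have k_step: "k i = 0 \<longleftrightarrow> k (Suc i) = 0" if i: "a' \<le> i" "Suc i < b'" for i
    proof
      assume k0: "k i = 0"
      show "k (Suc i) = 0"
      proof (rule ccontr)
        assume k1: "k (Suc i) \<noteq> 0"
        have cop: "coprime (k (Suc i)) (int p)" using i k1 by (intro k_coprime) auto
        have "[\<alpha> i (s g) = 0] (mod int p)" if "g \<in> carrier G0" for g
        proof -
          have "[\<alpha> i (s g) * k (Suc i) = 0 * k (Suc i)] (mod int p)" using rel[OF i that] k0 by simp
          then show ?thesis using cop cong_mult_rcancel by blast
        qed
        then show False using nonzero[of i] i k0 by simp
      qed
    next
      assume k0: "k (Suc i) = 0"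
      show "k i = 0"
      proof (rule ccontr)
        assume k1: "k i \<noteq> 0"
        have cop: "coprime (k i) (int p)" using i k1 by (intro k_coprime) auto
        have "[\<alpha> (Suc i) (s g) = 0] (mod int p)" if "g \<in> carrier G0" for g
        proof -
          have "[k i * \<alpha> (Suc i) (s g) = k i * 0] (mod int p)" using cong_sym[OF rel[OF i that]] k0 by simp
          then show ?thesis using cop cong_mult_lcancel by blast
        qed
        then show False using nonzero[of "Suc i"] i k0 by simp
      qed
    qed
    have k_all: "i < b' \<Longrightarrow> (k i = 0 \<longleftrightarrow> k a' = 0)" if "a' \<le> i" for i
      using that by (induction i rule: dec_induct) (use k_step in auto)
    show "massey_lift p G a' b' \<alpha>"
    proof (cases "k a' = 0")
      case True
      have "massey_lift p G0 a' b' (\<lambda>i. pull G0 s (\<alpha> i))"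
      proof (rule massey_liftableD[OF L])
        show "\<forall>i\<in>{a'..<b'}. pull G0 s (\<alpha> i) \<in> H1 p G0"
          using \<alpha>'(1) by (auto intro: pull_H1[OF G0 G p_pos split_facts(2)])
        show "\<forall>i. a' \<le> i \<and> Suc i < b' \<longrightarrow> cup_zero p G0 (pull G0 s (\<alpha> i)) (pull G0 s (\<alpha> (Suc i)))"
          using cup ab by (auto intro!: pull_cup_zero[OF G0 G split_facts(2)])
      qed
      then have lift: "massey_lift p G a' b' (\<lambda>i. pull G \<pi> (pull G0 s (\<alpha> i)))"
        by (rule pull_massey_lift[OF G G0 split_facts(1)])
      have "pull G \<pi> (pull G0 s (\<alpha> i)) = \<alpha> i" if i: "i \<in> {a'..<b'}" for i
      proof (rule C1_eqI[OF G _ \<alpha>'(2)])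
        show "pull G \<pi> (pull G0 s (\<alpha> i)) \<in> C1 p G"
          using i by (intro pull_cochain[OF G G0 split_facts(1)] pull_cochain[OF G0 G split_facts(2)] \<alpha>'(2)) auto
        fix x assume x: "x \<in> carrier G"
        have "[\<alpha> i x = A x 1 * k i + \<alpha> i (s (\<pi> x))] (mod int p)"
          unfolding k_def using i by (intro split_H1[OF \<alpha>'(1) x]) auto
        moreover have "k i = 0" using k_all[of i] True i by simp
        ultimately show "[pull G \<pi> (pull G0 s (\<alpha> i)) x = \<alpha> i x] (mod int p)"
          using cont_hom_closed[OF split_facts(1) x] x by (simp add: pull_apply cong_sym_eq)
      qed (use i in auto)
      with lift show ?thesis by (rule massey_lift_cong)
    next
      case False
      show ?thesis
      proof (cases "a' < b'")
        case True
        have k_nz: "k i \<noteq> 0" if "a' \<le> i" "i < b'" for i using k_all[OF that] False by simp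
        \<comment> \<open>Normalise the first character so that its value on the generator becomes 1.\<close>
        obtain u where u: "[k a' * u = 1] (mod int p)"
          using k_coprime[of a'] True False cong_solve_coprime_int by blast
        define \<epsilon> where "\<epsilon> = (\<lambda>g\<in>carrier G. (u * \<alpha> a' g) mod int p)"
        have \<epsilon>: "\<epsilon> \<in> H1 p G" unfolding \<epsilon>_def using True by (intro H1_scale[OF G p_pos] \<alpha>'(1)) auto
        have ratio: "i < b' \<Longrightarrow> [\<alpha> i (s g) * k a' = k i * \<alpha> a' (s g)] (mod int p)" if "a' \<le> i" "g \<in> carrier G0" for i g
          using that(1)
        proof (induction i rule: dec_induct)
          case base
          show ?case by (simp add: mult.commute)
        next
          case (step i)
          have "[k i * (\<alpha> (Suc i) (s g) * k a') = (k i * \<alpha> (Suc i) (s g)) * k a'] (mod int p)" by (simp add: mult.assoc)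
          also have "[(k i * \<alpha> (Suc i) (s g)) * k a' = (\<alpha> i (s g) * k (Suc i)) * k a'] (mod int p)"
            by (intro cong_mult cong_refl cong_sym[OF rel] step.hyps step.prems that(2))
          also have "(\<alpha> i (s g) * k (Suc i)) * k a' = (\<alpha> i (s g) * k a') * k (Suc i)" by simp
          also have "[(\<alpha> i (s g) * k a') * k (Suc i) = (k i * \<alpha> a' (s g)) * k (Suc i)] (mod int p)"
            by (rule cong_mult[OF step.IH cong_refl]) (use step.prems in simp)
          also have "(k i * \<alpha> a' (s g)) * k (Suc i) = k i * (k (Suc i) * \<alpha> a' (s g))" by simp
          finally show ?case
            using k_coprime[of i] k_nz[of i] step.hyps step.prems cong_mult_lcancel by auto
        qed
        have "massey_lift p G a' b' (\<lambda>i. \<lambda>g\<in>carrier G. (k i * \<epsilon> g) mod int p)"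
          by (rule massey_lift_proportional[OF p G \<theta> 4 K \<epsilon>])
        moreover have "(\<lambda>g\<in>carrier G. (k i * \<epsilon> g) mod int p) = \<alpha> i" if i: "i \<in> {a'..<b'}" for i
        proof (rule C1_eqI[OF G _ \<alpha>'(2)])
          show "(\<lambda>g\<in>carrier G. (k i * \<epsilon> g) mod int p) \<in> C1 p G"
            using H1_scale[OF G p_pos \<epsilon>] by (simp add: H1_iff[OF G p_pos])
          fix x assume x: "x \<in> carrier G"
          have \<pi>x: "\<pi> x \<in> carrier G0" by (rule cont_hom_closed[OF split_facts(1) x])
          let ?w = "\<pi> x"
          have "[k i * \<epsilon> x = k i * (u * \<alpha> a' x)] (mod int p)"
            using x by (intro cong_mult cong_refl) (simp add: \<epsilon>_def)
          also have "[k i * (u * \<alpha> a' x) = k i * (u * (A x 1 * k a' + \<alpha> a' (s ?w)))] (mod int p)"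
            unfolding k_def using True by (intro cong_mult cong_refl split_H1[OF \<alpha>'(1) x]) auto
          also have "k i * (u * (A x 1 * k a' + \<alpha> a' (s ?w))) = (A x 1 * k i) * (k a' * u) + u * (k i * \<alpha> a' (s ?w))"
            by (simp add: algebra_simps)
          also have "[(A x 1 * k i) * (k a' * u) + u * (k i * \<alpha> a' (s ?w)) = (A x 1 * k i) * 1 + u * (\<alpha> i (s ?w) * k a')] (mod int p)"
            by (rule cong_add[OF cong_mult[OF cong_refl u] cong_mult[OF cong_refl cong_sym[OF ratio]]]) (use i \<pi>x in auto)
          also have "(A x 1 * k i) * 1 + u * (\<alpha> i (s ?w) * k a') = A x 1 * k i + \<alpha> i (s ?w) * (k a' * u)" by simp
          also have "[A x 1 * k i + \<alpha> i (s ?w) * (k a' * u) = A x 1 * k i + \<alpha> i (s ?w) * 1] (mod int p)"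
            using u by (intro cong_add cong_mult cong_refl)
          also have "[A x 1 * k i + \<alpha> i (s ?w) * 1 = \<alpha> i x] (mod int p)"
            using split_H1[OF \<alpha>'(1) x, of i] i by (simp add: k_def cong_sym_eq)
          finally show "[(\<lambda>g\<in>carrier G. (k i * \<epsilon> g) mod int p) x = \<alpha> i x] (mod int p)" using x by simp
        qed (use i in auto)
        ultimately show ?thesis by (rule massey_lift_cong)
      next
        case False
        then show ?thesis by (auto simp: massey_lift_def unipotent_system_def)
      qed
    qed
  qed
qed

end

section \<open>Groups of elementary type\<close>

text \<open>The Kummerian property has to be carried along because the semidirect product step draws on it.  The condition at \<open>p = 2\<close> is an assumption
  of the last part alone, and it passes to the constituents because the orientation restricts to theirs.\<close>

lemma elementary_type_invariant:
  assumes p: "prime p" and E: "elementary_type p G \<theta>"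
  shows "oriented_pro_p p G \<theta> \<and> kummerian p G \<theta> \<and>
    ((p = 2 \<longrightarrow> \<theta> ` carrier G \<subseteq> one_plus 2 2) \<longrightarrow> massey_liftable p G)"
  using E
proof (induction rule: elementary_type.induct)
  case (free X F \<theta>)
  then show ?case
    using kummerian_free[OF p] massey_liftable_free[OF p] by (auto simp: oriented_pro_p_def)
next
  case (demushkin G \<theta>)
  have pro: "pro_p_group p G" using demushkin(1) unfolding demushkin_def by blast
  show ?case
    using pro demushkin kummerian_canonical[OF pro_p_topological_group[OF pro] prime_gt_0_nat[OF p]] massey_liftable_demushkin[OF p]
    by (auto simp: oriented_pro_p_def canonical_orientation_def)
next
  case (semidirect G0 \<theta>0 G \<theta>)
  have G: "topological_group G" and \<theta>: "\<theta> \<in> cont_hom G (principal_units p)"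
    using semidirect.hyps by (auto simp: oriented_pro_p_def pro_p_topological_group)
  have G0: "topological_group G0" and \<theta>0: "\<theta>0 \<in> cont_hom G0 (principal_units p)"
    using semidirect.IH by (auto simp: oriented_pro_p_def pro_p_topological_group)
  obtain \<pi> s A t where split: "semidirect_split p G \<theta> G0 \<theta>0 \<pi> s A t"
    using semidirect_split_exists[OF p G G0 \<theta>0 semidirect.hyps(3)] by blast
  note facts = split_facts[OF p G G0 \<theta>0 split]
  have K: "kummerian p G \<theta>"
    using split_kummerian[OF p G G0 \<theta>0 split] semidirect.IH by blast
  moreover have "massey_liftable p G" if 4: "p = 2 \<longrightarrow> \<theta> ` carrier G \<subseteq> one_plus 2 2"
  proof -
    have "p = 2 \<longrightarrow> \<theta>0 ` carrier G0 \<subseteq> one_plus 2 2"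
      using 4 facts(11) cont_hom_closed[OF facts(2)] by (metis image_subset_iff)
    then have "massey_liftable p G0" using semidirect.IH by blast
    then show ?thesis using split_massey_liftable[OF p G G0 \<theta>0 split \<theta> _ K] 4 by blast
  qed
  ultimately show ?case using semidirect.hyps(2) by blast
next
  case (free_product G1 \<theta>1 G2 \<theta>2 G \<theta> \<iota>1 \<iota>2)
  have \<theta>: "\<theta> \<in> cont_hom G (principal_units p)"
    using free_product.hyps by (auto simp: oriented_pro_p_def)
  have G1: "topological_group G1" and G2: "topological_group G2"
    and \<theta>1: "\<theta>1 \<in> cont_hom G1 (principal_units p)" and \<theta>2: "\<theta>2 \<in> cont_hom G2 (principal_units p)"
    using free_product.IH by (auto simp: oriented_pro_p_def pro_p_topological_group)
  have \<iota>: "\<iota>1 \<in> cont_hom G1 G" "\<iota>2 \<in> cont_hom G2 G"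
    using free_product.hyps by (auto simp: free_pro_p_product_def)
  have "kummerian p G \<theta>"
    using kummerian_free_product[OF p free_product.hyps(4) G1 G2 \<theta> \<theta>1 free_product.hyps(5) \<theta>2 free_product.hyps(6)]
      free_product.IH by blast
  moreover have "massey_liftable p G" if 4: "p = 2 \<longrightarrow> \<theta> ` carrier G \<subseteq> one_plus 2 2"
  proof -
    have "p = 2 \<longrightarrow> \<theta>1 ` carrier G1 \<subseteq> one_plus 2 2" "p = 2 \<longrightarrow> \<theta>2 ` carrier G2 \<subseteq> one_plus 2 2"
      using 4 free_product.hyps(5,6) cont_hom_closed[OF \<iota>(1)] cont_hom_closed[OF \<iota>(2)]
      by (metis image_subset_iff)+
    then show ?thesis
      using massey_liftable_free_product[OF p free_product.hyps(4) G1 G2] free_product.IH by blast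
  qed
  ultimately show ?case using free_product.hyps(3) by blast
qed

theorem theorem1p2:
  fixes p n :: nat and G :: "'a topgroup" and \<theta> :: "'a \<Rightarrow> nat \<Rightarrow> int"
  assumes "prime p"
    and "elementary_type p G \<theta>"
    and "p = 2 \<Longrightarrow> \<theta> ` carrier G \<subseteq> one_plus 2 2"
    and "n > 2"
  shows "strong_massey_vanishing p n G"
proof -
  have "massey_liftable p G" "topological_group G"
    using elementary_type_invariant[OF assms(1,2)] assms(3)
    by (auto simp: oriented_pro_p_def pro_p_topological_group)
  then show ?thesis
    using assms(4) by (intro strong_massey_vanishing_if_liftable prime_gt_0_nat[OF assms(1)]) auto
qed

end
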